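(* Let $\alpha\in\mathbb{R}\setminus\mathbb{Q}$, let $v(x)=\sum_{k=-d}^d\hat v_ke^{2\pi ikx}$ be a real-valued trigonometric polynomial of degree $d\ge1$, and let $E\in\mathbb{R}$. If the dual cocycle $(\alpha,L_{E,v})$ is $PH2$, then there do not exist $B\in C^\omega(\mathbb{R}/\mathbb{Z},SL(2,\mathbb{R}))$ and $\psi\in C^\omega(\mathbb{R}/\mathbb{Z},\mathbb{R})$ with $\int_0^1\psi(x)dx=0$ such that $B(x+\alpha)^{-1}S_E^v(x)B(x)=R_{\psi(x)}$ for all $x$.
   Context: $S_E^v(x)=\begin{pmatrix}E-v(x)&-1\\1&0\end{pmatrix}$; $R_\theta=\begin{pmatrix}\cos2\pi\theta&-\sin2\pi\theta\\ \sin2\pi\theta&\cos2\pi\theta\end{pmatrix}$. The dual cocycle $(\alpha,L_{E,v})$ is $(\theta,w)\mapsto(\theta+\alpha,L_{E,v}(\theta)w)$, where $L_{E,v}(\theta)$ is the $2d\times2d$ matrix with first row $\frac1{\hat v_d}(-\hat v_{d-1},\dots,-\hat v_1,E-2\cos2\pi\theta-\hat v_0,-\hat v_{-1},\dots,-\hat v_{-d})$ and $(j+1)$-th row $e_j^T$ ($j=1,\dots,2d-1$); it is the transfer matrix of $\sum_k\hat v_ku_{n+k}+2\cos2\pi(\theta+n\alpha)u_n=Eu_n$. A cocycle $(\alpha,A)$ on $\mathbb{C}^m$ is $k$-dominated if there is a continuous invariant splitting $\mathbb{C}^m=E^+(\theta)\oplus E^-(\theta)$, $\dim E^+=k$, and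 $N\ge1$ with $\|A_N(\theta)u\|>\|A_N(\theta)w\|$ for all $\theta$ and unit $u\in E^+(\theta)$, $w\in E^-(\theta)$, where $A_N(\theta)=A(\theta+(N-1)\alpha)\cdots A(\theta)$. A $2d$-dimensional cocycle is $PH2$ if it is $(d-1)$-dominated and $(d+1)$-dominated. *)

theory Defs
  imports "HOL-Analysis.Analysis" "Jordan_Normal_Form.Determinant"
begin

definition trigpoly :: "(int \<Rightarrow> complex) \<Rightarrow> nat \<Rightarrow> real \<Rightarrow> complex" where
  "trigpoly vh d x = (\<Sum>k\<in>{- int d..int d}. vh k * exp (2 * complex_of_real pi * \<i> * of_int k * complex_of_real x))"

definition real_analytic :: "(real \<Rightarrow> real) \<Rightarrow> bool" where
  "real_analytic f \<longleftrightarrow> (\<forall>x. \<exists>r>0. \<exists>c::nat \<Rightarrow> real.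
      \<forall>y. \<bar>y - x\<bar> < r \<longrightarrow> (\<lambda>n. c n * (y - x) ^ n) sums f y)"

definition analytic_periodic :: "(real \<Rightarrow> real) \<Rightarrow> bool" where
  "analytic_periodic f \<longleftrightarrow> real_analytic f \<and> (\<forall>x. f (x + 1) = f x)"

definition SE :: "real \<Rightarrow> (real \<Rightarrow> real) \<Rightarrow> real \<Rightarrow> real^2^2" where
  "SE E v x = vector [vector [E - v x, -1], vector [1, 0]]"

definition Rot :: "real \<Rightarrow> real^2^2" where
  "Rot t = vector [vector [cos (2*pi*t), - sin (2*pi*t)], vector [sin (2*pi*t), cos (2*pi*t)]]"

definition analytic_SL2 :: "(real \<Rightarrow> real^2^2) \<Rightarrow> bool" where
  "analytic_SL2 B \<longleftrightarrow> (\<forall>i j. analytic_periodic (\<lambda>x. B x $ i $ j)) \<and>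
      (\<forall>x. Determinants.det (B x) = 1)"

text \<open>The dual transfer matrix L_{E,v}(theta), of size 2d x 2d (0-indexed rows/columns).
  First row: (1/vh d) (-vh(d-1),...,-vh 1, E - 2cos(2 pi theta) - vh 0, -vh(-1),...,-vh(-d));
  row i+1 is the i-th standard unit row vector.\<close>
definition dualL :: "real \<Rightarrow> (int \<Rightarrow> complex) \<Rightarrow> nat \<Rightarrow> real \<Rightarrow> complex mat" where
  "dualL E vh d \<theta> = mat (2*d) (2*d) (\<lambda>(i,j).
     if i = 0 then
       (if j + 1 = d then complex_of_real E - complex_of_real (2 * cos (2*pi*\<theta>)) - vh 0
        else - vh (int d - 1 - int j)) / vh (int d)
     else if j + 1 = i then 1 else 0)"

fun cociter :: "nat \<Rightarrow> real \<Rightarrow> (real \<Rightarrow> complex mat) \<Rightarrow> nat \<Rightarrow> real \<Rightarrow> complex mat" where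
  "cociter m \<alpha> A 0 \<theta> = 1\<^sub>m m"
| "cociter m \<alpha> A (Suc n) \<theta> = A (\<theta> + real n * \<alpha>) * cociter m \<alpha> A n \<theta>"

definition cvnorm :: "complex vec \<Rightarrow> real" where
  "cvnorm u = sqrt (\<Sum>i<dim_vec u. (cmod (u $ i))\<^sup>2)"

definition cspan :: "nat \<Rightarrow> (nat \<Rightarrow> complex vec) \<Rightarrow> nat \<Rightarrow> complex vec set" where
  "cspan m fr k = {Matrix.vec m (\<lambda>j. \<Sum>i<k. c i * fr i $ j) | c. True}"

text \<open>k-domination of the cocycle (alpha, A) on C^m.  The splitting
  C^m = Ep(theta) (+) Em(theta) is over R/Z (1-periodic in theta), invariant
  (A(theta) Ep(theta) = Ep(theta+alpha), same for Em), and continuous in the sense of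
  locally admitting continuous frames: near every theta0 there is a continuous basis
  fr 0, ..., fr (m-1) of C^m with Ep = span of the first k and Em = span of the last m-k
  (this also gives dim Ep = k and the direct sum decomposition).\<close>
definition dominated :: "nat \<Rightarrow> real \<Rightarrow> (real \<Rightarrow> complex mat) \<Rightarrow> nat \<Rightarrow> bool" where
  "dominated m \<alpha> A k \<longleftrightarrow> k \<le> m \<and>
    (\<exists>Ep Em :: real \<Rightarrow> complex vec set.
      (\<forall>\<theta>. Ep (\<theta> + 1) = Ep \<theta> \<and> Em (\<theta> + 1) = Em \<theta>) \<and>
      (\<forall>\<theta>0. \<exists>U. open U \<and> \<theta>0 \<in> U \<and> (\<exists>fr :: real \<Rightarrow> nat \<Rightarrow> complex vec.
          (\<forall>i<m. \<forall>j<m. continuous_on U (\<lambda>\<theta>. fr \<theta> i $ j)) \<and>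
          (\<forall>\<theta>\<in>U. (\<forall>i<m. fr \<theta> i \<in> carrier_vec m) \<and>
                 Determinant.det (mat_of_cols m (map (fr \<theta>) [0..<m])) \<noteq> 0 \<and>
                 Ep \<theta> = cspan m (fr \<theta>) k \<and>
                 Em \<theta> = cspan m (\<lambda>i. fr \<theta> (k + i)) (m - k)))) \<and>
      (\<forall>\<theta>. (\<lambda>u. A \<theta> *\<^sub>v u) ` Ep \<theta> = Ep (\<theta> + \<alpha>) \<and>
           (\<lambda>u. A \<theta> *\<^sub>v u) ` Em \<theta> = Em (\<theta> + \<alpha>)) \<and>
      (\<exists>N\<ge>1. \<forall>\<theta> u w. u \<in> Ep \<theta> \<longrightarrow> w \<in> Em \<theta> \<longrightarrow> cvnorm u = 1 \<longrightarrow> cvnorm w = 1 \<longrightarrow>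
          cvnorm (cociter m \<alpha> A N \<theta> *\<^sub>v u) > cvnorm (cociter m \<alpha> A N \<theta> *\<^sub>v w)))"

definition PH2 :: "nat \<Rightarrow> real \<Rightarrow> (real \<Rightarrow> complex mat) \<Rightarrow> bool" where
  "PH2 d \<alpha> A \<longleftrightarrow> dominated (2*d) \<alpha> A (d - 1) \<and> dominated (2*d) \<alpha> A (d + 1)"

end

theory Submission
  imports Defs "HOL-Complex_Analysis.Complex_Analysis"
begin

text \<open>
  Let \<open>f\<close> be the first row of \<open>B\<close> applied to the eigenvector \<open>(1, -i)\<close> of the rotations. If \<open>\<psi>\<close> were a
  coboundary \<open>\<phi>(x + \<alpha>) - \<phi>(x)\<close>, the Fourier coefficients of \<open>e\<^sup>2\<^sup>\<pi>\<^sup>i\<^sup>\<phi> f\<close> and of its complex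
  conjugate would be two independent exponentially decaying solutions of the dual equation at phase \<open>0\<close>.
  For Liouville \<open>\<alpha>\<close> this fails, but \<open>\<psi>\<close> can be truncated to frequencies below the denominator \<open>q\<close> of a
  best approximation of \<open>\<alpha>\<close>. The truncation is a coboundary of some \<open>\<phi>\<close> with weighted norm \<open>o(q)\<close>,
  since all its divisors are at least \<open>1/(2q)\<close>; hence one gets two solutions up to an error
  \<open>e\<^sup>-\<^sup>h\<^sup>q\<close> that are localised within \<open>o(q)\<close> of the origin and independent up to \<open>e\<^sup>o\<^sup>(\<^sup>q\<^sup>)\<close>. Their windows
  \<open>p1, p2\<close> at the origin are therefore contracted by both the forward and the backward dual cocycle over a time
  proportional to \<open>q\<close>.

  The dual cocycle preserves a nondegenerate form, for which isotropic spaces have dimension at most \<open>d\<close>.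
  In the \<open>(d+1)\<close>-dominated splitting \<open>E\<^sup>+ \<oplus> E\<^sup>-\<close>, the space \<open>E\<^sup>+\<close> over phase \<open>0\<close> is thus not
  isotropic. This bounds the cocycle along \<open>E\<^sup>-\<close> from any past time up to phase \<open>0\<close>, which forces
  \<open>p1, p2\<close> to be close to \<open>E\<^sup>+\<close>. By domination \<open>E\<^sup>-\<close> is then contracted in forward time at least as much as they are,
  so that \<open>E\<^sup>- + span(p1, p2)\<close> is almost isotropic although it has dimension \<open>d + 1\<close>.
\<close>

section \<open>Fourier coefficients\<close>

text \<open>Why \<open>o(q)\<close>: the coefficients of \<psi> decay at twice the rate of the
  weight in which \<phi> is measured. A fixed finite head of the sum is bounded independently of
  \<open>q\<close>; the tail is \<open>q\<close> times an arbitrarily small constant. Isotropy is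
  used quantitatively. A space of dimension above half contains some nonzero \<open>s\<close>
  together with \<open>J s\<close>, where \<open>J\<close> is the Gram matrix of the form. The form
  at \<open>(J s, s)\<close> has modulus |J s|^2, which is comparable to |s|^2 because
  \<open>J\<close> is invertible. Conservation of the form then forbids \<open>s\<close> and
  \<open>J s\<close> to shrink together. Both directions of time matter for the dimension count: a
  pair that decays only forward could sit inside E^- and add nothing to it. Backward decay makes its
  E^- component negligible. Independence of the two approximate solutions comes from
  \<open>det B = 1\<close>, read as a Wronskian of \<open>f\<close> and its conjugate. The windows
  inherit it because one window determines a solution, at the price of exponential growth over the
  \<open>o(q)\<close> sites that carry its mass. Thus all losses have rates as small as desired,
  against gains of fixed rate.\<close>

definition ee :: "int \<Rightarrow> real \<Rightarrow> complex" where
  "ee k x = cis (2 * pi * of_int k * x)"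

definition fc :: "(real \<Rightarrow> complex) \<Rightarrow> int \<Rightarrow> complex" where
  "fc g k = integral {0..1} (\<lambda>x. g x * ee (- k) x)"

lemma ee_add: "ee (j + k) x = ee j x * ee k x"
  by (simp add: ee_def cis_mult algebra_simps)

lemma ee_0 [simp]: "ee 0 x = 1" "ee k 0 = 1"
  by (simp_all add: ee_def)

lemma ee_add_arg: "ee k (x + y) = ee k x * ee k y"
  by (simp add: ee_def cis_mult algebra_simps)

lemma norm_ee [simp]: "cmod (ee k x) = 1"
  by (simp add: ee_def)

lemma cnj_ee: "cnj (ee k x) = ee (- k) x"
  by (simp add: ee_def cis_cnj)

lemma ee_of_int [simp]: "ee k (of_int m) = 1"
proof -
  have "2 * pi * of_int k * of_int m = 2 * pi * of_int (k * m)" by simp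
  then show ?thesis unfolding ee_def by (simp only: cis_multiple_2pi Ints_of_int)
qed

lemma ee_1 [simp]: "ee k 1 = 1"
  using ee_of_int[of k 1] by simp

lemma ee_periodic: "ee k (x + 1) = ee k x"
  by (simp add: ee_add_arg)

lemma continuous_on_ee [continuous_intros]:
  "continuous_on S f \<Longrightarrow> continuous_on S (\<lambda>x. ee k (f x))"
  unfolding ee_def by (intro continuous_intros)

lemma ee_has_vector_derivative:
  "(ee k has_vector_derivative (2 * pi * \<i> * of_int k * ee k x)) (at x within S)"
proof -
  have "((\<lambda>t. exp (t *\<^sub>R (2 * pi * \<i> * of_int k))) has_vector_derivative
      exp (x *\<^sub>R (2 * pi * \<i> * of_int k)) * (2 * pi * \<i> * of_int k)) (at x within S)"
    by (rule exp_scaleR_has_vector_derivative_right)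
  moreover have "exp (t *\<^sub>R (2 * pi * \<i> * of_int k)) = ee k t" for t
    unfolding ee_def cis_conv_exp by (simp add: scaleR_conv_of_real mult_ac)
  ultimately show ?thesis by (simp add: mult_ac)
qed


section \<open>Calculus of Fourier coefficients: linearity, products, translations\<close>

lemma fc_integrable:
  assumes "continuous_on {0..1} g"
  shows "(\<lambda>x. g x * ee k x) integrable_on {0..1}"
  by (intro integrable_continuous_real continuous_intros assms)

lemma fc_cong: "(\<And>x. x \<in> {0..1} \<Longrightarrow> f x = g x) \<Longrightarrow> fc f k = fc g k"
  unfolding fc_def by (rule integral_cong) auto

lemma fc_add:
  assumes "continuous_on {0..1} f" "continuous_on {0..1} g"
  shows "fc (\<lambda>x. f x + g x) k = fc f k + fc g k"
  unfolding fc_def using integral_add[OF fc_integrable[OF assms(1)] fc_integrable[OF assms(2)]]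
  by (simp add: ring_distribs)

lemma fc_cmult: "fc (\<lambda>x. c * f x) k = c * fc f k"
  unfolding fc_def by (simp add: mult.assoc)

lemma fc_diff:
  assumes "continuous_on {0..1} f" "continuous_on {0..1} g"
  shows "fc (\<lambda>x. f x - g x) k = fc f k - fc g k"
  unfolding fc_def using integral_diff[OF fc_integrable[OF assms(1)] fc_integrable[OF assms(2)]]
  by (simp add: ring_distribs)

lemma fc_sum:
  assumes "finite A" "\<And>i. i \<in> A \<Longrightarrow> continuous_on {0..1} (f i)"
  shows "fc (\<lambda>x. \<Sum>i\<in>A. f i x) k = (\<Sum>i\<in>A. fc (f i) k)"
  unfolding fc_def sum_distrib_right
  by (rule integral_sum) (use assms fc_integrable in auto)

lemma fc_ee_mult: "fc (\<lambda>x. ee l x * g x) k = fc g (k - l)"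
proof -
  have "ee (- (k - l)) x = ee l x * ee (- k) x" for x
    using ee_add[of l "- k" x] by simp
  then show ?thesis unfolding fc_def by (simp only: mult_ac)
qed

text \<open>Products become convolutions. With \<open>c = vh\<close> this is how the potential of
  the Schroedinger equation turns into the hopping of the dual one.\<close>

lemma fc_trig_mult:
  assumes "finite A" "continuous_on {0..1} g"
  shows "fc (\<lambda>x. (\<Sum>l\<in>A. c l * ee l x) * g x) k = (\<Sum>l\<in>A. c l * fc g (k - l))"
proof -
  have "fc (\<lambda>x. (\<Sum>l\<in>A. c l * ee l x) * g x) k = fc (\<lambda>x. \<Sum>l\<in>A. c l * (ee l x * g x)) k"
    by (simp add: sum_distrib_right mult.assoc)
  also have "\<dots> = (\<Sum>l\<in>A. fc (\<lambda>x. c l * (ee l x * g x)) k)"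
    by (rule fc_sum) (intro assms continuous_intros)+
  finally show ?thesis by (simp add: fc_cmult fc_ee_mult)
qed

lemma fc_cnj: "fc (\<lambda>x. cnj (g x)) k = cnj (fc g (- k))"
  unfolding fc_def integral_cnj by (simp add: cnj_ee)

lemma fc_bound:
  assumes "continuous_on {0..1} g" "\<And>x. x \<in> {0..1} \<Longrightarrow> cmod (g x) \<le> M"
  shows "cmod (fc g k) \<le> M"
proof -
  have "M \<ge> 0" using assms(2)[of 0] by (simp add: order_trans[OF norm_ge_zero])
  then have "cmod (fc g k) \<le> M * measure lborel (cbox 0 (1::real))"
    unfolding fc_def using integrable_integral[OF fc_integrable[OF assms(1)]] assms(2)
    by (intro has_integral_bound) (auto simp: norm_mult)
  then show ?thesis by simp
qed

lemma fc_one: "fc (\<lambda>x. 1) k = (if k = 0 then 1 else 0)"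
proof (cases "k = 0")
  case False
  have "(ee (- k) has_integral
      (ee (- k) 1 / (2 * pi * \<i> * of_int (- k)) - ee (- k) 0 / (2 * pi * \<i> * of_int (- k)))) {0..1}"
  proof (rule fundamental_theorem_of_calculus)
    fix x :: real
    have "((\<lambda>x. ee (- k) x / (2 * pi * \<i> * of_int (- k))) has_vector_derivative
        2 * pi * \<i> * of_int (- k) * ee (- k) x / (2 * pi * \<i> * of_int (- k))) (at x within {0..1})"
      by (intro has_vector_derivative_divide ee_has_vector_derivative)
    then show "((\<lambda>x. ee (- k) x / (2 * pi * \<i> * of_int (- k))) has_vector_derivative
        ee (- k) x) (at x within {0..1})" using False by simp
  qed simp
  then show ?thesis using False by (simp add: fc_def integral_unique)
qed (simp add: fc_def)

lemma fc_trig: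
  assumes "finite A"
  shows "fc (\<lambda>x. \<Sum>l\<in>A. c l * ee l x) k = (if k \<in> A then c k else 0)"
  using fc_trig_mult[OF assms, of "\<lambda>x. 1" c k] assms
  by (simp add: fc_one if_distrib[of "(*) _"] sum.delta cong: if_cong)

lemma integral_periodic_shift:
  fixes p :: "real \<Rightarrow> complex"
  assumes p: "continuous_on UNIV p" "\<And>x. p (x + 1) = p x" and a: "0 \<le> a" "a \<le> 1"
  shows "integral {0..1} (\<lambda>x. p (x + a)) = integral {0..1} p"
proof -
  have c: "continuous_on S p" for S using p(1) continuous_on_subset by blast
  have "integral {0..1} (\<lambda>x. p (x + a)) = integral {a..1 + a} p"
    using integral_shift[of 0 a 1 p] c by (simp add: o_def)
  also have "\<dots> = integral {a..1} p + integral {1..1 + a} p"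
    by (rule Henstock_Kurzweil_Integration.integral_combine[symmetric])
      (use a integrable_continuous_real[OF c] in auto)
  also have "integral {1..1 + a} p = integral {0..a} p"
    using integral_shift[of 0 1 a p] c p(2) by (simp add: o_def add.commute)
  also have "integral {a..1} p + integral {0..a} p = integral {0..1} p"
    using Henstock_Kurzweil_Integration.integral_combine[of 0 a 1 p] a integrable_continuous_real[OF c]
    by (simp add: add.commute)
  finally show ?thesis .
qed

lemma periodic_add_of_int:
  fixes p :: "real \<Rightarrow> 'a"
  assumes "\<And>x. p (x + 1) = p x"
  shows "p (x + of_int n) = p x"
proof -
  have nat: "p (y + of_nat m) = p y" for y m
    by (induction m arbitrary: y) (simp_all add: assms add.assoc[symmetric] add.commute[of 1])
  show ?thesis
  proof (cases "n \<ge> 0")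
    case True
    then show ?thesis using nat[of x "nat n"] by simp
  next
    case False
    then show ?thesis using nat[of "x + of_int n" "nat (- n)"] by simp
  qed
qed

text \<open>The phases of the translates by \<alpha> and by - \<alpha> add up to the cosine
  potential of the dual equation.\<close>

lemma fc_shift:
  assumes g: "continuous_on UNIV g" "\<And>x. g (x + 1) = g x"
  shows "fc (\<lambda>x. g (x + a)) k = ee k a * fc g k"
proof -
  let ?p = "\<lambda>x. g x * ee (- k) x"
  \<comment> \<open>The integral is shifted by amounts in \<open>[0, 1]\<close> only, so
    \<open>a\<close> is replaced by its fractional part; periodicity makes both sides blind to the
    difference.\<close>
  have g': "g (x + a) = g (x + frac a)" for x
    using periodic_add_of_int[of g "x + frac a" "\<lfloor>a\<rfloor>"] g(2) by (simp add: frac_def)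
  have e: "ee k a = ee k (frac a)"
    using periodic_add_of_int[of "ee k" "frac a" "\<lfloor>a\<rfloor>"] by (simp add: frac_def ee_periodic)
  have "integral {0..1} (\<lambda>x. ?p (x + frac a)) = integral {0..1} ?p"
    by (rule integral_periodic_shift) (auto simp: g ee_periodic frac_ge_0 less_imp_le[OF frac_lt_1]
      intro!: continuous_intros g(1))
  moreover have "g (x + a) * ee (- k) x = ee k a * ?p (x + frac a)" for x
    unfolding g' e ee_add_arg using ee_add[of k "- k" "frac a"] by (simp add: mult_ac)
  ultimately show ?thesis unfolding fc_def by simp
qed

section \<open>Bessel, Riemann-Lebesgue and pointwise inversion\<close>

text \<open>\<open>S\<close> is the orthogonal projection of \<open>H\<close> to the characters in
  \<open>F\<close>, so the squared norm of \<open>H\<close> is that of \<open>S\<close> plus that of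
  \<open>D = H - S\<close>.\<close>

lemma bessel_inequality:
  assumes H: "continuous_on {0..1} H" and F: "finite F"
  shows "(\<Sum>k\<in>F. (cmod (fc H k))\<^sup>2) \<le> integral {0..1} (\<lambda>x. (cmod (H x))\<^sup>2)"
proof -
  define S where "S x = (\<Sum>k\<in>F. fc H k * ee k x)" for x
  define D where "D x = H x - S x" for x
  have cS: "continuous_on {0..1} S" unfolding S_def by (intro continuous_intros)
  have cD: "continuous_on {0..1} D" unfolding D_def by (intro continuous_intros H cS)
  have S: "integral {0..1} (\<lambda>x. g x * cnj (S x)) = (\<Sum>k\<in>F. cnj (fc H k) * fc g k)"
    if "continuous_on {0..1} g" for g
  proof -
    have "g x * cnj (S x) = (\<Sum>k\<in>F. cnj (fc H k) * (g x * ee (- k) x))" for x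
      by (simp add: S_def cnj_ee sum_distrib_left mult_ac)
    then have "integral {0..1} (\<lambda>x. g x * cnj (S x))
        = (\<Sum>k\<in>F. integral {0..1} (\<lambda>x. cnj (fc H k) * (g x * ee (- k) x)))"
      by (simp only:) (intro integral_sum F integrable_continuous_real continuous_intros that)
    then show ?thesis by (simp add: fc_def)
  qed
  have fS: "fc S k = (if k \<in> F then fc H k else 0)" for k
    unfolding S_def using fc_trig[OF F] by simp
  have "fc D k = 0" if "k \<in> F" for k
    unfolding D_def using that by (simp add: fc_diff[OF H cS] fS)
  then have DS: "integral {0..1} (\<lambda>x. D x * cnj (S x)) = 0"
    by (simp add: S[OF cD])
  have "integral {0..1} (\<lambda>x. S x * cnj (S x)) = (\<Sum>k\<in>F. cnj (fc H k) * fc H k)"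
    by (simp add: S[OF cS] fS)
  also have "\<dots> = of_real (\<Sum>k\<in>F. (cmod (fc H k))\<^sup>2)"
    by (simp add: complex_norm_square mult.commute del: of_real_power)
  finally have SS: "integral {0..1} (\<lambda>x. S x * cnj (S x)) = of_real (\<Sum>k\<in>F. (cmod (fc H k))\<^sup>2)" .
  have eq: "(cmod (H x))\<^sup>2 = (cmod (D x))\<^sup>2 + (Re (S x * cnj (S x)) + 2 * Re (D x * cnj (S x)))" for x
    unfolding D_def cmod_power2 by (simp add: power2_eq_square algebra_simps)
  have Re: "integral {0..1} (\<lambda>x. Re (g x)) = Re (integral {0..1} g)"
    if "continuous_on {0..1} g" for g :: "real \<Rightarrow> complex"
    using integral_linear[OF integrable_continuous_real[OF that] bounded_linear_Re] by (simp add: o_def)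
  have i1: "(\<lambda>x. (cmod (D x))\<^sup>2) integrable_on {0..1}"
    by (intro integrable_continuous_real continuous_intros cD)
  have i2: "(\<lambda>x. Re (S x * cnj (S x))) integrable_on {0..1}"
    by (intro integrable_continuous_real continuous_intros cS)
  have i3: "(\<lambda>x. 2 * Re (D x * cnj (S x))) integrable_on {0..1}"
    by (intro integrable_continuous_real continuous_intros cS cD)
  have z3: "integral {0..1} (\<lambda>x. 2 * Re (D x * cnj (S x))) = 0"
    using Re[of "\<lambda>x. D x * cnj (S x)"] DS cS cD by (simp add: continuous_intros del: times_complex.sel)
  have z2: "integral {0..1} (\<lambda>x. Re (S x * cnj (S x))) = (\<Sum>k\<in>F. (cmod (fc H k))\<^sup>2)"
    using Re[of "\<lambda>x. S x * cnj (S x)"] SS cS by (simp add: continuous_intros del: times_complex.sel)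
  have "integral {0..1} (\<lambda>x. (cmod (H x))\<^sup>2)
      = integral {0..1} (\<lambda>x. (cmod (D x))\<^sup>2) + (\<Sum>k\<in>F. (cmod (fc H k))\<^sup>2)"
    unfolding eq
    by (subst integral_add, rule i1, rule integrable_add[OF i2 i3], subst integral_add[OF i2 i3],
      simp only: z2 z3 add_0_right)
  moreover have "0 \<le> integral {0..1} (\<lambda>x. (cmod (D x))\<^sup>2)"
    by (rule integral_nonneg[OF i1]) auto
  ultimately show ?thesis by linarith
qed

text \<open>Bessel makes the squared moduli summable along any injective sequence of frequencies.
  The two ends of the telescoped sums below are such sequences.\<close>

lemma riemann_lebesgue:
  assumes H: "continuous_on {0..1} H" and r: "inj r"
  shows "(\<lambda>n::nat. fc H (r n)) \<longlonglongrightarrow> 0"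
proof -
  have "(\<Sum>i<n. (cmod (fc H (r i)))\<^sup>2) \<le> integral {0..1} (\<lambda>x. (cmod (H x))\<^sup>2)" for n
    using bessel_inequality[OF H, of "r ` {..<n}"] r
    by (simp add: sum.reindex inj_on_subset[OF r])
  then have "summable (\<lambda>n. (cmod (fc H (r n)))\<^sup>2)"
    by (intro summableI_nonneg_bounded) auto
  then have "(\<lambda>n. (cmod (fc H (r n)))\<^sup>2) \<longlonglongrightarrow> 0" by (rule summable_LIMSEQ_zero)
  then have "(\<lambda>n. cmod (fc H (r n))) \<longlonglongrightarrow> 0"
    using tendsto_real_sqrt[of "\<lambda>n. (cmod (fc H (r n)))\<^sup>2" 0] by simp
  then show ?thesis by (simp add: tendsto_norm_zero_iff)
qed

lemma ee_1_neq_1: "0 < y \<Longrightarrow> y < 1 \<Longrightarrow> ee 1 y \<noteq> 1"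
proof
  assume y: "0 < y" "y < 1" and "ee 1 y = 1"
  then have "cos (2 * pi * y) = 1" by (simp add: ee_def complex_eq_iff)
  then obtain n :: int where "2 * pi * y = n * 2 * pi" using cos_one_2pi_int by auto
  then have "y = n" by simp
  with y show False by auto
qed

lemma vector_derivative_quotient_tendsto:
  fixes g :: "real \<Rightarrow> complex"
  assumes "(g has_vector_derivative D) (at 0)"
  shows "((\<lambda>h. (g h - g 0) / of_real h) \<longlongrightarrow> D) (at 0)"
proof -
  have "((\<lambda>h. norm (g h - g 0 - h *\<^sub>R D) / norm h) \<longlongrightarrow> 0) (at 0)"
    using assms unfolding has_vector_derivative_def has_derivative_at by simp
  then have "((\<lambda>h. norm ((g h - g 0) / of_real h - D)) \<longlongrightarrow> 0) (at 0)"
  proof (rule Lim_transform_eventually)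
    have "norm (g h - g 0 - h *\<^sub>R D) / norm h = norm ((g h - g 0) / of_real h - D)" if "h \<noteq> 0" for h
    proof -
      have "(g h - g 0) / of_real h - D = (g h - g 0 - h *\<^sub>R D) / of_real h"
        using that by (simp add: scaleR_conv_of_real diff_divide_distrib)
      then show ?thesis by (simp only: norm_divide norm_of_real real_norm_def)
    qed
    then show "\<forall>\<^sub>F h in at 0. norm (g h - g 0 - h *\<^sub>R D) / norm h = norm ((g h - g 0) / of_real h - D)"
      by (simp add: eventually_at_filter)
  qed
  then show ?thesis by (simp add: tendsto_norm_zero_iff LIM_zero_iff)
qed

text \<open>Chernoff's argument: dividing by \<open>e\<^sup>2\<^sup>\<pi>\<^sup>i\<^sup>y - 1\<close> turns the partial sum at a zero into a
  telescoping sum, so that the Riemann--Lebesgue lemma applies.\<close>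

lemma fourier_partial_sums_at_zero:
  assumes G: "continuous_on UNIV G" "\<And>x. G (x + 1) = G x" "(G has_vector_derivative D) (at 0)" "G 0 = 0"
  shows "(\<lambda>n. \<Sum>k\<in>{- int n..int n}. fc G k) \<longlonglongrightarrow> 0"
proof -
  define L where "L = D / (2 * pi * \<i>)"
  \<comment> \<open>The split on \<open>ee 1 y = 1\<close>, rather than on \<open>y = 0\<close>,
    keeps \<open>H\<close> 1-periodic, so that continuity at 1 is inherited from continuity at 0.
    The value \<open>L\<close> is the limit of the quotient there.\<close>
  define H where "H y = (if ee 1 y = 1 then L else G y / (ee 1 y - 1))" for y
  have HG: "G y = H y * (ee 1 y - 1)" if "y \<in> {0..1}" for y
    using ee_1_neq_1[of y] that G(2)[of 0] G(4) by (cases "y = 0 \<or> y = 1") (auto simp: H_def)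
  have "((\<lambda>h. (G h / of_real h) / ((ee 1 h - 1) / of_real h)) \<longlongrightarrow> L) (at 0)"
    unfolding L_def
    using vector_derivative_quotient_tendsto[OF G(3)]
      vector_derivative_quotient_tendsto[OF ee_has_vector_derivative[of 1]] G(4)
    by (intro tendsto_divide) auto
  then have lim: "(H \<longlongrightarrow> L) (at 0)"
  proof (rule Lim_transform_eventually)
    have "G h / of_real h / ((ee 1 h - 1) / of_real h) = H h" if "h \<noteq> 0" "dist h 0 < 1" for h
    proof -
      have "ee 1 h \<noteq> 1"
        using that ee_1_neq_1[of h] ee_1_neq_1[of "h + 1"] by (cases "h > 0") (auto simp: ee_periodic)
      then show ?thesis using that by (simp add: H_def)
    qed
    then show "\<forall>\<^sub>F h in at 0. G h / of_real h / ((ee 1 h - 1) / of_real h) = H h"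
      unfolding eventually_at by (intro exI[of _ 1]) auto
  qed
  have Hper: "H (y + 1) = H y" for y by (simp add: H_def ee_periodic G(2))
  have H01: "H 0 = L" "H 1 = L" by (simp_all add: H_def)
  have cH0: "isCont H 0" using lim H01 by (simp add: isCont_def)
  have cH1: "isCont H 1"
  proof -
    have "isCont (\<lambda>y. H (y - 1)) 1"
      by (rule isCont_o2[where g=H]) (use cH0 in \<open>auto intro!: continuous_intros\<close>)
    moreover have "(\<lambda>y. H (y - 1)) = H"
    proof
      fix y show "H (y - 1) = H y" using Hper[of "y - 1"] by simp
    qed
    ultimately show ?thesis by simp
  qed
  have cHi: "isCont H y" if "0 < y" "y < 1" for y
  proof -
    have "continuous_on {0<..<1} (\<lambda>y. G y / (ee 1 y - 1))"
      using ee_1_neq_1 by (intro continuous_intros continuous_on_subset[OF G(1)]) auto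
    moreover have "continuous_on {0<..<1} H \<longleftrightarrow> continuous_on {0<..<1} (\<lambda>y. G y / (ee 1 y - 1))"
      using ee_1_neq_1 by (intro continuous_on_cong) (auto simp: H_def)
    ultimately show ?thesis using that by (auto simp: continuous_on_eq_continuous_at)
  qed
  have cH: "continuous_on {0..1} H"
  proof (intro continuous_at_imp_continuous_on ballI)
    fix y :: real assume "y \<in> {0..1}"
    then show "isCont H y" using cH0 cH1 cHi[of y] by (cases "y = 0 \<or> y = 1") auto
  qed
  have "fc G k = fc H (k - 1) - fc H k" for k
  proof -
    have "fc G k = fc (\<lambda>y. ee 1 y * H y - H y) k"
      by (rule fc_cong) (simp add: HG algebra_simps)
    then show ?thesis
      by (simp add: fc_diff cH continuous_intros fc_ee_mult)
  qed
  then have "(\<Sum>k\<in>{- int n..int n}. fc G k) = fc H (- int n - 1) - fc H (int n)" for n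
  proof (induction n)
    case (Suc n)
    have "{- int (Suc n)..int (Suc n)} = insert (int (Suc n)) (insert (- int (Suc n)) {- int n..int n})"
      by auto
    moreover have "fc H (- int n - 1) = fc H (- 1 - int n)" by (rule arg_cong[of _ _ "fc H"]) simp
    ultimately show ?case using Suc by simp
  qed simp
  moreover have "(\<lambda>n. fc H (- int n - 1) - fc H (int n)) \<longlonglongrightarrow> 0 - 0"
    by (intro tendsto_diff riemann_lebesgue[OF cH]) (simp_all add: inj_def)
  ultimately show ?thesis by simp
qed

text \<open>Translating \<open>x\<close> to the origin and subtracting \<open>g x\<close> produces a
  function with a zero at 0; the subtraction alters only the coefficient of index 0.\<close>

lemma fourier_inversion:
  assumes g: "\<And>x. (g has_vector_derivative g' x) (at x)" "\<And>x. g (x + 1) = g x"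
  shows "(\<lambda>n. \<Sum>k\<in>{- int n..int n}. fc g k * ee k x) \<longlonglongrightarrow> g x"
proof -
  define G where "G y = g (y + x) - g x" for y
  have c: "continuous_on UNIV g"
    using g(1) by (intro continuous_at_imp_continuous_on ballI has_vector_derivative_continuous)
  have c': "continuous_on S (\<lambda>y. g (y + x))" for S
    by (rule continuous_on_compose2[OF c]) (auto intro!: continuous_intros)
  have fG: "fc G k = fc g k * ee k x - (if k = 0 then g x else 0)" for k
  proof -
    have "fc G k = fc (\<lambda>y. g (y + x)) k - fc (\<lambda>y. g x) k"
      unfolding G_def by (intro fc_diff c' continuous_on_const)
    also have "fc (\<lambda>y. g (y + x)) k = ee k x * fc g k"
      by (rule fc_shift[OF c g(2)])
    also have "fc (\<lambda>y. g x) k = (if k = 0 then g x else 0)"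
      using fc_cmult[of "g x" "\<lambda>y. 1" k] by (simp add: fc_one)
    finally show ?thesis by simp
  qed
  have "(\<lambda>n. \<Sum>k\<in>{- int n..int n}. fc G k) \<longlonglongrightarrow> 0"
  proof (rule fourier_partial_sums_at_zero)
    show "continuous_on UNIV G" unfolding G_def by (intro continuous_intros c')
    show "G (y + 1) = G y" for y using g(2)[of "y + x"] by (simp add: G_def add_ac)
    show "(G has_vector_derivative g' x) (at 0)"
    proof -
      have "((\<lambda>y. y + x) has_vector_derivative 1) (at 0)"
        by (auto intro!: derivative_eq_intros)
      from vector_diff_chain_at[OF this, of g "g' x"] g(1)[of x]
      have "((\<lambda>y. g (y + x)) has_vector_derivative g' x) (at 0)" by (simp add: o_def)
      from has_vector_derivative_diff[OF this has_vector_derivative_const[of "g x"]]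
      show ?thesis by (simp add: G_def[abs_def])
    qed
  qed (simp add: G_def)
  then have "(\<lambda>n. (\<Sum>k\<in>{- int n..int n}. fc g k * ee k x) - g x) \<longlonglongrightarrow> 0"
    by (simp add: fG sum_subtractf)
  then show ?thesis by (simp add: LIM_zero_iff)
qed

lemma fc_derivative:
  assumes g: "\<And>x. (g has_vector_derivative g' x) (at x)" "g 1 = g 0" and g': "continuous_on {0..1} g'"
  shows "fc g' k = 2 * pi * \<i> * of_int k * fc g k"
proof -
  have c: "continuous_on S g" for S
    using g(1) by (intro continuous_at_imp_continuous_on ballI has_vector_derivative_continuous)
  let ?P = "\<lambda>x. g x * (2 * pi * \<i> * of_int (- k) * ee (- k) x) + g' x * ee (- k) x"
  have "(?P has_integral (g 1 * ee (- k) 1 - g 0 * ee (- k) 0)) {0..1}"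
    by (intro fundamental_theorem_of_calculus has_vector_derivative_mult ee_has_vector_derivative
      has_vector_derivative_at_within[OF g(1)]) simp
  then have "integral {0..1} ?P = 0" using g(2) by (simp add: integral_unique)
  moreover have "integral {0..1} ?P = integral {0..1} (\<lambda>x. - (2 * pi * \<i> * of_int k) * (g x * ee (- k) x))
      + fc g' k"
    unfolding fc_def
    by (subst integral_add[symmetric])
      (auto intro!: integrable_continuous_real continuous_intros c g' simp: algebra_simps)
  ultimately show ?thesis unfolding fc_def by simp
qed

section \<open>Fourier coefficients of analytic functions\<close>

text \<open>Passage from local to uniform constants, for derivatives of analytic functions and for
  the projections of a splitting alike.\<close>

lemma compact_local_bound:
  fixes K :: "'a::topological_space set" and Q :: "real \<Rightarrow> 'a \<Rightarrow> bool"
  assumes K: "compact K"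
    and loc: "\<And>x. x \<in> K \<Longrightarrow> \<exists>U C. open U \<and> x \<in> U \<and> (\<forall>y\<in>U. Q C y)"
    and mono: "\<And>C C' y. Q C y \<Longrightarrow> C \<le> C' \<Longrightarrow> Q C' y"
  shows "\<exists>C. \<forall>y\<in>K. Q C y"
proof -
  obtain U C where UC: "\<And>x. x \<in> K \<Longrightarrow> open (U x) \<and> x \<in> U x \<and> (\<forall>y\<in>U x. Q (C x) y)"
    using loc by metis
  obtain D where D: "D \<subseteq> K" "finite D" "K \<subseteq> (\<Union>x\<in>D. U x)"
    using compactE_image[OF K, of K U] UC by blast
  have "Q (Max (insert 0 (C ` D))) y" if y: "y \<in> K" for y
  proof -
    obtain x where "x \<in> D" "y \<in> U x" using D(3) y by blast
    then have "Q (C x) y" using UC D(1) by blast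
    moreover have "C x \<le> Max (insert 0 (C ` D))" using \<open>x \<in> D\<close> D(2) by (intro Max_ge) auto
    ultimately show ?thesis by (rule mono)
  qed
  then show ?thesis by blast
qed

section \<open>Complex extension and Cauchy estimates\<close>

text \<open>A power series that converges at real distance \<open>t\<close> converges on the open
  complex disc of radius \<open>t\<close>, so the real expansion extends with no loss of
  radius.\<close>

lemma real_analytic_extension:
  assumes "real_analytic f"
  shows "\<exists>r>0. \<exists>F. F holomorphic_on ball (complex_of_real x) r \<and>
    (\<forall>y. \<bar>y - x\<bar> < r \<longrightarrow> F (of_real y) = of_real (f y))"
proof -
  obtain r c where r: "r > 0" and c: "\<And>y. \<bar>y - x\<bar> < r \<Longrightarrow> (\<lambda>n. c n * (y - x) ^ n) sums f y"
    using assms unfolding real_analytic_def by metis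
  define F where "F z = (\<Sum>n. complex_of_real (c n) * (z - of_real x) ^ n)" for z
  have "(\<lambda>n. complex_of_real (c n) * (z - of_real x) ^ n) sums F z"
    if z: "z \<in> ball (of_real x) r" for z
  proof -
    obtain t where t: "cmod (z - of_real x) < t" "t < r"
      using z dense[of "cmod (z - of_real x)" r] by (auto simp: dist_norm norm_minus_commute)
    then have "t > 0" using norm_ge_zero[of "z - of_real x"] by linarith
    with t have "summable (\<lambda>n. c n * t ^ n)" using c[of "x + t"] by (auto simp: sums_iff)
    then have "summable (\<lambda>n. complex_of_real (c n * t ^ n))" by (simp only: summable_of_real)
    then have "summable (\<lambda>n. complex_of_real (c n) * of_real t ^ n)" by simp
    then have "summable (\<lambda>n. complex_of_real (c n) * (z - of_real x) ^ n)"
      by (rule powser_inside) (use t \<open>t > 0\<close> in simp)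
    then show ?thesis unfolding F_def by (rule summable_sums)
  qed
  then have "F holomorphic_on ball (of_real x) r" by (rule power_series_holomorphic)
  moreover have "F (of_real y) = of_real (f y)" if "\<bar>y - x\<bar> < r" for y
  proof -
    have "(\<lambda>n. complex_of_real (c n * (y - x) ^ n)) sums of_real (f y)"
      using c[OF that] by (simp only: sums_of_real_iff)
    then show ?thesis unfolding F_def by (simp add: sums_iff)
  qed
  ultimately show ?thesis using r by blast
qed

text \<open>The complex derivative at a real point can be computed along the real axis, where
  \<open>H\<close> takes real values. Hence it is real as well, and the lemma can be
  iterated.\<close>

lemma real_derivative_of_extension:
  assumes H: "H holomorphic_on ball (complex_of_real x) r"
    and h: "\<And>y. \<bar>y - x\<bar> < r \<Longrightarrow> H (of_real y) = of_real (h y)" and y: "\<bar>y - x\<bar> < r"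
  shows "(h has_real_derivative deriv h y) (at y)" "deriv H (of_real y) = of_real (deriv h y)"
proof -
  have yb: "of_real y \<in> ball (complex_of_real x) r"
    using y by (simp add: dist_real_def abs_minus_commute flip: of_real_diff)
  then have "(H has_field_derivative deriv H (of_real y)) (at (of_real y))"
    using H holomorphic_derivI open_ball by blast
  then have "((\<lambda>t. H (of_real t)) has_vector_derivative deriv H (of_real y)) (at y)"
    by (rule has_vector_derivative_real_field)
  then have *: "((\<lambda>t. complex_of_real (h t)) has_vector_derivative deriv H (of_real y)) (at y)"
    by (rule has_vector_derivative_transform_within_open[where S = "ball x r"])
      (use y h in \<open>auto simp: dist_real_def abs_minus_commute\<close>)
  have "(h has_vector_derivative Re (deriv H (of_real y))) (at y)"
    using bounded_linear.has_vector_derivative[OF bounded_linear_Re *] by simp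
  then have d: "(h has_real_derivative Re (deriv H (of_real y))) (at y)"
    by (simp add: has_real_derivative_iff_has_vector_derivative)
  then have e: "deriv h y = Re (deriv H (of_real y))" by (rule DERIV_imp_deriv)
  show "(h has_real_derivative deriv h y) (at y)" using d e by simp
  have "((\<lambda>t. 0::real) has_vector_derivative Im (deriv H (of_real y))) (at y)"
    using bounded_linear.has_vector_derivative[OF bounded_linear_Im *] by simp
  then have "Im (deriv H (of_real y)) = 0"
    using has_vector_derivative_const vector_derivative_unique_at by blast
  then show "deriv H (of_real y) = of_real (deriv h y)" by (simp add: e complex_eq_iff)
qed

lemma real_derivatives_of_extension:
  assumes F: "F holomorphic_on ball (complex_of_real x) r"
    and f: "\<And>y. \<bar>y - x\<bar> < r \<Longrightarrow> F (of_real y) = of_real (f y)"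
  shows "\<bar>y - x\<bar> < r \<Longrightarrow> (deriv ^^ j) F (of_real y) = of_real ((deriv ^^ j) f y)"
    and "\<bar>y - x\<bar> < r \<Longrightarrow> ((deriv ^^ j) f has_real_derivative (deriv ^^ Suc j) f y) (at y)"
proof -
  have hol: "(deriv ^^ j) F holomorphic_on ball (of_real x) r" for j
    by (rule holomorphic_higher_deriv[OF F open_ball])
  have 1: "\<bar>y - x\<bar> < r \<Longrightarrow> (deriv ^^ j) F (of_real y) = of_real ((deriv ^^ j) f y)" for y j
  proof (induction j arbitrary: y)
    case (Suc j)
    then show ?case using real_derivative_of_extension(2)[OF hol[of j] Suc.IH] by simp
  qed (simp add: f)
  show "\<bar>y - x\<bar> < r \<Longrightarrow> (deriv ^^ j) F (of_real y) = of_real ((deriv ^^ j) f y)" by (rule 1)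
  show "\<bar>y - x\<bar> < r \<Longrightarrow> ((deriv ^^ j) f has_real_derivative (deriv ^^ Suc j) f y) (at y)"
    using real_derivative_of_extension(1)[OF hol[of j] 1] by simp
qed

lemma real_analytic_higher_derivative:
  assumes "real_analytic f"
  shows "((deriv ^^ j) f has_real_derivative (deriv ^^ Suc j) f y) (at y)"
proof -
  obtain r F where "r > 0" "F holomorphic_on ball (complex_of_real y) r"
    "\<And>t. \<bar>t - y\<bar> < r \<Longrightarrow> F (of_real t) = of_real (f t)"
    using real_analytic_extension[OF assms, of y] by blast
  then show ?thesis by (intro real_derivatives_of_extension(2)) auto
qed

text \<open>Cauchy estimates on discs of radius \<open>r / 4\<close> around the points near
  \<open>x\<close>. A single \<open>C\<close> serves as bound of \<open>F\<close> and as inverse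
  radius, whence the exponent \<open>Suc j\<close>.\<close>

lemma real_analytic_local_derivative_bound:
  assumes "real_analytic f"
  shows "\<exists>U C. open U \<and> x \<in> U \<and> (\<forall>y\<in>U. 0 < C \<and> (\<forall>j. \<bar>(deriv ^^ j) f y\<bar> \<le> fact j * C ^ Suc j))"
proof -
  obtain r F where r: "r > 0" and F: "F holomorphic_on ball (complex_of_real x) r"
    and f: "\<And>t. \<bar>t - x\<bar> < r \<Longrightarrow> F (of_real t) = of_real (f t)"
    using real_analytic_extension[OF assms, of x] by blast
  have "continuous_on (cball (of_real x) (r / 2)) F"
    using r by (intro continuous_on_subset[OF holomorphic_on_imp_continuous_on[OF F]]) auto
  then have "bounded (F ` cball (of_real x) (r / 2))"
    by (intro compact_imp_bounded compact_continuous_image) auto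
  then obtain M where M: "\<And>z. z \<in> cball (of_real x) (r / 2) \<Longrightarrow> cmod (F z) \<le> M"
    unfolding bounded_iff by blast
  define C where "C = max (max M (4 / r)) 1"
  have "\<bar>(deriv ^^ j) f y\<bar> \<le> fact j * C ^ Suc j" if y: "y \<in> ball x (r / 4)" for y j
  proof -
    have yx: "dist (complex_of_real y) (of_real x) < r / 4"
      using y by (simp add: dist_real_def abs_minus_commute flip: of_real_diff)
    have sub: "z \<in> cball (complex_of_real x) (r / 2)" if "dist (of_real y) z \<le> r / 4" for z
      using that yx dist_triangle3[of "of_real x" z "complex_of_real y"] by (simp add: dist_commute)
    have sub': "cball (complex_of_real x) (r / 2) \<subseteq> ball (of_real x) r" using r by auto
    have "cmod ((deriv ^^ j) F (of_real y)) \<le> fact j * M / (r / 4) ^ j"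
    proof (rule Cauchy_inequality)
      show "F holomorphic_on ball (of_real y) (r / 4)"
        by (rule holomorphic_on_subset[OF F]) (use sub sub' in fastforce)
      show "continuous_on (cball (of_real y) (r / 4)) F"
        by (rule continuous_on_subset[OF holomorphic_on_imp_continuous_on[OF F]]) (use sub sub' in fastforce)
    qed (use r sub M in \<open>auto simp: dist_norm\<close>)
    also have "\<dots> = fact j * (M * (4 / r) ^ j)" by (simp add: power_divide)
    also have "\<dots> \<le> fact j * (C * C ^ j)"
      using r by (intro mult_left_mono mult_mono power_mono) (auto simp: C_def)
    finally have "cmod ((deriv ^^ j) F (of_real y)) \<le> fact j * C ^ Suc j" by simp
    moreover have "\<bar>y - x\<bar> < r" using y r by (auto simp: dist_real_def abs_minus_commute)
    ultimately show ?thesis using real_derivatives_of_extension(1)[OF F f, of y j] by simp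
  qed
  moreover have "C > 0" by (simp add: C_def)
  ultimately show ?thesis using r by (intro exI[of _ "ball x (r / 4)"] exI[of _ C]) auto
qed

lemma analytic_periodic_higher_derivative:
  assumes f: "analytic_periodic f"
  shows "(deriv ^^ j) f (x + 1) = (deriv ^^ j) f x"
proof (induction j arbitrary: x)
  case 0
  then show ?case using f by (simp add: analytic_periodic_def)
next
  case (Suc j)
  have ra: "real_analytic f" using f by (simp add: analytic_periodic_def)
  have "((\<lambda>t. (deriv ^^ j) f (t + 1)) has_real_derivative (deriv ^^ Suc j) f (x + 1)) (at x)"
    by (rule DERIV_shift[THEN iffD1]) (rule real_analytic_higher_derivative[OF ra])
  then show ?case using Suc real_analytic_higher_derivative[OF ra, of j x] DERIV_unique by auto
qed

lemma analytic_periodic_derivative_bound: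
  assumes f: "analytic_periodic f"
  shows "\<exists>C>0. \<forall>y j. \<bar>(deriv ^^ j) f y\<bar> \<le> fact j * C ^ Suc j"
proof -
  have ra: "real_analytic f" using f by (simp add: analytic_periodic_def)
  note per' = analytic_periodic_higher_derivative[OF f]
  have "\<exists>C. \<forall>y\<in>{0..1}. 0 < C \<and> (\<forall>j. \<bar>(deriv ^^ j) f y\<bar> \<le> fact j * C ^ Suc j)"
  proof (rule compact_local_bound)
    fix C C' y assume *: "0 < C \<and> (\<forall>j. \<bar>(deriv ^^ j) f y\<bar> \<le> fact j * C ^ Suc j)" and CC: "C \<le> (C'::real)"
    have "fact j * C ^ Suc j \<le> fact j * C' ^ Suc j" for j
      using * CC by (intro mult_left_mono power_mono) auto
    then show "0 < C' \<and> (\<forall>j. \<bar>(deriv ^^ j) f y\<bar> \<le> fact j * C' ^ Suc j)"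
      using * CC by (meson order_trans less_le_trans)
  qed (use real_analytic_local_derivative_bound[OF ra] in auto)
  then obtain C where C: "\<And>y. y \<in> {0..1} \<Longrightarrow> 0 < C \<and> (\<forall>j. \<bar>(deriv ^^ j) f y\<bar> \<le> fact j * C ^ Suc j)"
    by blast
  have "\<bar>(deriv ^^ j) f y\<bar> \<le> fact j * C ^ Suc j" for y j
  proof -
    have "(deriv ^^ j) f y = (deriv ^^ j) f (frac y)"
      using periodic_add_of_int[of "(deriv ^^ j) f" "frac y" "\<lfloor>y\<rfloor>"] per' by (simp add: frac_def)
    then show ?thesis using C[of "frac y"] by (simp add: frac_ge_0 less_imp_le[OF frac_lt_1])
  qed
  moreover have "C > 0" using C[of 0] by simp
  ultimately show ?thesis by blast
qed

lemma taylor_term_bound: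
  fixes a t C :: real
  assumes C: "C > 0" and le: "(2 * C * t) ^ j * a \<le> fact j * C ^ Suc j"
  shows "a * (t ^ j /\<^sub>R fact j) \<le> C * (1 / 2) ^ j"
proof -
  have "C ^ j * (2 ^ j * (t ^ j * a)) \<le> C ^ j * (fact j * C)"
    using le by (simp add: power_mult_distrib mult_ac)
  then have "2 ^ j * (t ^ j * a) \<le> fact j * C" using C by simp
  then have "2 ^ j * (t ^ j * a) / (fact j * 2 ^ j) \<le> fact j * C / (fact j * 2 ^ j)"
    by (rule divide_right_mono) simp
  moreover have "2 ^ j * (t ^ j * a) / (fact j * 2 ^ j) = a * (t ^ j /\<^sub>R fact j)"
    by (simp add: field_simps)
  moreover have "fact j * C / (fact j * 2 ^ j) = C * (1 / 2) ^ j"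
    by (simp add: power_one_over inverse_eq_divide)
  ultimately show ?thesis by (simp only:)
qed

text \<open>With \<open>t = pi |k| / C\<close>, the bound on the \<open>j\<close>-th derivative
  reads \<open>a t^j / j! <= C / 2^j\<close> for the modulus \<open>a\<close> of the coefficient.
  Summing over all \<open>j\<close> gives \<open>a exp t <= 2 C\<close>, without optimising
  \<open>j\<close> or shifting a contour.\<close>

lemma fc_analytic_decay:
  assumes f: "analytic_periodic f"
  shows "\<exists>M h. h > 0 \<and> (\<forall>k. cmod (fc (\<lambda>x. of_real (f x)) k) \<le> M * exp (- h * \<bar>of_int k\<bar>))"
proof -
  obtain C where C: "C > 0" "\<And>y j. \<bar>(deriv ^^ j) f y\<bar> \<le> fact j * C ^ Suc j"
    using analytic_periodic_derivative_bound[OF f] by blast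
  have ra: "real_analytic f" using f by (simp add: analytic_periodic_def)
  let ?d = "\<lambda>j x. complex_of_real ((deriv ^^ j) f x)"
  have D: "(?d j has_vector_derivative ?d (Suc j) x) (at x)" for j x
    using real_analytic_higher_derivative[OF ra, of j x]
    by (auto simp: has_real_derivative_iff_has_vector_derivative
      intro!: bounded_linear.has_vector_derivative[OF bounded_linear_of_real])
  have c: "continuous_on S (?d j)" for S j
    using D by (intro continuous_at_imp_continuous_on ballI has_vector_derivative_continuous)
  have d01: "(deriv ^^ j) f 1 = (deriv ^^ j) f 0" for j
    using analytic_periodic_higher_derivative[OF f, of j 0] by simp
  have fcj: "fc (?d j) k = (2 * pi * \<i> * of_int k) ^ j * fc (?d 0) k" for j k
  proof (induction j)
    case (Suc j)
    have "fc (?d (Suc j)) k = 2 * pi * \<i> * of_int k * fc (?d j) k"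
      by (rule fc_derivative[OF D _ c]) (simp add: d01)
    then show ?case by (simp only: Suc power_Suc mult.assoc)
  qed simp
  define h where "h = pi / C"
  have "cmod (fc (?d 0) k) * exp (h * \<bar>of_int k\<bar>) \<le> 2 * C" for k
  proof -
    let ?a = "cmod (fc (?d 0) k)" and ?t = "h * \<bar>of_int k :: real\<bar>"
    have le: "?a * (?t ^ j /\<^sub>R fact j) \<le> C * (1 / 2) ^ j" for j
    proof -
      have "cmod (fc (?d j) k) \<le> fact j * C ^ Suc j"
        by (rule fc_bound[OF c]) (use C(2)[of j] in simp)
      then have "(2 * pi * \<bar>of_int k\<bar>) ^ j * ?a \<le> fact j * C ^ Suc j"
        by (simp add: fcj[of j] norm_mult norm_power)
      moreover have "2 * pi * \<bar>of_int k\<bar> = 2 * C * ?t" using C(1) by (simp add: h_def)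
      ultimately have "(2 * C * ?t) ^ j * ?a \<le> fact j * C ^ Suc j" by (simp only:)
      then show ?thesis by (rule taylor_term_bound[OF C(1)])
    qed
    have s1: "(\<lambda>j. ?a * (?t ^ j /\<^sub>R fact j)) sums (?a * exp ?t)"
      by (intro sums_mult exp_converges)
    have s2: "(\<lambda>j. C * (1 / 2) ^ j) sums (C * (1 / (1 - 1 / 2)))"
      by (intro sums_mult geometric_sums) simp
    show ?thesis using sums_le[OF le s1 s2] by simp
  qed
  then have "cmod (fc (\<lambda>x. of_real (f x)) k) \<le> 2 * C * exp (- h * \<bar>of_int k\<bar>)" for k
    by (simp add: exp_minus field_simps)
  moreover have "h > 0" using C(1) by (simp add: h_def)
  ultimately show ?thesis by blast
qed

section \<open>Exponential weights and small divisors\<close>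

text \<open>The least admissible \<open>M\<close> is a weighted norm of \<open>g\<close>. Since
  \<open>|k| <= |l| + |k - l|\<close>, multiplication by a trigonometric polynomial acts on it with
  norm at most the weighted sum of the moduli of its coefficients.\<close>

lemma fc_trig_mult_decay:
  assumes A: "finite A" and g: "continuous_on {0..1} g" and h: "h \<ge> 0"
    and M: "\<And>k. cmod (fc g k) \<le> M * exp (- h * \<bar>of_int k\<bar>)"
  shows "cmod (fc (\<lambda>x. (\<Sum>l\<in>A. c l * ee l x) * g x) k)
    \<le> (\<Sum>l\<in>A. cmod (c l) * exp (h * \<bar>of_int l\<bar>)) * M * exp (- h * \<bar>of_int k\<bar>)"
proof -
  have M0: "M \<ge> 0" using order_trans[OF norm_ge_zero M[of 0]] by simp
  have "cmod (fc (\<lambda>x. (\<Sum>l\<in>A. c l * ee l x) * g x) k) \<le> (\<Sum>l\<in>A. cmod (c l) * cmod (fc g (k - l)))"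
    unfolding fc_trig_mult[OF A g] by (rule order_trans[OF norm_sum]) (simp add: norm_mult)
  also have "\<dots> \<le> (\<Sum>l\<in>A. cmod (c l) * exp (h * \<bar>of_int l\<bar>) * (M * exp (- h * \<bar>of_int k\<bar>)))"
  proof (rule sum_mono)
    fix l
    have "- h * \<bar>of_int (k - l)\<bar> \<le> h * \<bar>of_int l\<bar> + - h * \<bar>of_int k\<bar>"
    proof -
      have "h * \<bar>of_int k :: real\<bar> \<le> h * (\<bar>of_int l\<bar> + \<bar>of_int (k - l)\<bar>)"
        by (rule mult_left_mono[OF _ h]) simp
      then show ?thesis by (simp add: algebra_simps)
    qed
    then have "exp (- h * \<bar>of_int (k - l)\<bar>) \<le> exp (h * \<bar>of_int l\<bar>) * exp (- h * \<bar>of_int k\<bar>)"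
      by (simp only: exp_add[symmetric] exp_le_cancel_iff)
    then have "cmod (fc g (k - l)) \<le> M * (exp (h * \<bar>of_int l\<bar>) * exp (- h * \<bar>of_int k\<bar>))"
      using M[of "k - l"] M0 by (meson mult_left_mono order_trans)
    then have "cmod (c l) * cmod (fc g (k - l))
        \<le> cmod (c l) * (M * (exp (h * \<bar>of_int l\<bar>) * exp (- h * \<bar>of_int k\<bar>)))"
      by (rule mult_left_mono) simp
    then show "cmod (c l) * cmod (fc g (k - l))
        \<le> cmod (c l) * exp (h * \<bar>of_int l\<bar>) * (M * exp (- h * \<bar>of_int k\<bar>))"
      by (simp only: mult_ac)
  qed
  finally show ?thesis by (simp only: sum_distrib_right mult.assoc)
qed

text \<open>The previous bound along the exponential series: the \<open>n\<close>-th power costs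
  \<open>P ^ n\<close>, so the exponential costs \<open>exp P\<close>. For the gauge factor
  \<open>P\<close> is \<open>o(q)\<close>, and this is the whole loss of decay.\<close>

lemma fc_exp_mult_decay:
  assumes A: "finite A" and g: "continuous_on {0..1} g" and h: "h \<ge> 0"
    and M: "\<And>k. cmod (fc g k) \<le> M * exp (- h * \<bar>of_int k\<bar>)"
    and P: "P = (\<Sum>l\<in>A. cmod (c l) * exp (h * \<bar>of_int l\<bar>))"
  shows "cmod (fc (\<lambda>x. exp (\<Sum>l\<in>A. c l * ee l x) * g x) k) \<le> exp P * M * exp (- h * \<bar>of_int k\<bar>)"
proof -
  define w where "w x = (\<Sum>l\<in>A. c l * ee l x)" for x
  have cw: "continuous_on S w" for S unfolding w_def by (intro continuous_intros)
  have M0: "M \<ge> 0" using order_trans[OF norm_ge_zero M[of 0]] by simp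
  have wn: "cmod (fc (\<lambda>x. w x ^ n * g x) k) \<le> P ^ n * M * exp (- h * \<bar>of_int k\<bar>)" for n k
  proof (induction n arbitrary: k)
    case (Suc n)
    have "cmod (fc (\<lambda>x. w x * (w x ^ n * g x)) k) \<le> P * (P ^ n * M) * exp (- h * \<bar>of_int k\<bar>)"
      unfolding P w_def
      by (rule fc_trig_mult_decay[OF A _ h])
        (use Suc in \<open>auto simp: w_def P intro!: continuous_intros g\<close>)
    then show ?case by (simp only: power_Suc mult.assoc)
  qed (use M in simp)
  obtain G where G: "\<And>x. x \<in> {0..1} \<Longrightarrow> cmod (g x) \<le> G"
    using compact_imp_bounded[OF compact_continuous_image[OF g compact_Icc]]
    unfolding bounded_iff by blast
  define R where "R = (\<Sum>l\<in>A. cmod (c l))"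
  have R: "cmod (w x) \<le> R" for x
    unfolding w_def R_def by (rule order_trans[OF norm_sum]) (simp add: norm_mult)
  \<comment> \<open>Uniform convergence of the series on \<open>[0, 1]\<close> allows the
    coefficient to be taken term by term.\<close>
  let ?t = "\<lambda>n x. (w x ^ n /\<^sub>R fact n) * (g x * ee (- k) x)"
  let ?S = "\<lambda>n x. \<Sum>i<n. ?t i x"
  have "uniform_limit {0..1} ?S (\<lambda>x. \<Sum>i. ?t i x) sequentially"
  proof (rule Weierstrass_m_test)
    fix n x assume "x \<in> {0..1::real}"
    then have "cmod (w x ^ n /\<^sub>R fact n) * cmod (g x * ee (- k) x) \<le> (R ^ n /\<^sub>R fact n) * G"
      using G[of x] R[of x] by (intro mult_mono) (auto simp: norm_power norm_mult power_mono R_def sum_nonneg)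
    then show "norm (?t n x) \<le> (R ^ n /\<^sub>R fact n) * G" by (simp only: norm_mult)
  next
    show "summable (\<lambda>n. (R ^ n /\<^sub>R fact n) * G)"
      by (intro summable_mult2 sums_summable[OF exp_converges])
  qed
  moreover have "(\<Sum>i. ?t i x) = exp (w x) * g x * ee (- k) x" for x
    using sums_mult2[OF exp_converges[of "w x"], of "g x * ee (- k) x"] by (simp add: sums_iff mult.assoc)
  ultimately have "uniform_limit {0..1} ?S (\<lambda>x. exp (w x) * g x * ee (- k) x) sequentially"
    by (simp only:)
  moreover have "\<And>n. continuous_on {0..1} (?S n)" by (intro continuous_intros cw g)
  ultimately obtain I J where I: "\<And>n. (?S n has_integral I n) {0..1}"
    and J: "((\<lambda>x. exp (w x) * g x * ee (- k) x) has_integral J) {0..1}" and IJ: "I \<longlonglongrightarrow> J"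
    by (rule uniform_limit_integral) auto
  have "cmod (I n) \<le> exp P * M * exp (- h * \<bar>of_int k\<bar>)" for n
  proof -
    have "I n = integral {0..1} (?S n)" using I[of n] by (simp add: integral_unique)
    also have "\<dots> = (\<Sum>i<n. integral {0..1} (?t i))"
      by (rule integral_sum) (auto intro!: integrable_continuous_real continuous_intros cw g)
    also have "\<dots> = (\<Sum>i<n. fc (\<lambda>x. w x ^ i * g x) k /\<^sub>R fact i)"
      unfolding fc_def by (intro sum.cong) (simp_all add: mult.assoc)
    finally have "cmod (I n) \<le> (\<Sum>i<n. cmod (fc (\<lambda>x. w x ^ i * g x) k /\<^sub>R fact i))"
      by (simp only: norm_sum)
    also have "\<dots> \<le> (\<Sum>i<n. (P ^ i /\<^sub>R fact i) * (M * exp (- h * \<bar>of_int k\<bar>)))"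
    proof (rule sum_mono)
      fix i
      have "inverse (fact i) * cmod (fc (\<lambda>x. w x ^ i * g x) k)
          \<le> inverse (fact i) * (P ^ i * M * exp (- h * \<bar>of_int k\<bar>))"
        by (rule mult_left_mono[OF wn]) simp
      then show "cmod (fc (\<lambda>x. w x ^ i * g x) k /\<^sub>R fact i)
          \<le> (P ^ i /\<^sub>R fact i) * (M * exp (- h * \<bar>of_int k\<bar>))"
        by (simp add: mult.assoc)
    qed
    also have "\<dots> = (\<Sum>i<n. P ^ i /\<^sub>R fact i) * (M * exp (- h * \<bar>of_int k\<bar>))"
      by (simp only: sum_distrib_right)
    also have "\<dots> \<le> exp P * (M * exp (- h * \<bar>of_int k\<bar>))"
    proof (rule mult_right_mono)
      have "(\<Sum>i<n. P ^ i /\<^sub>R fact i) \<le> (\<Sum>i. P ^ i /\<^sub>R fact i)"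
        by (rule sum_le_suminf[OF sums_summable[OF exp_converges]]) (auto simp: P sum_nonneg)
      then show "(\<Sum>i<n. P ^ i /\<^sub>R fact i) \<le> exp P" by (simp add: exp_def)
    qed (use M0 in simp)
    finally show ?thesis by (simp only: mult.assoc)
  qed
  then have "cmod J \<le> exp P * M * exp (- h * \<bar>of_int k\<bar>)"
    using LIMSEQ_le_const2[OF tendsto_norm[OF IJ]] by blast
  moreover have "J = fc (\<lambda>x. exp (w x) * g x) k"
    using J by (simp add: fc_def integral_unique)
  ultimately show ?thesis by (simp only: w_def)
qed

text \<open>On each of the two half-lines \<open>|k| - K\<close> is injective, so each part is
  dominated by a geometric series.\<close>

lemma sum_exp_tail:
  fixes F :: "int set"
  assumes h: "h > 0" and F: "finite F" "\<And>k. k \<in> F \<Longrightarrow> int K \<le> \<bar>k\<bar>"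
  shows "(\<Sum>k\<in>F. exp (- h * \<bar>of_int k\<bar>)) \<le> 2 / (1 - exp (- h)) * exp (- h * real K)"
proof -
  have r: "exp (- h) < 1" using h by simp
  have half: "(\<Sum>k\<in>G. exp (- h * \<bar>of_int k\<bar>)) \<le> exp (- h * real K) / (1 - exp (- h))"
    if G: "finite G" "\<And>k. k \<in> G \<Longrightarrow> int K \<le> \<bar>k\<bar>" and inj: "inj_on (\<lambda>k. nat \<bar>k\<bar> - K) G" for G :: "int set"
  proof -
    let ?i = "\<lambda>k::int. nat \<bar>k\<bar> - K"
    have "exp (- h * \<bar>of_int k\<bar>) = exp (- h * real K) * exp (- h) ^ ?i k" if "k \<in> G" for k
    proof -
      have "\<bar>of_int k :: real\<bar> = real K + real (?i k)" using G(2)[OF that] by linarith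
      then have "- h * \<bar>of_int k :: real\<bar> = - h * real K + real (?i k) * (- h)"
        by (simp only: ring_distribs mult.commute)
      then show ?thesis by (simp only: exp_add exp_of_nat_mult)
    qed
    then have "(\<Sum>k\<in>G. exp (- h * \<bar>of_int k\<bar>)) = exp (- h * real K) * (\<Sum>k\<in>G. exp (- h) ^ ?i k)"
      by (simp add: sum_distrib_left)
    also have "(\<Sum>k\<in>G. exp (- h) ^ ?i k) = sum ((^) (exp (- h))) (?i ` G)"
      using inj by (simp add: sum.reindex o_def)
    also have "\<dots> \<le> 1 / (1 - exp (- h))"
      using sum_le_suminf[OF summable_geometric, of "exp (- h)" "?i ` G"] r G(1)
      by (simp add: suminf_geometric)
    finally show ?thesis by (simp add: mult_left_mono)
  qed
  let ?P = "{k \<in> F. k \<ge> 0}" and ?N = "{k \<in> F. k < 0}"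
  have "F = ?P \<union> ?N" by auto
  then have "(\<Sum>k\<in>F. exp (- h * \<bar>of_int k\<bar>))
      = (\<Sum>k\<in>?P. exp (- h * \<bar>of_int k\<bar>)) + (\<Sum>k\<in>?N. exp (- h * \<bar>of_int k\<bar>))"
    using F(1) by (subst \<open>F = ?P \<union> ?N\<close>, subst sum.union_disjoint) auto
  also have "\<dots> \<le> exp (- h * real K) / (1 - exp (- h)) + exp (- h * real K) / (1 - exp (- h))"
    using F by (intro add_mono half) (auto simp: inj_on_def dest!: F(2))
  finally show ?thesis by simp
qed

lemma fourier_tail:
  assumes lim: "(\<lambda>n. \<Sum>k\<in>{- int n..int n}. a k * ee k x) \<longlonglongrightarrow> y"
    and a: "\<And>k. cmod (a k) \<le> M * exp (- h * \<bar>of_int k\<bar>)" and h: "h > 0"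
  shows "cmod (y - (\<Sum>k | \<bar>k\<bar> < int K. a k * ee k x)) \<le> M * (2 / (1 - exp (- h)) * exp (- h * real K))"
proof -
  have M0: "M \<ge> 0" using order_trans[OF norm_ge_zero a[of 0]] by simp
  let ?S = "\<Sum>k | \<bar>k\<bar> < int K. a k * ee k x"
  have *: "cmod ((\<Sum>k\<in>{- int n..int n}. a k * ee k x) - ?S) \<le> M * (2 / (1 - exp (- h)) * exp (- h * real K))"
    if "n \<ge> K" for n
  proof -
    let ?F = "{- int n..int n} - {k. \<bar>k\<bar> < int K}"
    have sub: "{k. \<bar>k\<bar> < int K} \<subseteq> {- int n..int n}" using that by auto
    have "(\<Sum>k\<in>{- int n..int n}. a k * ee k x) - ?S = (\<Sum>k\<in>?F. a k * ee k x)"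
      using sub by (subst sum_diff) auto
    also have "cmod \<dots> \<le> (\<Sum>k\<in>?F. M * exp (- h * \<bar>of_int k\<bar>))"
      by (rule order_trans[OF norm_sum]) (intro sum_mono, simp add: norm_mult a[simplified])
    also have "\<dots> \<le> M * (2 / (1 - exp (- h)) * exp (- h * real K))"
      unfolding sum_distrib_left[symmetric]
      by (intro mult_left_mono[OF sum_exp_tail[OF h] M0]) auto
    finally show ?thesis .
  qed
  have "(\<lambda>n. cmod ((\<Sum>k\<in>{- int n..int n}. a k * ee k x) - ?S)) \<longlonglongrightarrow> cmod (y - ?S)"
    by (intro tendsto_norm tendsto_diff lim tendsto_const)
  then show ?thesis by (rule LIMSEQ_le_const2) (use * in blast)
qed

section \<open>Lower bounds for the divisors\<close>

text \<open>The slope 1/4 is crude but enough: with \<open>pi >= 2\<close> it yields the constant 1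
  in \<open>norm_ee_minus_one_ge\<close>.\<close>

lemma sin_ge_quarter: "0 \<le> x \<Longrightarrow> x \<le> pi / 2 \<Longrightarrow> x / 4 \<le> sin x"
proof (cases "x \<le> pi / 3")
  case True
  assume x: "0 \<le> x"
  show ?thesis
  proof (cases "x = 0")
    case False
    then obtain z where z: "0 < z" "z < x" "sin x - sin 0 = (x - 0) * cos z"
      using MVT2[of 0 x sin cos] x by (auto intro!: derivative_eq_intros)
    have "cos (pi / 3) \<le> cos z" using z True by (intro cos_monotone_0_pi_le) auto
    then have "x * (1 / 2) \<le> x * cos z" using x by (intro mult_left_mono) (auto simp: cos_60)
    then show ?thesis using z x by simp
  qed simp
next
  case False
  assume x: "0 \<le> x" "x \<le> pi / 2"
  have "sin (pi / 6) \<le> sin x" using x False by (intro sin_monotone_2pi_le) auto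
  then show ?thesis using x pi_less_4 by (simp add: sin_30)
qed

lemma norm_ee_minus_one_ge:
  assumes "\<bar>of_int k * x - of_int p\<bar> \<le> 1 / 2"
  shows "\<bar>of_int k * x - of_int p\<bar> \<le> cmod (ee k x - 1)"
proof -
  define t where "t = of_int k * x - of_int p"
  have "2 * pi * of_int k * x = 2 * pi * t + 2 * pi * of_int p" by (simp add: t_def algebra_simps)
  then have "ee k x = cis (2 * pi * t) * cis (2 * pi * of_int p)"
    unfolding ee_def by (simp only: cis_mult)
  then have "ee k x = cis (2 * pi * t)" by (simp add: cis_multiple_2pi)
  also have "cis (2 * pi * t) - 1 = cis (pi * t) * (cis (pi * t) - cis (- (pi * t)))"
    unfolding right_diff_distrib cis_mult by (simp add: algebra_simps)
  also have "cis (pi * t) - cis (- (pi * t)) = 2 * \<i> * sin (pi * t)" by (simp add: complex_eq_iff)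
  finally have e: "cmod (ee k x - 1) = 2 * \<bar>sin (pi * t)\<bar>" by (simp add: norm_mult)
  have "pi * \<bar>t\<bar> / 4 \<le> sin (pi * \<bar>t\<bar>)" using assms by (intro sin_ge_quarter) (auto simp: t_def)
  also have "\<dots> \<le> \<bar>sin (pi * t)\<bar>" by (cases "t \<ge> 0") auto
  finally have "pi * \<bar>t\<bar> / 2 \<le> cmod (ee k x - 1)" unfolding e by simp
  moreover have "\<bar>t\<bar> \<le> pi * \<bar>t\<bar> / 2" using pi_ge_two mult_right_mono[of 2 pi "\<bar>t\<bar>"] by simp
  ultimately show ?thesis by (simp add: t_def)
qed

text \<open>A best approximation without continued fractions. \<open>q'\<close> is optimal among the
  denominators up to \<open>Q + 1\<close> and \<open>q\<close> is the first to beat it, so each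
  \<open>k < q\<close> is at least as far from the integers as \<open>q'\<close> is. The determinant
  \<open>n\<close> of the two approximations is a nonzero integer of modulus at most
  \<open>2 q D q'\<close>, which bounds \<open>D q'\<close> from below.\<close>

lemma good_denominator:
  assumes irr: "\<alpha> \<notin> \<rat>"
  shows "\<exists>q::nat>Q. \<forall>k::nat. 0 < k \<and> k < q \<longrightarrow> (\<forall>p::int. 1 / (2 * real q) \<le> \<bar>real k * \<alpha> - of_int p\<bar>)"
proof -
  define D where "D k = \<bar>real k * \<alpha> - of_int (round (real k * \<alpha>))\<bar>" for k :: nat
  have D0: "D k > 0" if "k > 0" for k
  proof (rule ccontr)
    assume "\<not> D k > 0"
    then have "real k * \<alpha> = of_int (round (real k * \<alpha>))" by (simp add: D_def)
    then have "\<alpha> = of_int (round (real k * \<alpha>)) / of_int (int k)" using that by (simp add: field_simps)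
    then show False using irr by (metis Rats_divide Rats_of_int)
  qed
  have Dmin: "D k \<le> \<bar>real k * \<alpha> - of_int p\<bar>" for k p
    unfolding D_def by (rule round_diff_minimal)
  obtain q' where q': "q' \<in> {1..Suc Q}" and min: "\<And>k. k \<in> {1..Suc Q} \<Longrightarrow> D q' \<le> D k"
    using ex_is_arg_min_if_finite[of "{1..Suc Q}" D] by (auto simp: is_arg_min_linorder)
  obtain m where "inverse (real (Suc m)) < D q'"
    using reals_Archimedean[OF D0[of q']] q' by auto
  then obtain N :: nat where N: "N > 0" "1 / real N < D q'"
    by (metis inverse_eq_divide zero_less_Suc)
  \<comment> \<open>Dirichlet supplies some denominator that beats \<open>q'\<close>, so there is a
    least one.\<close>
  obtain h k where hk: "0 < k" "k \<le> int N" "\<bar>real_of_int k * \<alpha> - of_int h\<bar> < 1 / real N"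
    using Dirichlet_approx[OF N(1)] by blast
  have "D (nat k) < D q'"
    using Dmin[of "nat k" h] hk N(2) by simp
  then have ex: "\<exists>k>0. D k < D q'" using hk(1) by (intro exI[of _ "nat k"]) simp
  define q where "q = (LEAST k. k > 0 \<and> D k < D q')"
  have q: "q > 0" "D q < D q'" using LeastI_ex[OF ex] by (auto simp: q_def)
  have least: "D q' \<le> D k" if "0 < k" "k < q" for k
    using not_less_Least[of k "\<lambda>k. k > 0 \<and> D k < D q'"] that by (force simp: q_def)
  have "q > Suc Q" using min[of q] q by (cases "q \<le> Suc Q") auto
  then have "q' < q" "0 < q'" using q' by auto
  define p p' where "p = round (real q * \<alpha>)" and "p' = round (real q' * \<alpha>)"
  define n where "n = p * int q' - p' * int q"
  have n: "of_int n = real q * (real q' * \<alpha> - p') - real q' * (real q * \<alpha> - p)"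
    by (simp add: n_def algebra_simps)
  \<comment> \<open>If \<open>n\<close> were 0, the two errors would be proportional to their
    denominators, but the larger denominator has the smaller error.\<close>
  have "n \<noteq> 0"
  proof
    assume "n = 0"
    then have "real q * (real q' * \<alpha> - p') = real q' * (real q * \<alpha> - p)" using n by simp
    then have "real q * D q' = real q' * D q"
      unfolding D_def p_def p'_def by (metis abs_mult abs_of_nat)
    moreover have "real q' * D q < real q * D q'"
      using q \<open>q' < q\<close> D0[of q] by (intro mult_strict_mono) auto
    ultimately show False by simp
  qed
  then have "1 \<le> \<bar>real_of_int n\<bar>" by linarith
  also have "\<dots> \<le> \<bar>real q * (real q' * \<alpha> - p')\<bar> + \<bar>real q' * (real q * \<alpha> - p)\<bar>"
    unfolding n by (rule abs_triangle_ineq4)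
  also have "\<dots> = real q * D q' + real q' * D q"
    by (simp add: D_def p_def p'_def abs_mult)
  also have "real q' * D q \<le> real q * D q'"
    using q \<open>q' < q\<close> D0[of q] by (intro mult_mono) auto
  finally have "1 / (2 * real q) \<le> D q'" using q(1) by (simp add: field_simps)
  then have "1 / (2 * real q) \<le> \<bar>real k * \<alpha> - of_int p\<bar>" if "0 < k" "k < q" for k p
    using least[OF that] Dmin[of k p] by linarith
  then show ?thesis using \<open>q > Suc Q\<close> by (intro exI[of _ q]) auto
qed

lemma small_divisor_bound:
  assumes irr: "\<alpha> \<notin> \<rat>"
  shows "\<exists>q::nat>Q. \<forall>k::int. 0 < \<bar>k\<bar> \<and> \<bar>k\<bar> < int q \<longrightarrow> 1 / (2 * real q) \<le> cmod (ee k \<alpha> - 1)"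
proof -
  obtain q where q: "q > Q" and *: "\<And>k p. 0 < k \<Longrightarrow> k < q \<Longrightarrow> 1 / (2 * real q) \<le> \<bar>real k * \<alpha> - of_int p\<bar>"
    using good_denominator[OF irr, of Q] by blast
  have pos: "1 / (2 * real q) \<le> cmod (ee k \<alpha> - 1)" if "0 < k" "k < int q" for k
  proof -
    have "real (nat k) = of_int k" using that by simp
    moreover have "1 / (2 * real q) \<le> \<bar>real (nat k) * \<alpha> - of_int (round (of_int k * \<alpha>))\<bar>"
      by (rule *) (use that in auto)
    ultimately have "1 / (2 * real q) \<le> \<bar>of_int k * \<alpha> - of_int (round (of_int k * \<alpha>))\<bar>"
      by (simp only:)
    also have "\<dots> \<le> cmod (ee k \<alpha> - 1)"
      using of_int_round_abs_le[of "of_int k * \<alpha>"]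
      by (intro norm_ee_minus_one_ge) (simp add: abs_minus_commute)
    finally show ?thesis .
  qed
  have sym: "cmod (ee (- k) \<alpha> - 1) = cmod (ee k \<alpha> - 1)" for k
    by (metis cnj_ee complex_cnj_diff complex_cnj_one complex_mod_cnj)
  have "1 / (2 * real q) \<le> cmod (ee k \<alpha> - 1)" if "0 < \<bar>k\<bar>" "\<bar>k\<bar> < int q" for k
    using that pos[of k] pos[of "- k"] sym[of k] by (cases "k > 0") auto
  then show ?thesis using q by blast
qed

section \<open>Linear algebra\<close>

lemma cvnorm_L2_set: "cvnorm u = L2_set (\<lambda>i. cmod (vec_index u i)) {..<dim_vec u}"
  by (simp add: cvnorm_def L2_set_def)

lemma cvnorm_nonneg [simp]: "0 \<le> cvnorm u"
  by (simp add: cvnorm_L2_set)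

lemma cvnorm_le_sum: "cvnorm u \<le> (\<Sum>i<dim_vec u. cmod (vec_index u i))"
  unfolding cvnorm_L2_set by (rule L2_set_le_sum) simp

lemma cmod_index_le_cvnorm: "i < dim_vec u \<Longrightarrow> cmod (vec_index u i) \<le> cvnorm u"
  unfolding cvnorm_L2_set by (rule member_le_L2_set) auto

lemma cvnorm_eq_0_iff: "u \<in> carrier_vec m \<Longrightarrow> cvnorm u = 0 \<longleftrightarrow> u = 0\<^sub>v m"
  by (auto simp: cvnorm_L2_set L2_set_eq_0_iff intro!: eq_vecI)

lemma cvnorm_zero [simp]: "cvnorm (0\<^sub>v m) = 0"
  by (simp add: cvnorm_eq_0_iff[of _ m])

lemma cvnorm_smult: "cvnorm (c \<cdot>\<^sub>v u) = cmod c * cvnorm u"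
proof -
  have "cvnorm (c \<cdot>\<^sub>v u) = L2_set (\<lambda>i. cmod c * cmod (vec_index u i)) {..<dim_vec u}"
    unfolding cvnorm_L2_set by (intro L2_set_cong) (auto simp: norm_mult)
  then show ?thesis by (simp add: cvnorm_L2_set L2_set_right_distrib)
qed

lemma cvnorm_uminus: "cvnorm (- u) = cvnorm u"
  by (simp add: cvnorm_def)

lemma cvnorm_add:
  assumes "u \<in> carrier_vec m" "v \<in> carrier_vec m"
  shows "cvnorm (u + v) \<le> cvnorm u + cvnorm v"
proof -
  have "cvnorm (u + v) \<le> L2_set (\<lambda>i. cmod (vec_index u i) + cmod (vec_index v i)) {..<m}"
    unfolding cvnorm_L2_set using assms by (auto intro!: L2_set_mono norm_triangle_ineq)
  also have "\<dots> \<le> cvnorm u + cvnorm v"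
    unfolding cvnorm_L2_set using assms by (auto intro: L2_set_triangle_ineq)
  finally show ?thesis .
qed

lemma cvnorm_diff:
  assumes "u \<in> carrier_vec m" "v \<in> carrier_vec m"
  shows "cvnorm (u - v) \<le> cvnorm u + cvnorm v"
  using cvnorm_add[of u m "- v"] assms
  by (simp add: cvnorm_uminus minus_add_uminus_vec[of _ m])

text \<open>A bound for the operator norm, chosen because its continuity in the entries is
  immediate.\<close>

definition entry_sum :: "complex mat \<Rightarrow> real" where
  "entry_sum A = (\<Sum>i<dim_row A. \<Sum>j<dim_col A. cmod (A $$ (i, j)))"

lemma entry_sum_nonneg [simp]: "0 \<le> entry_sum A"
  by (simp add: entry_sum_def sum_nonneg)

lemma mult_mat_vec_index:
  assumes "A \<in> carrier_mat n m" "x \<in> carrier_vec m" "i < n"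
  shows "vec_index (A *\<^sub>v x) i = (\<Sum>j<m. A $$ (i, j) * vec_index x j)"
  using assms by (auto simp: scalar_prod_def atLeast0LessThan intro!: sum.cong)

lemma cvnorm_mult_mat_vec:
  assumes A: "A \<in> carrier_mat n m" and x: "x \<in> carrier_vec m"
  shows "cvnorm (A *\<^sub>v x) \<le> entry_sum A * cvnorm x"
proof -
  have "cvnorm (A *\<^sub>v x) \<le> (\<Sum>i<n. cmod (vec_index (A *\<^sub>v x) i))"
    using cvnorm_le_sum[of "A *\<^sub>v x"] A by simp
  also have "\<dots> \<le> (\<Sum>i<n. \<Sum>j<m. cmod (A $$ (i, j)) * cvnorm x)"
  proof (intro sum_mono)
    fix i assume "i \<in> {..<n}"
    then have "cmod (vec_index (A *\<^sub>v x) i) \<le> (\<Sum>j<m. cmod (A $$ (i, j) * vec_index x j))"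
      using mult_mat_vec_index[OF A x] by (auto intro: norm_sum)
    also have "\<dots> \<le> (\<Sum>j<m. cmod (A $$ (i, j)) * cvnorm x)"
      using x by (intro sum_mono) (auto simp: norm_mult intro!: mult_left_mono cmod_index_le_cvnorm)
    finally show "cmod (vec_index (A *\<^sub>v x) i) \<le> (\<Sum>j<m. cmod (A $$ (i, j)) * cvnorm x)" .
  qed
  also have "\<dots> = entry_sum A * cvnorm x"
    using A by (simp add: entry_sum_def sum_distrib_right)
  finally show ?thesis .
qed

text \<open>The adjugate stands in for the inverse: its entries are polynomials in those of
  \<open>A\<close>, so the constant depends continuously on an invertible \<open>A\<close>.\<close>

lemma cvnorm_le_adj_mat:
  assumes A: "A \<in> carrier_mat m m" and d: "Determinant.det A \<noteq> 0" and x: "x \<in> carrier_vec m"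
  shows "cvnorm x \<le> entry_sum (adj_mat A) / cmod (Determinant.det A) * cvnorm (A *\<^sub>v x)"
proof -
  have "adj_mat A *\<^sub>v (A *\<^sub>v x) = (adj_mat A * A) *\<^sub>v x"
    using A x adj_mat(1)[OF A] by simp
  also have "\<dots> = Determinant.det A \<cdot>\<^sub>v x"
  proof (rule eq_vecI)
    fix i assume "i < dim_vec (Determinant.det A \<cdot>\<^sub>v x)"
    then have i: "i < m" using x by simp
    have "vec_index ((adj_mat A * A) *\<^sub>v x) i
        = (\<Sum>j<m. (Determinant.det A \<cdot>\<^sub>m 1\<^sub>m m) $$ (i, j) * vec_index x j)"
      unfolding adj_mat(3)[OF A] by (rule mult_mat_vec_index[OF _ x i]) simp
    also have "\<dots> = (\<Sum>j<m. if j = i then Determinant.det A * vec_index x i else 0)"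
      using i by (intro sum.cong) auto
    finally show "vec_index ((adj_mat A * A) *\<^sub>v x) i = vec_index (Determinant.det A \<cdot>\<^sub>v x) i"
      using i x by simp
  qed (use A x adj_mat(1)[OF A] in auto)
  finally have "cmod (Determinant.det A) * cvnorm x = cvnorm (adj_mat A *\<^sub>v (A *\<^sub>v x))"
    by (simp add: cvnorm_smult)
  also have "\<dots> \<le> entry_sum (adj_mat A) * cvnorm (A *\<^sub>v x)"
    using adj_mat(1)[OF A] A x by (intro cvnorm_mult_mat_vec) auto
  finally show ?thesis using d by (simp add: field_simps)
qed

lemma mult_smult_mat_vec:
  assumes "(A :: complex mat) \<in> carrier_mat n m" "x \<in> carrier_vec m"
  shows "A *\<^sub>v (c \<cdot>\<^sub>v x) = c \<cdot>\<^sub>v (A *\<^sub>v x)"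
  by (rule mult_mat_vec[OF assms])

lemma cspan_carrier: "x \<in> cspan m g n \<Longrightarrow> x \<in> carrier_vec m"
  by (auto simp: cspan_def)

lemma cspan_add:
  assumes "x \<in> cspan m g n" "y \<in> cspan m g n"
  shows "x + y \<in> cspan m g n"
proof -
  obtain c c' where "x = Matrix.vec m (\<lambda>j. \<Sum>i<n. c i * vec_index (g i) j)"
    "y = Matrix.vec m (\<lambda>j. \<Sum>i<n. c' i * vec_index (g i) j)"
    using assms by (auto simp: cspan_def)
  then have "x + y = Matrix.vec m (\<lambda>j. \<Sum>i<n. (c i + c' i) * vec_index (g i) j)"
    by (intro eq_vecI) (auto simp: ring_distribs sum.distrib)
  then show ?thesis unfolding cspan_def by (auto intro!: exI[of _ "\<lambda>i. c i + c' i"])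
qed

lemma cspan_smult:
  assumes "x \<in> cspan m g n"
  shows "a \<cdot>\<^sub>v x \<in> cspan m g n"
proof -
  obtain c where "x = Matrix.vec m (\<lambda>j. \<Sum>i<n. c i * vec_index (g i) j)"
    using assms by (auto simp: cspan_def)
  then have "a \<cdot>\<^sub>v x = Matrix.vec m (\<lambda>j. \<Sum>i<n. (a * c i) * vec_index (g i) j)"
    by (intro eq_vecI) (auto simp: sum_distrib_left mult_ac)
  then show ?thesis unfolding cspan_def by (auto intro!: exI[of _ "\<lambda>i. a * c i"])
qed

text \<open>Two subspaces of dimension \<open>n > m/2\<close>, here the span of \<open>g\<close> and its preimage under \<open>J\<close>, intersect.\<close>

lemma cspan_meets_preimage:
  assumes g: "\<And>i. i < n \<Longrightarrow> g i \<in> carrier_vec m" and J: "J \<in> carrier_mat m m" and n: "m < 2 * n"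
    and indep: "\<And>c i. Matrix.vec m (\<lambda>j. \<Sum>i<n. c i * vec_index (g i) j) = 0\<^sub>v m \<Longrightarrow> i < n \<Longrightarrow> c i = (0::complex)"
  shows "\<exists>s\<in>cspan m g n. s \<noteq> 0\<^sub>v m \<and> J *\<^sub>v s \<in> cspan m g n"
proof -
  let ?lc = "\<lambda>c. Matrix.vec m (\<lambda>j. \<Sum>i<n. c i * vec_index (g i) j)"
  \<comment> \<open>The vectors \<open>J g\<close> and \<open>- g\<close> give \<open>2 * n\<close>
    columns of height \<open>m\<close>, padded by zero rows to a square matrix. Row \<open>m\<close>
    is a zero row because \<open>m < 2 * n\<close>, so the determinant vanishes. A kernel vector
    splits into coefficients \<open>c\<close> and \<open>c'\<close> for which \<open>J\<close> maps
    one combination to the other.\<close>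
  define W where "W = mat (2 * n) (2 * n) (\<lambda>(r, c). if r < m then
      (if c < n then vec_index (J *\<^sub>v g c) r else - vec_index (g (c - n)) r) else 0)"
  have W: "W \<in> carrier_mat (2 * n) (2 * n)" by (simp add: W_def)
  have "W\<^sup>T *\<^sub>v unit_vec (2 * n) m = 0\<^sub>v (2 * n)"
    using n by (intro eq_vecI) (auto simp: W_def)
  moreover have "unit_vec (2 * n) m \<noteq> (0\<^sub>v (2 * n) :: complex vec)"
    using n by (metis index_unit_vec(2) index_zero_vec(1) zero_neq_one)
  ultimately have "\<exists>v. v \<in> carrier_vec (2 * n) \<and> v \<noteq> 0\<^sub>v (2 * n) \<and> W\<^sup>T *\<^sub>v v = 0\<^sub>v (2 * n)"
    by (intro exI[of _ "unit_vec (2 * n) m"]) simp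
  then have "Determinant.det (W\<^sup>T) = 0"
    by (subst det_0_iff_vec_prod_zero_field[of _ "2 * n"]) (use W in simp_all)
  then have "Determinant.det W = 0" using det_transpose[OF W] by simp
  then obtain v where v: "v \<in> carrier_vec (2 * n)" "v \<noteq> 0\<^sub>v (2 * n)" "W *\<^sub>v v = 0\<^sub>v (2 * n)"
    using det_0_iff_vec_prod_zero_field[OF W] by blast
  define c c' where "c i = vec_index v i" and "c' i = vec_index v (n + i)" for i
  have lc: "?lc c \<in> cspan m g n" for c by (auto simp: cspan_def)
  have eq: "J *\<^sub>v ?lc c = ?lc c'"
  proof (rule eq_vecI)
    fix r assume "r < dim_vec (?lc c')"
    then have r: "r < m" by simp
    have split: "(\<Sum>i<2 * n. f i) = (\<Sum>i<n. f i) + (\<Sum>i<n. f (n + i))" for f :: "nat \<Rightarrow> complex"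
    proof -
      have "(\<Sum>i = 0..<n. f i) + (\<Sum>i = n..<n + n. f i) = (\<Sum>i = 0..<n + n. f i)"
        by (rule sum.atLeastLessThan_concat) auto
      moreover have "(\<Sum>i = n..<n + n. f i) = (\<Sum>i = 0..<n. f (n + i))"
        using sum.shift_bounds_nat_ivl[of f 0 n n] by (simp add: add.commute)
      ultimately show ?thesis unfolding atLeast0LessThan mult_2 by simp
    qed
    have "0 = vec_index (W *\<^sub>v v) r" using v(3) r n by simp
    also have "\<dots> = (\<Sum>i<2 * n. W $$ (r, i) * vec_index v i)"
      using r n by (intro mult_mat_vec_index[OF W v(1)]) simp
    also have "\<dots> = (\<Sum>i<n. vec_index (J *\<^sub>v g i) r * c i) - (\<Sum>i<n. vec_index (g i) r * c' i)"
      unfolding split using r n by (simp add: W_def c_def c'_def sum_negf del: index_mult_mat_vec)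
    finally have "(\<Sum>i<n. vec_index (J *\<^sub>v g i) r * c i) = (\<Sum>i<n. vec_index (g i) r * c' i)" by simp
    moreover have "vec_index (J *\<^sub>v ?lc c) r = (\<Sum>i<n. vec_index (J *\<^sub>v g i) r * c i)"
    proof -
      have "vec_index (J *\<^sub>v ?lc c) r = (\<Sum>j<m. \<Sum>i<n. J $$ (r, j) * (c i * vec_index (g i) j))"
        using mult_mat_vec_index[OF J _ r, of "?lc c"] by (simp add: sum_distrib_left)
      also have "\<dots> = (\<Sum>i<n. \<Sum>j<m. J $$ (r, j) * (c i * vec_index (g i) j))" by (rule sum.swap)
      also have "\<dots> = (\<Sum>i<n. vec_index (J *\<^sub>v g i) r * c i)"
      proof (rule sum.cong)
        fix i assume "i \<in> {..<n}"
        then show "(\<Sum>j<m. J $$ (r, j) * (c i * vec_index (g i) j)) = vec_index (J *\<^sub>v g i) r * c i"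
          using mult_mat_vec_index[OF J g[of i] r] by (simp add: sum_distrib_left mult_ac)
      qed simp
      finally show ?thesis .
    qed
    ultimately show "vec_index (J *\<^sub>v ?lc c) r = vec_index (?lc c') r" using r by (simp add: mult_ac)
  qed (use J in simp)
  have "?lc c \<noteq> 0\<^sub>v m"
  proof
    assume z: "?lc c = 0\<^sub>v m"
    have "J *\<^sub>v 0\<^sub>v m = 0\<^sub>v m" using J by (intro eq_vecI) auto
    then have "?lc c' = 0\<^sub>v m" using eq z by simp
    then have "vec_index v i = 0" if "i < 2 * n" for i
      using indep[OF z, of i] indep[of c' "i - n"] that by (cases "i < n") (auto simp: c_def c'_def)
    then show False using v(1,2) by (auto intro!: eq_vecI)
  qed
  moreover have "J *\<^sub>v ?lc c \<in> cspan m g n" unfolding eq by (rule lc)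
  ultimately show ?thesis using lc[of c] by blast
qed

section \<open>The conserved form of the dual cocycle\<close>

text \<open>\<open>vh\<close> is unconstrained outside \<open>{-d..d}\<close>, whereas differences
  of window indices reach \<open>2 * d - 1\<close>.\<close>

definition band_coeff :: "(int \<Rightarrow> complex) \<Rightarrow> nat \<Rightarrow> int \<Rightarrow> complex" where
  "band_coeff vh d k = (if \<bar>k\<bar> \<le> int d then vh k else 0)"

text \<open>The commutator of the hopping operator with the indicator of a half-line. Index
  \<open>i\<close> stands for site \<open>d - 1 - i\<close>, so \<open>i < d\<close> means a site at
  or above 0. For \<open>d = 1\<close> the form is a Wronskian, up to coefficients and
  conjugation.\<close>

definition flux_mat :: "(int \<Rightarrow> complex) \<Rightarrow> nat \<Rightarrow> complex mat" where
  "flux_mat vh d = mat (2 * d) (2 * d)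
    (\<lambda>(i, j). band_coeff vh d (int i - int j) * (of_bool (j < d) - of_bool (i < d)))"

definition flux :: "(int \<Rightarrow> complex) \<Rightarrow> nat \<Rightarrow> complex vec \<Rightarrow> complex vec \<Rightarrow> complex" where
  "flux vh d x y = (\<Sum>i<2 * d. cnj (vec_index x i) * vec_index (flux_mat vh d *\<^sub>v y) i)"

lemma flux_mat_carrier [simp]: "flux_mat vh d \<in> carrier_mat (2 * d) (2 * d)"
  by (simp add: flux_mat_def)

lemma dualL_carrier [simp]: "dualL E vh d \<theta> \<in> carrier_mat (2 * d) (2 * d)"
  by (simp add: dualL_def)

lemma flux_bound:
  assumes "x \<in> carrier_vec (2 * d)" "y \<in> carrier_vec (2 * d)"
  shows "cmod (flux vh d x y) \<le> entry_sum (flux_mat vh d) * cvnorm x * cvnorm y"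
proof -
  let ?z = "flux_mat vh d *\<^sub>v y"
  have z: "?z \<in> carrier_vec (2 * d)" by (rule mult_mat_vec_carrier[OF flux_mat_carrier assms(2)])
  have "cmod (flux vh d x y) \<le> (\<Sum>i<2 * d. \<bar>cmod (vec_index x i)\<bar> * \<bar>cmod (vec_index ?z i)\<bar>)"
    unfolding flux_def by (rule order_trans[OF norm_sum]) (simp add: norm_mult)
  also have "\<dots> \<le> cvnorm x * cvnorm ?z"
    unfolding cvnorm_L2_set carrier_vecD[OF z] carrier_vecD[OF assms(1)] by (rule L2_set_mult_ineq)
  also have "\<dots> \<le> cvnorm x * (entry_sum (flux_mat vh d) * cvnorm y)"
    by (intro mult_left_mono cvnorm_mult_mat_vec[OF flux_mat_carrier] assms) simp
  finally show ?thesis by (simp add: mult_ac)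
qed

text \<open>This turns non-isotropy into a number: a space that contains both \<open>y\<close> and
  \<open>J y\<close> carries a value of the form as large as |J y|^2.\<close>

lemma flux_self:
  assumes "y \<in> carrier_vec (2 * d)"
  shows "cmod (flux vh d (flux_mat vh d *\<^sub>v y) y) = (cvnorm (flux_mat vh d *\<^sub>v y))\<^sup>2"
proof -
  let ?z = "flux_mat vh d *\<^sub>v y"
  have z: "dim_vec ?z = 2 * d" by (simp add: flux_mat_def)
  have "flux vh d ?z y = of_real (\<Sum>i<2 * d. (cmod (vec_index ?z i))\<^sup>2)"
    unfolding flux_def by (simp add: complex_norm_square mult.commute del: of_real_power index_mult_mat_vec)
  also have "(\<Sum>i<2 * d. (cmod (vec_index ?z i))\<^sup>2) = (cvnorm ?z)\<^sup>2"
    unfolding cvnorm_def z by (simp add: sum_nonneg)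
  finally show ?thesis by (simp add: norm_power)
qed

text \<open>A vector is read as the values \<open>X s\<close> at the sites \<open>s = d-1, \<dots>, -d\<close>; applying the
  transfer matrix appends the site \<open>d\<close> and drops the site \<open>-d\<close>, so both windows sit in one
  sequence on \<open>{-d..d}\<close> that solves the difference equation at site \<open>0\<close>.\<close>

lemma flux_eq_site_sum:
  fixes X Y :: "int \<Rightarrow> complex"
  assumes "x \<in> carrier_vec (2 * d)" "y \<in> carrier_vec (2 * d)"
    and X: "\<And>i. i < 2 * d \<Longrightarrow> vec_index x i = X (c + int d - 1 - int i)"
    and Y: "\<And>i. i < 2 * d \<Longrightarrow> vec_index y i = Y (c + int d - 1 - int i)"
    and c: "c \<in> {0, 1}"
  shows "flux vh d x y = (\<Sum>s\<in>{- int d..int d}. \<Sum>t\<in>{- int d..int d}.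
    cnj (X s) * band_coeff vh d (t - s) * Y t * (of_bool (t \<ge> c) - of_bool (s \<ge> c)))"
proof -
  let ?W = "{c - int d..c + int d - 1}"
  let ?f = "\<lambda>s t. cnj (X s) * band_coeff vh d (t - s) * Y t * (of_bool (t \<ge> c) - of_bool (s \<ge> c))"
  have re: "(\<Sum>i<2 * d. g (c + int d - 1 - int i)) = (\<Sum>s\<in>?W. g s)" for g :: "int \<Rightarrow> complex"
    by (rule sum.reindex_bij_witness[of _ "\<lambda>s. nat (c + int d - 1 - s)" "\<lambda>i. c + int d - 1 - int i"]) auto
  have "flux vh d x y = (\<Sum>i<2 * d. \<Sum>j<2 * d. ?f (c + int d - 1 - int i) (c + int d - 1 - int j))"
    unfolding flux_def
  proof (rule sum.cong)
    fix i assume "i \<in> {..<2 * d}"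
    then have i: "i < 2 * d" by simp
    have "vec_index (flux_mat vh d *\<^sub>v y) i = (\<Sum>j<2 * d. flux_mat vh d $$ (i, j) * vec_index y j)"
      by (rule mult_mat_vec_index[OF flux_mat_carrier assms(2) i])
    then have "cnj (vec_index x i) * vec_index (flux_mat vh d *\<^sub>v y) i
        = (\<Sum>j<2 * d. cnj (vec_index x i) * (flux_mat vh d $$ (i, j) * vec_index y j))"
      by (simp only: sum_distrib_left)
    also have "\<dots> = (\<Sum>j<2 * d. ?f (c + int d - 1 - int i) (c + int d - 1 - int j))"
    proof (rule sum.cong)
      fix j assume "j \<in> {..<2 * d}"
      then have j: "j < 2 * d" by simp
      have "(c \<le> c + int d - 1 - int j) = (j < d)" "(c \<le> c + int d - 1 - int i) = (i < d)" by auto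
      then show "cnj (vec_index x i) * (flux_mat vh d $$ (i, j) * vec_index y j)
          = ?f (c + int d - 1 - int i) (c + int d - 1 - int j)"
        using i j X[OF i] Y[OF j] by (simp add: flux_mat_def mult_ac)
    qed simp
    finally show "cnj (vec_index x i) * vec_index (flux_mat vh d *\<^sub>v y) i
        = (\<Sum>j<2 * d. ?f (c + int d - 1 - int i) (c + int d - 1 - int j))" .
  qed simp
  also have "\<dots> = (\<Sum>i<2 * d. \<Sum>t\<in>?W. ?f (c + int d - 1 - int i) t)"
    by (rule sum.cong[OF refl], rule re)
  also have "\<dots> = (\<Sum>s\<in>?W. \<Sum>t\<in>?W. ?f s t)"
    by (rule re[of "\<lambda>s. \<Sum>t\<in>?W. ?f s t"])
  \<comment> \<open>Both windows are enlarged to the common range \<open>{-d..d}\<close>. The added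
    site interacts only with sites within distance \<open>d\<close>, all on its own side of the cut,
    where the two indicators agree.\<close>
  also have "\<dots> = (\<Sum>s\<in>?W. \<Sum>t\<in>{- int d..int d}. ?f s t)"
    using c by (intro sum.cong refl sum.mono_neutral_left) (auto simp: band_coeff_def)
  also have "\<dots> = (\<Sum>s\<in>{- int d..int d}. \<Sum>t\<in>{- int d..int d}. ?f s t)"
    using c by (intro sum.mono_neutral_left) (auto simp: band_coeff_def intro!: sum.neutral)
  finally show ?thesis .
qed

lemma dualL_index:
  assumes x: "x \<in> carrier_vec (2 * d)" and d: "d \<ge> 1" "vh (int d) \<noteq> 0"
  shows "i + 1 < 2 * d \<Longrightarrow> vec_index (dualL E vh d \<theta> *\<^sub>v x) (i + 1) = vec_index x i"
    and "vh (int d) * vec_index (dualL E vh d \<theta> *\<^sub>v x) 0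
      = (\<Sum>j<2 * d. (of_bool (j + 1 = d) * of_real (E - 2 * cos (2 * pi * \<theta>))
          - vh (int d - 1 - int j)) * vec_index x j)"
proof -
  assume i: "i + 1 < 2 * d"
  have "vec_index (dualL E vh d \<theta> *\<^sub>v x) (i + 1)
      = (\<Sum>j<2 * d. dualL E vh d \<theta> $$ (i + 1, j) * vec_index x j)"
    by (rule mult_mat_vec_index[OF dualL_carrier x i])
  also have "\<dots> = (\<Sum>j<2 * d. if j = i then vec_index x i else 0)"
    using i by (intro sum.cong) (auto simp: dualL_def)
  finally show "vec_index (dualL E vh d \<theta> *\<^sub>v x) (i + 1) = vec_index x i" using i by simp
next
  have "vh (int d) * vec_index (dualL E vh d \<theta> *\<^sub>v x) 0
      = vh (int d) * (\<Sum>j<2 * d. dualL E vh d \<theta> $$ (0, j) * vec_index x j)"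
    using d by (subst mult_mat_vec_index[OF dualL_carrier x]) auto
  also have "\<dots> = (\<Sum>j<2 * d. (of_bool (j + 1 = d) * of_real (E - 2 * cos (2 * pi * \<theta>))
          - vh (int d - 1 - int j)) * vec_index x j)"
    unfolding sum_distrib_left using d by (intro sum.cong refl) (auto simp: dualL_def)
  finally show "vh (int d) * vec_index (dualL E vh d \<theta> *\<^sub>v x) 0
      = (\<Sum>j<2 * d. (of_bool (j + 1 = d) * of_real (E - 2 * cos (2 * pi * \<theta>))
          - vh (int d - 1 - int j)) * vec_index x j)" .
qed

lemma dualL_site_sequence:
  assumes x: "x \<in> carrier_vec (2 * d)" and d: "d \<ge> 1" "vh (int d) \<noteq> 0"
  shows "\<exists>X. (\<forall>i<2 * d. vec_index x i = X (0 + int d - 1 - int i)) \<and>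
    (\<forall>i<2 * d. vec_index (dualL E vh d \<theta> *\<^sub>v x) i = X (1 + int d - 1 - int i)) \<and>
    (\<Sum>t\<in>{- int d..int d}. vh t * X t) = of_real (E - 2 * cos (2 * pi * \<theta>)) * X 0"
proof -
  let ?A = "dualL E vh d \<theta> *\<^sub>v x" and ?e = "complex_of_real (E - 2 * cos (2 * pi * \<theta>))"
  define X where "X s = (if s = int d then vec_index ?A 0 else vec_index x (nat (int d - 1 - s)))" for s
  have X1: "vec_index x i = X (0 + int d - 1 - int i)" if "i < 2 * d" for i
    by (simp add: X_def)
  have X2: "vec_index ?A i = X (1 + int d - 1 - int i)" if i: "i < 2 * d" for i
  proof (cases i)
    case (Suc j)
    then have "nat (int d - 1 - (1 + int d - 1 - int i)) = j" by simp
    then show ?thesis using dualL_index(1)[of x d vh j E \<theta>] x d i Suc by (simp add: X_def del: index_mult_mat_vec)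
  qed (simp add: X_def)
  have "(\<Sum>t\<in>{- int d..int d}. vh t * X t) = vh (int d) * X (int d) + (\<Sum>t\<in>{- int d..<int d}. vh t * X t)"
  proof -
    have "{- int d..int d} = insert (int d) {- int d..<int d}" by auto
    then show ?thesis by simp
  qed
  also have "(\<Sum>t\<in>{- int d..<int d}. vh t * X t) = (\<Sum>j<2 * d. vh (int d - 1 - int j) * vec_index x j)"
    by (rule sum.reindex_bij_witness[of _ "\<lambda>i. int d - 1 - int i" "\<lambda>s. nat (int d - 1 - s)"])
      (auto simp: X_def)
  also have "vh (int d) * X (int d) = vh (int d) * vec_index ?A 0" by (simp add: X_def)
  also have "\<dots> + (\<Sum>j<2 * d. vh (int d - 1 - int j) * vec_index x j)
      = (\<Sum>j<2 * d. of_bool (j + 1 = d) * ?e * vec_index x j)"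
    unfolding dualL_index(2)[of x d vh, OF x d] sum.distrib[symmetric] by (simp add: algebra_simps)
  also have "\<dots> = (\<Sum>j<2 * d. if j = d - 1 then ?e * vec_index x (d - 1) else 0)"
    using d(1) by (intro sum.cong) auto
  also have "\<dots> = ?e * vec_index x (d - 1)"
  proof -
    have "d - 1 < 2 * d" using d(1) by linarith
    then show ?thesis by simp
  qed
  also have "\<dots> = ?e * X 0" using d(1) by (simp add: X_def nat_diff_distrib)
  finally show ?thesis using X1 X2 by blast
qed

text \<open>Moving the cut by one site changes the form only in the terms with \<open>s = 0\<close>
  or \<open>t = 0\<close>. By the equation at site 0 these sum to
  \<open>conj (e X 0) Y 0 - conj (X 0) e Y 0\<close>, which vanishes because
  \<open>e = E - 2 cos\<close> is real.\<close>

lemma flux_invariant: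
  assumes x: "x \<in> carrier_vec (2 * d)" and y: "y \<in> carrier_vec (2 * d)"
    and d: "d \<ge> 1" "vh (int d) \<noteq> 0"
    and sym: "\<And>k. \<bar>k\<bar> \<le> int d \<Longrightarrow> vh (- k) = cnj (vh k)"
  shows "flux vh d (dualL E vh d \<theta> *\<^sub>v x) (dualL E vh d \<theta> *\<^sub>v y) = flux vh d x y"
proof -
  let ?e = "complex_of_real (E - 2 * cos (2 * pi * \<theta>))"
  let ?I = "{- int d..int d}"
  obtain X where X: "\<And>i. i < 2 * d \<Longrightarrow> vec_index x i = X (0 + int d - 1 - int i)"
    "\<And>i. i < 2 * d \<Longrightarrow> vec_index (dualL E vh d \<theta> *\<^sub>v x) i = X (1 + int d - 1 - int i)"
    "(\<Sum>t\<in>?I. vh t * X t) = ?e * X 0"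
    using dualL_site_sequence[where vh=vh, OF x d, of E \<theta>] by blast
  obtain Y where Y: "\<And>i. i < 2 * d \<Longrightarrow> vec_index y i = Y (0 + int d - 1 - int i)"
    "\<And>i. i < 2 * d \<Longrightarrow> vec_index (dualL E vh d \<theta> *\<^sub>v y) i = Y (1 + int d - 1 - int i)"
    "(\<Sum>t\<in>?I. vh t * Y t) = ?e * Y 0"
    using dualL_site_sequence[where vh=vh, OF y d, of E \<theta>] by blast
  let ?g = "\<lambda>s t. cnj (X s) * band_coeff vh d (t - s) * Y t"
  have 0: "0 \<in> ?I" by simp
  have "flux vh d x y - flux vh d (dualL E vh d \<theta> *\<^sub>v x) (dualL E vh d \<theta> *\<^sub>v y)
      = (\<Sum>s\<in>?I. \<Sum>t\<in>?I. ?g s t * (of_bool (t = 0) - of_bool (s = 0)))"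
  proof -
    have "flux vh d x y = (\<Sum>s\<in>?I. \<Sum>t\<in>?I. ?g s t * (of_bool (t \<ge> 0) - of_bool (s \<ge> 0)))"
      by (rule flux_eq_site_sum[OF x y X(1) Y(1)]) auto
    moreover have "flux vh d (dualL E vh d \<theta> *\<^sub>v x) (dualL E vh d \<theta> *\<^sub>v y)
        = (\<Sum>s\<in>?I. \<Sum>t\<in>?I. ?g s t * (of_bool (t \<ge> 1) - of_bool (s \<ge> 1)))"
      by (rule flux_eq_site_sum[OF mult_mat_vec_carrier[OF dualL_carrier x]
          mult_mat_vec_carrier[OF dualL_carrier y] X(2) Y(2)]) auto
    moreover have "of_bool (t \<ge> 0) - of_bool (s \<ge> 0) - (of_bool (t \<ge> 1) - of_bool (s \<ge> 1))
        = (of_bool (t = 0) - of_bool (s = 0) :: complex)" for s t :: int by (auto split: split_of_bool)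
    ultimately show ?thesis by (simp only: sum_subtractf[symmetric] right_diff_distrib[symmetric])
  qed
  also have "\<dots> = (\<Sum>s\<in>?I. \<Sum>t\<in>?I. ?g s t * of_bool (t = 0)) - (\<Sum>s\<in>?I. \<Sum>t\<in>?I. ?g s t * of_bool (s = 0))"
    by (simp only: right_diff_distrib sum_subtractf)
  also have "(\<Sum>s\<in>?I. \<Sum>t\<in>?I. ?g s t * of_bool (t = 0)) = (\<Sum>s\<in>?I. cnj (vh s * X s)) * Y 0"
  proof -
    have inner: "(\<Sum>t\<in>?I. ?g s t * of_bool (t = 0)) = cnj (vh s * X s) * Y 0" if "s \<in> ?I" for s
    proof -
      have "(\<Sum>t\<in>?I. ?g s t * of_bool (t = 0)) = (\<Sum>t\<in>?I. if t = 0 then ?g s 0 else 0)"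
        by (intro sum.cong) auto
      also have "\<dots> = ?g s 0" by simp
      also have "band_coeff vh d (0 - s) = cnj (vh s)" using that sym[of s] by (auto simp: band_coeff_def abs_le_iff)
      finally show ?thesis by (simp add: mult_ac)
    qed
    show ?thesis unfolding sum_distrib_right by (rule sum.cong[OF refl inner])
  qed
  also have "(\<Sum>s\<in>?I. \<Sum>t\<in>?I. ?g s t * of_bool (s = 0)) = cnj (X 0) * (\<Sum>t\<in>?I. vh t * Y t)"
  proof -
    have "(\<Sum>s\<in>?I. \<Sum>t\<in>?I. ?g s t * of_bool (s = 0)) = (\<Sum>s\<in>?I. if s = 0 then (\<Sum>t\<in>?I. ?g 0 t) else 0)"
      by (intro sum.cong) auto
    also have "\<dots> = (\<Sum>t\<in>?I. ?g 0 t)" by simp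
    also have "\<dots> = (\<Sum>t\<in>?I. cnj (X 0) * (vh t * Y t))"
      by (intro sum.cong) (auto simp: band_coeff_def mult_ac)
    finally show ?thesis by (simp only: sum_distrib_left)
  qed
  also have "(\<Sum>s\<in>?I. cnj (vh s * X s)) = ?e * cnj (X 0)"
    using arg_cong[OF X(3), of cnj] by (simp only: cnj_sum complex_cnj_mult complex_cnj_complex_of_real)
  finally show ?thesis unfolding Y(3) by (simp add: mult_ac)
qed

text \<open>The diagonal blocks vanish because the indicators agree there. The off-diagonal blocks
  are triangular, with \<open>vh d\<close> and \<open>vh (-d)\<close> up to sign on the diagonal;
  \<open>hi\<close> and \<open>lo\<close> are the two substitutions.\<close>

lemma det_flux_mat_nonzero:
  assumes d: "vh (int d) \<noteq> 0" "vh (- int d) \<noteq> 0"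
  shows "Determinant.det (flux_mat vh d) \<noteq> 0"
proof
  assume "Determinant.det (flux_mat vh d) = 0"
  then obtain x where x: "x \<in> carrier_vec (2 * d)" "x \<noteq> 0\<^sub>v (2 * d)"
    and J: "flux_mat vh d *\<^sub>v x = 0\<^sub>v (2 * d)"
    using det_0_iff_vec_prod_zero_field[OF flux_mat_carrier] by blast
  let ?m = "\<lambda>i j. band_coeff vh d (int i - int j) * (of_bool (j < d) - of_bool (i < d)) * vec_index x j"
  have eq: "(\<Sum>j<2 * d. ?m i j) = 0" if "i < 2 * d" for i
  proof -
    have "0 = vec_index (flux_mat vh d *\<^sub>v x) i" unfolding J using that by simp
    also have "\<dots> = (\<Sum>j<2 * d. flux_mat vh d $$ (i, j) * vec_index x j)"
      by (rule mult_mat_vec_index[OF flux_mat_carrier x(1) that])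
    also have "\<dots> = (\<Sum>j<2 * d. ?m i j)"
      using that by (intro sum.cong) (auto simp: flux_mat_def)
    finally show ?thesis by (rule sym)
  qed
  have hi: "i < d \<Longrightarrow> vec_index x (d + i) = 0" for i
  proof (induction i rule: less_induct)
    case (less i)
    have "?m i j = 0" if j: "j < 2 * d" "j \<noteq> d + i" for j
    proof (cases "j < d \<or> j > d + i")
      case True
      then show ?thesis using less.prems by (auto simp: band_coeff_def)
    next
      case False
      then have "j - d < i" "j - d < d" "d + (j - d) = j" using j less.prems by auto
      then show ?thesis using less.IH[of "j - d"] by simp
    qed
    then have "(\<Sum>j<2 * d. ?m i j) = (\<Sum>j<2 * d. if j = d + i then ?m i (d + i) else 0)"
      by (intro sum.cong) auto
    also have "\<dots> = ?m i (d + i)" using less.prems by simp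
    finally show ?case using eq[of i] less.prems d by (simp add: band_coeff_def)
  qed
  have lo: "i < d \<Longrightarrow> vec_index x (d - 1 - i) = 0" for i
  proof (induction i rule: less_induct)
    case (less i)
    let ?r = "2 * d - 1 - i" and ?c = "d - 1 - i"
    have "?m ?r j = 0" if j: "j < 2 * d" "j \<noteq> ?c" for j
    proof (cases "j < ?c")
      case True
      then show ?thesis using less.prems by (auto simp: band_coeff_def)
    next
      case False
      show ?thesis
      proof (cases "j < d")
        case True
        then show ?thesis using less.IH[of "d - 1 - j"] False j less.prems by simp
      next
        case False
        moreover have "\<not> ?r < d" using less.prems by linarith
        ultimately show ?thesis by simp
      qed
    qed
    then have "(\<Sum>j<2 * d. ?m ?r j) = (\<Sum>j<2 * d. if j = ?c then ?m ?r ?c else 0)"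
      by (intro sum.cong) auto
    also have "\<dots> = ?m ?r ?c" using less.prems by simp
    also have "int ?r - int ?c = int d" using less.prems by linarith
    finally have "band_coeff vh d (int d) * (of_bool (?c < d) - of_bool (?r < d)) * vec_index x ?c = 0"
      using eq[of ?r] less.prems by simp
    moreover have "\<not> ?r < d" "?c < d" using less.prems by linarith+
    ultimately show ?case using d by (simp add: band_coeff_def)
  qed
  have "vec_index x i = 0" if "i < 2 * d" for i
    using hi[of "i - d"] lo[of "d - 1 - i"] that by (cases "i < d") auto
  then show False using x by (auto intro!: eq_vecI)
qed

section \<open>Iterates of the cocycle\<close>

lemma cociter_carrier:
  assumes "\<And>\<theta>. A \<theta> \<in> carrier_mat m m"
  shows "cociter m \<alpha> A n \<theta> \<in> carrier_mat m m"
  by (induction n) (auto intro!: mult_carrier_mat assms)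

lemma cociter_add:
  assumes A: "\<And>\<theta>. A \<theta> \<in> carrier_mat m m"
  shows "cociter m \<alpha> A (a + b) \<theta> = cociter m \<alpha> A b (\<theta> + real a * \<alpha>) * cociter m \<alpha> A a \<theta>"
proof (induction b)
  case (Suc b)
  have "\<theta> + real (a + b) * \<alpha> = \<theta> + real a * \<alpha> + real b * \<alpha>" by (simp add: algebra_simps)
  then show ?case
    by (simp only: add_Suc_right cociter.simps Suc assoc_mult_mat[OF A cociter_carrier[OF A] cociter_carrier[OF A]])
qed (use cociter_carrier[of A m \<alpha> a \<theta>, OF A] in simp)

lemma flux_cociter_invariant:
  fixes \<alpha> E :: real
  assumes x: "x \<in> carrier_vec (2 * d)" and y: "y \<in> carrier_vec (2 * d)"
    and d: "d \<ge> 1" "vh (int d) \<noteq> 0"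
    and sym: "\<And>k. \<bar>k\<bar> \<le> int d \<Longrightarrow> vh (- k) = cnj (vh k)"
  defines "A \<equiv> cociter (2 * d) \<alpha> (dualL E vh d)"
  shows "flux vh d (A n \<theta> *\<^sub>v x) (A n \<theta> *\<^sub>v y) = flux vh d x y"
proof (induction n)
  case (Suc n)
  have c: "A n \<theta> \<in> carrier_mat (2 * d) (2 * d)"
    unfolding A_def by (rule cociter_carrier) simp
  have "A (Suc n) \<theta> *\<^sub>v z = dualL E vh d (\<theta> + real n * \<alpha>) *\<^sub>v (A n \<theta> *\<^sub>v z)"
    if "z \<in> carrier_vec (2 * d)" for z
    using assoc_mult_mat_vec[OF dualL_carrier c that] by (simp add: A_def)
  then show ?case using flux_invariant[where vh=vh, OF _ _ d sym, of "A n \<theta> *\<^sub>v x" "A n \<theta> *\<^sub>v y"] c x y Suc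
    by simp
qed (use x y in \<open>simp add: A_def\<close>)

section \<open>Dominated splittings\<close>

lemma cvnorm_mono:
  assumes "x \<in> carrier_vec m" "y \<in> carrier_vec m"
    and "\<And>i. i < m \<Longrightarrow> cmod (vec_index x i) \<le> cmod (vec_index y i)"
  shows "cvnorm x \<le> cvnorm y"
  unfolding cvnorm_L2_set carrier_vecD[OF assms(1)] carrier_vecD[OF assms(2)]
  by (intro L2_set_mono) (use assms(3) in auto)

section \<open>Frames and the projections they define\<close>

abbreviation frame_mat :: "nat \<Rightarrow> (nat \<Rightarrow> complex vec) \<Rightarrow> complex mat" where
  "frame_mat m fr \<equiv> mat_of_cols m (map fr [0..<m])"

lemma frame_mat_carrier: "frame_mat m fr \<in> carrier_mat m m"
  by (metis diff_zero length_map length_upt mat_of_cols_carrier(1))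

lemma frame_mat_index: "i < m \<Longrightarrow> j < m \<Longrightarrow> frame_mat m fr $$ (i, j) = vec_index (fr j) i"
  by (simp add: mat_of_cols_index)

lemma cspan_frame_first:
  assumes k: "k \<le> m"
  shows "u \<in> cspan m fr k \<longleftrightarrow>
    (\<exists>c\<in>carrier_vec m. (\<forall>i<m. k \<le> i \<longrightarrow> vec_index c i = 0) \<and> u = frame_mat m fr *\<^sub>v c)"
proof -
  have key: "frame_mat m fr *\<^sub>v c = Matrix.vec m (\<lambda>j. \<Sum>i<k. vec_index c i * vec_index (fr i) j)"
    if c: "c \<in> carrier_vec m" "\<And>i. i < m \<Longrightarrow> k \<le> i \<Longrightarrow> vec_index c i = 0" for c
  proof (rule eq_vecI)
    fix j assume "j < dim_vec (Matrix.vec m (\<lambda>j. \<Sum>i<k. vec_index c i * vec_index (fr i) j))"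
    then have j: "j < m" by simp
    have "vec_index (frame_mat m fr *\<^sub>v c) j = (\<Sum>i<m. frame_mat m fr $$ (j, i) * vec_index c i)"
      by (rule mult_mat_vec_index[OF frame_mat_carrier c(1) j])
    also have "\<dots> = (\<Sum>i<m. vec_index c i * vec_index (fr i) j)"
      by (intro sum.cong refl) (simp add: frame_mat_index j)
    also have "\<dots> = (\<Sum>i<k. vec_index c i * vec_index (fr i) j)"
      using k c(2) by (intro sum.mono_neutral_right) auto
    finally show "vec_index (frame_mat m fr *\<^sub>v c) j
        = vec_index (Matrix.vec m (\<lambda>j. \<Sum>i<k. vec_index c i * vec_index (fr i) j)) j"
      using j by simp
  qed simp
  show ?thesis
  proof
    assume "u \<in> cspan m fr k"
    then obtain c where u: "u = Matrix.vec m (\<lambda>j. \<Sum>i<k. c i * vec_index (fr i) j)"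
      by (auto simp: cspan_def)
    let ?c = "Matrix.vec m (\<lambda>i. if i < k then c i else 0)"
    have "frame_mat m fr *\<^sub>v ?c = Matrix.vec m (\<lambda>j. \<Sum>i<k. vec_index ?c i * vec_index (fr i) j)"
      by (rule key) auto
    also have "\<dots> = u" unfolding u using k by (intro eq_vecI) auto
    finally show "\<exists>c\<in>carrier_vec m. (\<forall>i<m. k \<le> i \<longrightarrow> vec_index c i = 0) \<and> u = frame_mat m fr *\<^sub>v c"
      by (intro bexI[of _ ?c]) auto
  next
    assume "\<exists>c\<in>carrier_vec m. (\<forall>i<m. k \<le> i \<longrightarrow> vec_index c i = 0) \<and> u = frame_mat m fr *\<^sub>v c"
    then show "u \<in> cspan m fr k" by (auto simp: key cspan_def)
  qed
qed

lemma cspan_frame_last: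
  assumes k: "k \<le> m"
  shows "w \<in> cspan m (\<lambda>i. fr (k + i)) (m - k) \<longleftrightarrow>
    (\<exists>c\<in>carrier_vec m. (\<forall>i<k. vec_index c i = 0) \<and> w = frame_mat m fr *\<^sub>v c)"
proof -
  have key: "frame_mat m fr *\<^sub>v c
      = Matrix.vec m (\<lambda>j. \<Sum>i<m - k. vec_index c (k + i) * vec_index (fr (k + i)) j)"
    if c: "c \<in> carrier_vec m" "\<And>i. i < k \<Longrightarrow> vec_index c i = 0" for c
  proof (rule eq_vecI)
    fix j assume "j < dim_vec (Matrix.vec m (\<lambda>j. \<Sum>i<m - k. vec_index c (k + i) * vec_index (fr (k + i)) j))"
    then have j: "j < m" by simp
    have "vec_index (frame_mat m fr *\<^sub>v c) j = (\<Sum>i<m. frame_mat m fr $$ (j, i) * vec_index c i)"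
      by (rule mult_mat_vec_index[OF frame_mat_carrier c(1) j])
    also have "\<dots> = (\<Sum>i<m. vec_index c i * vec_index (fr i) j)"
      by (intro sum.cong refl) (simp add: frame_mat_index j)
    also have "\<dots> = (\<Sum>i\<in>{k..<m}. vec_index c i * vec_index (fr i) j)"
      using k c(2) by (intro sum.mono_neutral_right) auto
    also have "\<dots> = (\<Sum>i<m - k. vec_index c (k + i) * vec_index (fr (k + i)) j)"
      using k by (intro sum.reindex_bij_witness[of _ "\<lambda>i. k + i" "\<lambda>i. i - k"]) auto
    finally show "vec_index (frame_mat m fr *\<^sub>v c) j
        = vec_index (Matrix.vec m (\<lambda>j. \<Sum>i<m - k. vec_index c (k + i) * vec_index (fr (k + i)) j)) j"
      using j by simp
  qed simp
  show ?thesis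
  proof
    assume "w \<in> cspan m (\<lambda>i. fr (k + i)) (m - k)"
    then obtain c where w: "w = Matrix.vec m (\<lambda>j. \<Sum>i<m - k. c i * vec_index (fr (k + i)) j)"
      by (auto simp: cspan_def)
    let ?c = "Matrix.vec m (\<lambda>i. if i < k then 0 else c (i - k))"
    have "frame_mat m fr *\<^sub>v ?c
        = Matrix.vec m (\<lambda>j. \<Sum>i<m - k. vec_index ?c (k + i) * vec_index (fr (k + i)) j)"
      by (rule key) (use k in auto)
    also have "\<dots> = w" unfolding w using k by (intro eq_vecI) auto
    finally show "\<exists>c\<in>carrier_vec m. (\<forall>i<k. vec_index c i = 0) \<and> w = frame_mat m fr *\<^sub>v c"
      using k by (intro bexI[of _ ?c]) auto
  next
    assume "\<exists>c\<in>carrier_vec m. (\<forall>i<k. vec_index c i = 0) \<and> w = frame_mat m fr *\<^sub>v c"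
    then obtain c where c: "c \<in> carrier_vec m" "\<And>i. i < k \<Longrightarrow> vec_index c i = 0" "w = frame_mat m fr *\<^sub>v c"
      by blast
    show "w \<in> cspan m (\<lambda>i. fr (k + i)) (m - k)"
      unfolding cspan_def using c(3) key[OF c(1,2)]
      by (intro CollectI exI[of _ "\<lambda>i. vec_index c (k + i)"] conjI TrueI) (simp only:)
  qed
qed

text \<open>In frame coordinates \<open>u\<close> and \<open>w\<close> have disjoint supports, so
  neither is longer than their sum. The condition number \<open>B\<close> of the frame translates
  this back.\<close>

lemma frame_projection_bound:
  assumes k: "k \<le> m" and d: "Determinant.det (frame_mat m fr) \<noteq> 0"
    and u: "u \<in> cspan m fr k" and w: "w \<in> cspan m (\<lambda>i. fr (k + i)) (m - k)"
  defines "B \<equiv> entry_sum (frame_mat m fr)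
    * (entry_sum (adj_mat (frame_mat m fr)) / cmod (Determinant.det (frame_mat m fr)))"
  shows "cvnorm u \<le> B * cvnorm (u + w)" "cvnorm w \<le> B * cvnorm (u + w)"
proof -
  let ?M = "frame_mat m fr"
  obtain c where c: "c \<in> carrier_vec m" "\<And>i. i < m \<Longrightarrow> k \<le> i \<Longrightarrow> vec_index c i = 0" "u = ?M *\<^sub>v c"
    using u cspan_frame_first[OF k] by blast
  obtain e where e: "e \<in> carrier_vec m" "\<And>i. i < k \<Longrightarrow> vec_index e i = 0" "w = ?M *\<^sub>v e"
    using w cspan_frame_last[OF k] by blast
  have uw: "u + w = ?M *\<^sub>v (c + e)"
    unfolding c(3) e(3) by (rule mult_add_distrib_mat_vec[OF frame_mat_carrier c(1) e(1), symmetric])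
  have ce: "c + e \<in> carrier_vec m" using c e by simp
  have disj: "vec_index c i = 0 \<or> vec_index e i = 0" if "i < m" for i
    using c(2) e(2) that by (cases "i < k") auto
  have "cvnorm c \<le> cvnorm (c + e)"
    by (rule cvnorm_mono[OF c(1) ce]) (use c(1) e(1) disj in force)
  moreover have "cvnorm e \<le> cvnorm (c + e)"
    by (rule cvnorm_mono[OF e(1) ce]) (use c(1) e(1) disj in force)
  moreover have "cvnorm (c + e) \<le> entry_sum (adj_mat ?M) / cmod (Determinant.det ?M) * cvnorm (u + w)"
    unfolding uw by (rule cvnorm_le_adj_mat[OF frame_mat_carrier d ce])
  ultimately have b: "cvnorm c \<le> entry_sum (adj_mat ?M) / cmod (Determinant.det ?M) * cvnorm (u + w)"
    "cvnorm e \<le> entry_sum (adj_mat ?M) / cmod (Determinant.det ?M) * cvnorm (u + w)" by linarith+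
  have "cvnorm (?M *\<^sub>v c) \<le> entry_sum ?M * (entry_sum (adj_mat ?M) / cmod (Determinant.det ?M) * cvnorm (u + w))"
    by (rule order_trans[OF cvnorm_mult_mat_vec[OF frame_mat_carrier c(1)] mult_left_mono[OF b(1) entry_sum_nonneg]])
  then show "cvnorm u \<le> B * cvnorm (u + w)" unfolding B_def c(3) by (simp only: mult.assoc)
  have "cvnorm (?M *\<^sub>v e) \<le> entry_sum ?M * (entry_sum (adj_mat ?M) / cmod (Determinant.det ?M) * cvnorm (u + w))"
    by (rule order_trans[OF cvnorm_mult_mat_vec[OF frame_mat_carrier e(1)] mult_left_mono[OF b(2) entry_sum_nonneg]])
  then show "cvnorm w \<le> B * cvnorm (u + w)" unfolding B_def e(3) by (simp only: mult.assoc)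
qed

lemma frame_decomposition:
  assumes k: "k \<le> m" and d: "Determinant.det (frame_mat m fr) \<noteq> 0" and x: "x \<in> carrier_vec m"
  shows "\<exists>u\<in>cspan m fr k. \<exists>w\<in>cspan m (\<lambda>i. fr (k + i)) (m - k). x = u + w"
proof -
  let ?M = "frame_mat m fr"
  have M: "?M \<in> carrier_mat m m" by (rule frame_mat_carrier)
  define c where "c = (1 / Determinant.det ?M) \<cdot>\<^sub>v (adj_mat ?M *\<^sub>v x)"
  have adjx: "adj_mat ?M *\<^sub>v x \<in> carrier_vec m" using adj_mat(1)[OF M] x by simp
  have c: "c \<in> carrier_vec m" using adjx by (simp add: c_def)
  have "?M *\<^sub>v (adj_mat ?M *\<^sub>v x) = (?M * adj_mat ?M) *\<^sub>v x"
    using assoc_mult_mat_vec[OF M adj_mat(1)[OF M] x] by simp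
  also have "\<dots> = Determinant.det ?M \<cdot>\<^sub>v x"
    unfolding adj_mat(2)[OF M] using x by (intro eq_vecI) (auto simp: smult_scalar_prod_distrib[of _ m] row_smult)
  finally have "?M *\<^sub>v c = x"
    unfolding c_def mult_smult_mat_vec[OF M adjx] using d by (simp add: smult_smult_assoc)
  define c1 where "c1 = Matrix.vec m (\<lambda>i. if i < k then vec_index c i else 0)"
  define c2 where "c2 = Matrix.vec m (\<lambda>i. if i < k then 0 else vec_index c i)"
  have c12: "c1 \<in> carrier_vec m" "c2 \<in> carrier_vec m" by (simp_all add: c1_def c2_def)
  have "c = c1 + c2" using c by (intro eq_vecI) (auto simp: c1_def c2_def)
  then have "x = ?M *\<^sub>v c1 + ?M *\<^sub>v c2"
    using mult_add_distrib_mat_vec[OF M c12] \<open>?M *\<^sub>v c = x\<close> by simp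
  moreover have "?M *\<^sub>v c1 \<in> cspan m fr k"
    unfolding cspan_frame_first[OF k] using c12 by (intro bexI[of _ c1]) (auto simp: c1_def)
  moreover have "?M *\<^sub>v c2 \<in> cspan m (\<lambda>i. fr (k + i)) (m - k)"
    unfolding cspan_frame_last[OF k] using c12 k by (intro bexI[of _ c2]) (auto simp: c2_def)
  ultimately show ?thesis by blast
qed

lemma frame_independent:
  assumes d: "Determinant.det (frame_mat m fr) \<noteq> 0"
    and z: "Matrix.vec m (\<lambda>j. \<Sum>i<m. c i * vec_index (fr i) j) = 0\<^sub>v m" and i: "i < m"
  shows "c i = 0"
proof -
  have M: "frame_mat m fr \<in> carrier_mat m m" by (rule frame_mat_carrier)
  have "frame_mat m fr *\<^sub>v Matrix.vec m c = Matrix.vec m (\<lambda>j. \<Sum>i<m. c i * vec_index (fr i) j)"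
  proof (rule eq_vecI)
    fix j assume "j < dim_vec (Matrix.vec m (\<lambda>j. \<Sum>i<m. c i * vec_index (fr i) j))"
    then have j: "j < m" by simp
    have "vec_index (frame_mat m fr *\<^sub>v Matrix.vec m c) j
        = (\<Sum>i<m. frame_mat m fr $$ (j, i) * vec_index (Matrix.vec m c) i)"
      by (rule mult_mat_vec_index[OF M _ j]) simp
    also have "\<dots> = (\<Sum>i<m. c i * vec_index (fr i) j)"
      by (intro sum.cong refl) (simp add: frame_mat_index j)
    finally show "vec_index (frame_mat m fr *\<^sub>v Matrix.vec m c) j
      = vec_index (Matrix.vec m (\<lambda>j. \<Sum>i<m. c i * vec_index (fr i) j)) j" using j by simp
  qed simp
  then have "frame_mat m fr *\<^sub>v Matrix.vec m c = 0\<^sub>v m" by (simp only: z)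
  then have "Matrix.vec m c = 0\<^sub>v m"
    using det_0_iff_vec_prod_zero_field[OF M] d vec_carrier[of m c] by blast
  from arg_cong[OF this, of "\<lambda>v. vec_index v i"] show ?thesis using i by simp
qed

section \<open>Continuity of determinant, adjugate and entry sum\<close>

lemma continuous_on_det:
  assumes "\<And>\<theta>. \<theta> \<in> U \<Longrightarrow> A \<theta> \<in> carrier_mat n n"
    and "\<And>i j. i < n \<Longrightarrow> j < n \<Longrightarrow> continuous_on U (\<lambda>\<theta>. (A \<theta> $$ (i, j) :: complex))"
  shows "continuous_on U (\<lambda>\<theta>. Determinant.det (A \<theta>))"
proof -
  have "continuous_on U (\<lambda>\<theta>. \<Sum>p | p permutes {0..<n}. signof p * (\<Prod>i = 0..<n. A \<theta> $$ (i, p i)))"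
    by (intro continuous_intros assms(2)) (auto simp: permutes_in_image)
  then show ?thesis
    by (rule continuous_on_eq) (simp add: det_def'[OF assms(1)])
qed

lemma continuous_on_entry_sum:
  assumes "\<And>\<theta>. \<theta> \<in> U \<Longrightarrow> A \<theta> \<in> carrier_mat n m"
    and "\<And>i j. i < n \<Longrightarrow> j < m \<Longrightarrow> continuous_on U (\<lambda>\<theta>. A \<theta> $$ (i, j))"
  shows "continuous_on U (\<lambda>\<theta>. entry_sum (A \<theta>))"
proof -
  have "continuous_on U (\<lambda>\<theta>. \<Sum>i<n. \<Sum>j<m. cmod (A \<theta> $$ (i, j)))"
    by (intro continuous_intros assms(2)) auto
  then show ?thesis
    by (rule continuous_on_eq) (use assms(1) in \<open>auto simp: entry_sum_def\<close>)
qed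

lemma continuous_on_adj_mat_entry:
  assumes A: "\<And>\<theta>. \<theta> \<in> U \<Longrightarrow> A \<theta> \<in> carrier_mat n n"
    and c: "\<And>i j. i < n \<Longrightarrow> j < n \<Longrightarrow> continuous_on U (\<lambda>\<theta>. (A \<theta> $$ (i, j) :: complex))"
    and ij: "i < n" "j < n"
  shows "continuous_on U (\<lambda>\<theta>. adj_mat (A \<theta>) $$ (i, j))"
proof -
  have "continuous_on U (\<lambda>\<theta>. (- 1) ^ (j + i) * Determinant.det (mat_delete (A \<theta>) j i))"
  proof (intro continuous_intros continuous_on_det)
    show "mat_delete (A \<theta>) j i \<in> carrier_mat (n - 1) (n - 1)" if "\<theta> \<in> U" for \<theta>
      using mat_delete_carrier[OF A[OF that]] .
    fix r s assume rs: "r < n - 1" "s < n - 1"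
    have "continuous_on U (\<lambda>\<theta>. A \<theta> $$ (if r < j then r else Suc r, if s < i then s else Suc s))"
      by (rule c) (use rs ij in auto)
    then show "continuous_on U (\<lambda>\<theta>. mat_delete (A \<theta>) j i $$ (r, s))"
    proof (rule continuous_on_eq)
      fix \<theta> assume "\<theta> \<in> U"
      then have "dim_row (A \<theta>) = n" "dim_col (A \<theta>) = n" using A by auto
      then show "A \<theta> $$ (if r < j then r else Suc r, if s < i then s else Suc s) = mat_delete (A \<theta>) j i $$ (r, s)"
        using rs by (simp add: mat_delete_def)
    qed
  qed
  then show ?thesis
  proof (rule continuous_on_eq)
    fix \<theta> assume "\<theta> \<in> U"
    then have "dim_row (A \<theta>) = n" "dim_col (A \<theta>) = n" using A by auto
    then show "(- 1) ^ (j + i) * Determinant.det (mat_delete (A \<theta>) j i) = adj_mat (A \<theta>) $$ (i, j)"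
      using ij by (simp add: adj_mat_def cofactor_def)
  qed
qed

text \<open>The continuity of the splitting is distilled into the uniform constant \<open>C\<close>,
  while \<open>frame\<close> keeps the linear algebra at each phase. Domination is made homogeneous,
  without unit vectors, so that it can be iterated and applied to vectors that may vanish.\<close>

locale dominated_splitting =
  fixes m :: nat and \<alpha> :: real and A :: "real \<Rightarrow> complex mat" and k :: nat
    and Ep Em :: "real \<Rightarrow> complex vec set" and C :: real and N :: nat
  assumes A_carrier: "A \<theta> \<in> carrier_mat m m"
    and k_le: "k \<le> m"
    and frame: "\<exists>fr. (\<forall>i<m. fr i \<in> carrier_vec m) \<and> Determinant.det (frame_mat m fr) \<noteq> 0 \<and>
      Ep \<theta> = cspan m fr k \<and> Em \<theta> = cspan m (\<lambda>i. fr (k + i)) (m - k)"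
    and proj: "u \<in> Ep \<theta> \<Longrightarrow> w \<in> Em \<theta> \<Longrightarrow> cvnorm u \<le> C * cvnorm (u + w)"
      "u \<in> Ep \<theta> \<Longrightarrow> w \<in> Em \<theta> \<Longrightarrow> cvnorm w \<le> C * cvnorm (u + w)"
    and C_pos: "C > 0"
    and image_step: "(\<lambda>u. A \<theta> *\<^sub>v u) ` Ep \<theta> = Ep (\<theta> + \<alpha>)" "(\<lambda>u. A \<theta> *\<^sub>v u) ` Em \<theta> = Em (\<theta> + \<alpha>)"
    and N_pos: "N \<ge> 1"
    and dom_step: "u \<in> Ep \<theta> \<Longrightarrow> w \<in> Em \<theta> \<Longrightarrow>
      cvnorm (cociter m \<alpha> A N \<theta> *\<^sub>v w) * cvnorm u \<le> cvnorm (cociter m \<alpha> A N \<theta> *\<^sub>v u) * cvnorm w"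
begin

abbreviation "An \<equiv> cociter m \<alpha> A"

lemma An_carrier: "An n \<theta> \<in> carrier_mat m m"
  by (rule cociter_carrier) (rule A_carrier)

lemma An_vec_carrier: "x \<in> carrier_vec m \<Longrightarrow> An n \<theta> *\<^sub>v x \<in> carrier_vec m"
  by (rule mult_mat_vec_carrier[OF An_carrier])

lemma Ep_carrier: "u \<in> Ep \<theta> \<Longrightarrow> u \<in> carrier_vec m"
  and Em_carrier: "u \<in> Em \<theta> \<Longrightarrow> u \<in> carrier_vec m"
  using frame[of \<theta>] cspan_carrier by metis+

lemma Ep_add: "u \<in> Ep \<theta> \<Longrightarrow> v \<in> Ep \<theta> \<Longrightarrow> u + v \<in> Ep \<theta>"
  and Em_add: "u \<in> Em \<theta> \<Longrightarrow> v \<in> Em \<theta> \<Longrightarrow> u + v \<in> Em \<theta>"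
  using frame[of \<theta>] cspan_add by metis+

lemma decompose: "x \<in> carrier_vec m \<Longrightarrow> \<exists>u\<in>Ep \<theta>. \<exists>w\<in>Em \<theta>. x = u + w"
proof -
  assume x: "x \<in> carrier_vec m"
  obtain fr where "Determinant.det (frame_mat m fr) \<noteq> 0"
    "Ep \<theta> = cspan m fr k" "Em \<theta> = cspan m (\<lambda>i. fr (k + i)) (m - k)"
    using frame[of \<theta>] by blast
  then show ?thesis using frame_decomposition[OF k_le _ x] by simp
qed

lemma An_Suc_vec: "x \<in> carrier_vec m \<Longrightarrow> An (Suc n) \<theta> *\<^sub>v x = A (\<theta> + real n * \<alpha>) *\<^sub>v (An n \<theta> *\<^sub>v x)"
  using assoc_mult_mat_vec[OF A_carrier An_carrier] by simp

lemma An_add_vec: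
  "x \<in> carrier_vec m \<Longrightarrow> An (a + b) \<theta> *\<^sub>v x = An b (\<theta> + real a * \<alpha>) *\<^sub>v (An a \<theta> *\<^sub>v x)"
  using assoc_mult_mat_vec[OF An_carrier An_carrier] cociter_add[of A m \<alpha> a b, OF A_carrier] by simp

lemma image_An:
  assumes step: "\<And>\<theta>. (\<lambda>u. A \<theta> *\<^sub>v u) ` E \<theta> = E (\<theta> + \<alpha>)" and E: "\<And>\<theta> u. u \<in> E \<theta> \<Longrightarrow> u \<in> carrier_vec m"
  shows "(\<lambda>u. An n \<theta> *\<^sub>v u) ` E \<theta> = E (\<theta> + real n * \<alpha>)"
proof (induction n)
  case 0
  have "(\<lambda>u. 1\<^sub>m m *\<^sub>v u) ` E \<theta> = id ` E \<theta>"
    by (rule image_cong[OF refl]) (simp add: E)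
  then show ?case by simp
next
  case (Suc n)
  have "(\<lambda>u. An (Suc n) \<theta> *\<^sub>v u) ` E \<theta> = (\<lambda>u. A (\<theta> + real n * \<alpha>) *\<^sub>v u) ` ((\<lambda>u. An n \<theta> *\<^sub>v u) ` E \<theta>)"
    unfolding image_image by (rule image_cong[OF refl]) (rule An_Suc_vec[OF E])
  also have "\<dots> = E (\<theta> + real n * \<alpha> + \<alpha>)" unfolding Suc step ..
  also have "\<theta> + real n * \<alpha> + \<alpha> = \<theta> + real (Suc n) * \<alpha>" by (simp add: algebra_simps)
  finally show ?case .
qed

lemma image_Ep: "(\<lambda>u. An n \<theta> *\<^sub>v u) ` Ep \<theta> = Ep (\<theta> + real n * \<alpha>)"
  by (rule image_An[OF image_step(1) Ep_carrier])

lemma image_Em: "(\<lambda>u. An n \<theta> *\<^sub>v u) ` Em \<theta> = Em (\<theta> + real n * \<alpha>)"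
  by (rule image_An[OF image_step(2) Em_carrier])

lemma An_Ep: "u \<in> Ep \<theta> \<Longrightarrow> An n \<theta> *\<^sub>v u \<in> Ep (\<theta> + real n * \<alpha>)"
  and An_Em: "u \<in> Em \<theta> \<Longrightarrow> An n \<theta> *\<^sub>v u \<in> Em (\<theta> + real n * \<alpha>)"
  using image_Ep image_Em by blast+

lemma dom:
  assumes u: "u \<in> Ep \<theta>" and w: "w \<in> Em \<theta>"
  shows "cvnorm (An (j * N) \<theta> *\<^sub>v w) * cvnorm u \<le> cvnorm (An (j * N) \<theta> *\<^sub>v u) * cvnorm w"
proof (induction j)
  case 0
  then show ?case using Ep_carrier[OF u] Em_carrier[OF w] by (simp add: mult.commute)
next
  case (Suc j)
  let ?u = "An (j * N) \<theta> *\<^sub>v u" and ?w = "An (j * N) \<theta> *\<^sub>v w" and ?t = "\<theta> + real (j * N) * \<alpha>"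
  have u': "?u \<in> Ep ?t" and w': "?w \<in> Em ?t" by (rule An_Ep[OF u], rule An_Em[OF w])
  have step: "An (Suc j * N) \<theta> *\<^sub>v x = An N ?t *\<^sub>v (An (j * N) \<theta> *\<^sub>v x)" if "x \<in> carrier_vec m" for x
    using An_add_vec[OF that, of "j * N" N \<theta>] by (simp add: add.commute)
  let ?U = "cvnorm (An N ?t *\<^sub>v ?u)" and ?W = "cvnorm (An N ?t *\<^sub>v ?w)"
  have d: "?W * cvnorm ?u \<le> ?U * cvnorm ?w" by (rule dom_step[OF u' w'])
  \<comment> \<open>The two inequalities are chained by cancelling the norm of \<open>?u\<close>. If
    that is zero, the induction hypothesis makes \<open>?w\<close> or \<open>u\<close> vanish and
    the claim is trivial.\<close>
  have "?W * cvnorm u \<le> ?U * cvnorm w"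
  proof (cases "cvnorm ?u = 0")
    case True
    have nz: "An N ?t *\<^sub>v 0\<^sub>v m = 0\<^sub>v m" using An_carrier[of N ?t] by (intro eq_vecI) auto
    have "cvnorm ?w * cvnorm u \<le> 0" using Suc True by simp
    then have "cvnorm ?w = 0 \<or> cvnorm u = 0"
      using cvnorm_nonneg[of ?w] cvnorm_nonneg[of u] by (metis mult_nonneg_nonneg mult_eq_0_iff order_antisym)
    then show ?thesis
    proof
      assume "cvnorm ?w = 0"
      then have "?w = 0\<^sub>v m" using cvnorm_eq_0_iff[OF Em_carrier[OF w']] by simp
      then show ?thesis using nz by simp
    qed simp
  next
    case False
    then have pos: "cvnorm ?u > 0" using cvnorm_nonneg[of ?u] by linarith
    have "?W * cvnorm u * cvnorm ?u \<le> ?U * (cvnorm ?w * cvnorm u)"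
      using mult_right_mono[OF d cvnorm_nonneg[of u]] by (simp only: mult_ac)
    also have "\<dots> \<le> ?U * (cvnorm ?u * cvnorm w)" by (rule mult_left_mono[OF Suc]) simp
    finally have "?W * cvnorm u * cvnorm ?u \<le> ?U * cvnorm w * cvnorm ?u" by (simp only: mult_ac)
    then show ?thesis using pos by simp
  qed
  then show ?case unfolding step[OF Ep_carrier[OF u]] step[OF Em_carrier[OF w]] .
qed

end

lemma dominated_imp_splitting:
  assumes dom: "dominated m \<alpha> A k" and A: "\<And>\<theta>. A \<theta> \<in> carrier_mat m m"
  shows "\<exists>Ep Em C N. dominated_splitting m \<alpha> A k Ep Em C N"
proof -
  have k: "k \<le> m" using dom unfolding dominated_def by (rule conjunct1)
  obtain Ep Em N where per: "\<forall>\<theta>. Ep (\<theta> + 1) = Ep \<theta> \<and> Em (\<theta> + 1) = Em \<theta>"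
    and loc: "\<forall>\<theta>0. \<exists>U. open U \<and> \<theta>0 \<in> U \<and> (\<exists>fr :: real \<Rightarrow> nat \<Rightarrow> complex vec.
          (\<forall>i<m. \<forall>j<m. continuous_on U (\<lambda>\<theta>. vec_index (fr \<theta> i) j)) \<and>
          (\<forall>\<theta>\<in>U. (\<forall>i<m. fr \<theta> i \<in> carrier_vec m) \<and>
                 Determinant.det (frame_mat m (fr \<theta>)) \<noteq> 0 \<and>
                 Ep \<theta> = cspan m (fr \<theta>) k \<and>
                 Em \<theta> = cspan m (\<lambda>i. fr \<theta> (k + i)) (m - k)))"
    and img: "\<forall>\<theta>. (\<lambda>u. A \<theta> *\<^sub>v u) ` Ep \<theta> = Ep (\<theta> + \<alpha>) \<and> (\<lambda>u. A \<theta> *\<^sub>v u) ` Em \<theta> = Em (\<theta> + \<alpha>)"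
    and N: "N \<ge> 1" and str0: "\<forall>\<theta> u w. u \<in> Ep \<theta> \<longrightarrow> w \<in> Em \<theta> \<longrightarrow> cvnorm u = 1 \<longrightarrow> cvnorm w = 1 \<longrightarrow>
          cvnorm (cociter m \<alpha> A N \<theta> *\<^sub>v u) > cvnorm (cociter m \<alpha> A N \<theta> *\<^sub>v w)"
    using conjunct2[OF dom[unfolded dominated_def]] by (elim exE conjE) (rule that)
  note str = str0[rule_format]
  let ?Q = "\<lambda>C \<theta>. \<forall>u\<in>Ep \<theta>. \<forall>w\<in>Em \<theta>. cvnorm u \<le> C * cvnorm (u + w) \<and> cvnorm w \<le> C * cvnorm (u + w)"
  have "\<exists>C. \<forall>\<theta>\<in>{0..1}. ?Q C \<theta>"
  proof (rule compact_local_bound)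
    fix \<theta>0 :: real
    obtain U fr where U: "open U" "\<theta>0 \<in> U"
      and fc: "\<forall>i<m. \<forall>j<m. continuous_on U (\<lambda>\<theta>. vec_index (fr \<theta> i) j)"
      and fr: "\<forall>\<theta>\<in>U. (\<forall>i<m. fr \<theta> i \<in> carrier_vec m) \<and>
                 Determinant.det (frame_mat m (fr \<theta>)) \<noteq> 0 \<and>
                 Ep \<theta> = cspan m (fr \<theta>) k \<and>
                 Em \<theta> = cspan m (\<lambda>i. fr \<theta> (k + i)) (m - k)"
      using spec[OF loc, of \<theta>0] by (elim exE conjE) (rule that)
    let ?M = "\<lambda>\<theta>. frame_mat m (fr \<theta>)"
    \<comment> \<open>\<open>B\<close> is the condition number of the local frame; by continuity it
      stays below \<open>B \<theta>0 + 1\<close> near \<open>\<theta>0\<close>.\<close>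
    define B where "B \<theta> = entry_sum (?M \<theta>) * (entry_sum (adj_mat (?M \<theta>)) / cmod (Determinant.det (?M \<theta>)))" for \<theta>
    have ent: "continuous_on U (\<lambda>\<theta>. ?M \<theta> $$ (i, j))" if "i < m" "j < m" for i j
      using fc[rule_format, OF that(2,1)] that by (simp add: frame_mat_index)
    have "continuous_on U B"
      unfolding B_def
    proof (intro continuous_intros)
      show "continuous_on U (\<lambda>\<theta>. entry_sum (?M \<theta>))"
        by (rule continuous_on_entry_sum[OF frame_mat_carrier ent])
      show "continuous_on U (\<lambda>\<theta>. entry_sum (adj_mat (?M \<theta>)))"
        by (rule continuous_on_entry_sum[OF adj_mat(1)[OF frame_mat_carrier]
            continuous_on_adj_mat_entry[OF frame_mat_carrier ent]])
      show "continuous_on U (\<lambda>\<theta>. Determinant.det (?M \<theta>))"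
        by (rule continuous_on_det[OF frame_mat_carrier ent])
    qed (use fr in auto)
    then have "open (U \<inter> B -` {..<B \<theta>0 + 1})"
      using U(1) by (intro continuous_open_preimage) auto
    moreover have "?Q (B \<theta>0 + 1) \<theta>" if "\<theta> \<in> U \<inter> B -` {..<B \<theta>0 + 1}" for \<theta>
    proof (intro ballI)
      fix u w assume uw: "u \<in> Ep \<theta>" "w \<in> Em \<theta>"
      have t: "\<theta> \<in> U" using that by simp
      have d: "Determinant.det (?M \<theta>) \<noteq> 0" and uw': "u \<in> cspan m (fr \<theta>) k"
        "w \<in> cspan m (\<lambda>i. fr \<theta> (k + i)) (m - k)"
        using bspec[OF fr t] uw by auto
      have *: "cvnorm u \<le> B \<theta> * cvnorm (u + w)" "cvnorm w \<le> B \<theta> * cvnorm (u + w)"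
        unfolding B_def by (rule frame_projection_bound(1)[OF k d uw'], rule frame_projection_bound(2)[OF k d uw'])
      have "B \<theta> * cvnorm (u + w) \<le> (B \<theta>0 + 1) * cvnorm (u + w)"
        using that by (intro mult_right_mono) auto
      then show "cvnorm u \<le> (B \<theta>0 + 1) * cvnorm (u + w) \<and> cvnorm w \<le> (B \<theta>0 + 1) * cvnorm (u + w)"
        using * by linarith
    qed
    ultimately show "\<exists>V C. open V \<and> \<theta>0 \<in> V \<and> (\<forall>\<theta>\<in>V. ?Q C \<theta>)"
      using U(2) by (intro exI[of _ "U \<inter> B -` {..<B \<theta>0 + 1}"] exI[of _ "B \<theta>0 + 1"]) auto
  next
    fix C C' :: real and \<theta> assume "?Q C \<theta>" "C \<le> C'"
    then show "?Q C' \<theta>" by (meson cvnorm_nonneg mult_right_mono order_trans)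
  qed simp
  then obtain C where C: "\<And>\<theta>. \<theta> \<in> {0..1} \<Longrightarrow> ?Q C \<theta>" by blast
  \<comment> \<open>Periodicity extends the constant from \<open>[0, 1]\<close> to every phase, and
    the maximum with 1 makes it positive.\<close>
  have CQ: "?Q (max C 1) \<theta>" for \<theta>
  proof -
    have "Ep \<theta> = Ep (frac \<theta>)" "Em \<theta> = Em (frac \<theta>)"
      using periodic_add_of_int[of Ep "frac \<theta>" "\<lfloor>\<theta>\<rfloor>"] periodic_add_of_int[of Em "frac \<theta>" "\<lfloor>\<theta>\<rfloor>"] per
      by (simp_all add: frac_def)
    moreover have "?Q C (frac \<theta>)" by (rule C) (simp add: frac_ge_0 less_imp_le[OF frac_lt_1])
    ultimately have "?Q C \<theta>" by simp
    then show ?thesis by (meson cvnorm_nonneg max.cobounded1 mult_right_mono order_trans)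
  qed
  have frames: "\<exists>fr. (\<forall>i<m. fr i \<in> carrier_vec m) \<and> Determinant.det (frame_mat m fr) \<noteq> 0 \<and>
      Ep \<theta> = cspan m fr k \<and> Em \<theta> = cspan m (\<lambda>i. fr (k + i)) (m - k)" for \<theta>
  proof -
    obtain U fr where "\<theta> \<in> U"
      and fr: "\<forall>\<theta>\<in>U. (\<forall>i<m. fr \<theta> i \<in> carrier_vec m) \<and>
                 Determinant.det (frame_mat m (fr \<theta>)) \<noteq> 0 \<and>
                 Ep \<theta> = cspan m (fr \<theta>) k \<and>
                 Em \<theta> = cspan m (\<lambda>i. fr \<theta> (k + i)) (m - k)"
      using spec[OF loc, of \<theta>] by (elim exE conjE) (rule that)
    then show ?thesis by (intro exI[of _ "fr \<theta>"]) (rule bspec)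
  qed
  have "dominated_splitting m \<alpha> A k Ep Em (max C 1) N"
  proof
    fix \<theta> u w assume uw: "u \<in> Ep \<theta>" "w \<in> Em \<theta>"
    let ?A = "cociter m \<alpha> A N \<theta>"
    have Ac: "?A \<in> carrier_mat m m" by (rule cociter_carrier[OF A])
    obtain fr where fr: "Ep \<theta> = cspan m fr k" "Em \<theta> = cspan m (\<lambda>i. fr (k + i)) (m - k)"
      using frames[of \<theta>] by blast
    have c: "u \<in> carrier_vec m" "w \<in> carrier_vec m" using uw fr cspan_carrier by auto
    show "cvnorm (?A *\<^sub>v w) * cvnorm u \<le> cvnorm (?A *\<^sub>v u) * cvnorm w"
    proof (cases "cvnorm u = 0 \<or> cvnorm w = 0")
      case True
      have "?A *\<^sub>v 0\<^sub>v m = 0\<^sub>v m" using Ac by (intro eq_vecI) auto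
      then show ?thesis using True cvnorm_eq_0_iff[OF c(2)] by auto
    next
      case False
      then have pos: "cvnorm u > 0" "cvnorm w > 0" using cvnorm_nonneg[of u] cvnorm_nonneg[of w] by linarith+
      let ?a = "complex_of_real (1 / cvnorm u)" and ?b = "complex_of_real (1 / cvnorm w)"
      have "cvnorm (?A *\<^sub>v (?b \<cdot>\<^sub>v w)) < cvnorm (?A *\<^sub>v (?a \<cdot>\<^sub>v u))"
        using pos uw fr cspan_smult by (intro str[of _ \<theta>]) (auto simp: cvnorm_smult norm_divide)
      then have "cvnorm (?A *\<^sub>v w) / cvnorm w < cvnorm (?A *\<^sub>v u) / cvnorm u"
        unfolding mult_smult_mat_vec[OF Ac c(1)] mult_smult_mat_vec[OF Ac c(2)] cvnorm_smult
        using pos by (simp add: norm_divide)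
      then show ?thesis using pos by (simp add: field_simps)
    qed
  next
    show "\<And>u \<theta> w. u \<in> Ep \<theta> \<Longrightarrow> w \<in> Em \<theta> \<Longrightarrow> cvnorm u \<le> max C 1 * cvnorm (u + w)"
      "\<And>u \<theta> w. u \<in> Ep \<theta> \<Longrightarrow> w \<in> Em \<theta> \<Longrightarrow> cvnorm w \<le> max C 1 * cvnorm (u + w)"
      using CQ by blast+
  qed (use A k frames img N in auto)
  then show ?thesis by blast
qed

section \<open>Contracted pairs of vectors\<close>

lemma cvnorm_lincomb:
  assumes "x \<in> carrier_vec m" "y \<in> carrier_vec m" "cvnorm x \<le> \<eta>" "cvnorm y \<le> \<eta>"
  shows "cvnorm (a \<cdot>\<^sub>v x + b \<cdot>\<^sub>v y) \<le> \<eta> * (cmod a + cmod b)"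
proof -
  have "cvnorm (a \<cdot>\<^sub>v x + b \<cdot>\<^sub>v y) \<le> cmod a * cvnorm x + cmod b * cvnorm y"
    using cvnorm_add[of "a \<cdot>\<^sub>v x" m "b \<cdot>\<^sub>v y"] assms by (simp add: cvnorm_smult)
  also have "\<dots> \<le> cmod a * \<eta> + cmod b * \<eta>"
    by (intro add_mono mult_left_mono assms) auto
  finally show ?thesis by (simp add: algebra_simps)
qed

lemma mult_mat_vec_lincomb:
  assumes A: "(A :: complex mat) \<in> carrier_mat n m" and "x \<in> carrier_vec m" "y \<in> carrier_vec m"
  shows "A *\<^sub>v (a \<cdot>\<^sub>v x + b \<cdot>\<^sub>v y) = a \<cdot>\<^sub>v (A *\<^sub>v x) + b \<cdot>\<^sub>v (A *\<^sub>v y)"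
  using mult_add_distrib_mat_vec[OF A, of "a \<cdot>\<^sub>v x" "b \<cdot>\<^sub>v y"] assms mult_smult_mat_vec[OF A] by simp

locale dual_splitting = dominated_splitting "2 * d" \<alpha> "dualL E vh d" "d + 1" Ep Em C N
  for d :: nat and \<alpha> E :: real and vh :: "int \<Rightarrow> complex" and Ep Em C N +
  assumes d_pos: "d \<ge> 1" and lead: "vh (int d) \<noteq> 0"
    and sym: "\<And>k. \<bar>k\<bar> \<le> int d \<Longrightarrow> vh (- k) = cnj (vh k)"
begin

abbreviation "J \<equiv> flux_mat vh d"

lemma det_J: "Determinant.det J \<noteq> 0"
  by (rule det_flux_mat_nonzero) (use lead sym[of "int d"] in auto)

lemma J_vec_carrier: "x \<in> carrier_vec (2 * d) \<Longrightarrow> J *\<^sub>v x \<in> carrier_vec (2 * d)"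
  by (rule mult_mat_vec_carrier[OF flux_mat_carrier])

lemma J_lower_bound:
  "\<exists>c\<ge>0. \<forall>x\<in>carrier_vec (2 * d). cvnorm x \<le> c * cvnorm (J *\<^sub>v x)"
  using cvnorm_le_adj_mat[OF flux_mat_carrier det_J]
  by (intro exI[of _ "entry_sum (adj_mat J) / cmod (Determinant.det J)"]) auto

lemma flux_An:
  "x \<in> carrier_vec (2 * d) \<Longrightarrow> y \<in> carrier_vec (2 * d) \<Longrightarrow>
    flux vh d (An n \<theta> *\<^sub>v x) (An n \<theta> *\<^sub>v y) = flux vh d x y"
  by (rule flux_cociter_invariant[OF _ _ d_pos lead sym])

text \<open>\<open>Ep 0\<close> has dimension \<open>d + 1\<close>, so it is not isotropic; by invariance of the form, the cocycle
  cannot be small on it, and domination transfers a bound to \<open>Em\<close>.\<close>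

lemma Em_backward_bound:
  "\<exists>K\<ge>0. \<forall>j. \<forall>e\<in>Em (- (real (j * N) * \<alpha>)).
    cvnorm (An (j * N) (- (real (j * N) * \<alpha>)) *\<^sub>v e) \<le> K * cvnorm e"
proof -
  obtain fr where fr: "\<And>i. i < 2 * d \<Longrightarrow> fr i \<in> carrier_vec (2 * d)"
    "Determinant.det (frame_mat (2 * d) fr) \<noteq> 0" "Ep 0 = cspan (2 * d) fr (d + 1)"
    using frame[of 0] by blast
  \<comment> \<open>The witness of non-isotropy of \<open>Ep 0\<close>: the form at
    \<open>J s\<close> and \<open>s\<close> has modulus |J s|^2.\<close>
  have "\<exists>s\<in>cspan (2 * d) fr (d + 1). s \<noteq> 0\<^sub>v (2 * d) \<and> J *\<^sub>v s \<in> cspan (2 * d) fr (d + 1)"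
  proof (rule cspan_meets_preimage)
    fix c i assume z: "Matrix.vec (2 * d) (\<lambda>j. \<Sum>i<d + 1. c i * vec_index (fr i) j) = 0\<^sub>v (2 * d)" and i: "i < d + 1"
    \<comment> \<open>Padding with zeros brings the independence of the whole frame to bear on its
      first \<open>d + 1\<close> vectors.\<close>
    define c' where "c' i = (if i < d + 1 then c i else 0)" for i
    have "Matrix.vec (2 * d) (\<lambda>j. \<Sum>i<2 * d. c' i * vec_index (fr i) j) = 0\<^sub>v (2 * d)"
    proof -
      have "(\<Sum>i<2 * d. c' i * vec_index (fr i) j) = (\<Sum>i<d + 1. c i * vec_index (fr i) j)" for j
        using d_pos by (intro sum.mono_neutral_cong_right) (auto simp: c'_def)
      then show ?thesis using z by simp
    qed
    then have "c' i = 0" by (rule frame_independent[OF fr(2)]) (use i d_pos in simp)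
    then show "c i = 0" using i by (simp add: c'_def)
  qed (use fr d_pos in auto)
  then obtain s where s: "s \<in> Ep 0" "s \<noteq> 0\<^sub>v (2 * d)" "J *\<^sub>v s \<in> Ep 0" using fr(3) by blast
  have sc: "s \<in> carrier_vec (2 * d)" by (rule Ep_carrier[OF s(1)])
  let ?a = "cvnorm s" and ?b = "cvnorm (J *\<^sub>v s)" and ?K = "entry_sum J"
  have "J *\<^sub>v s \<noteq> 0\<^sub>v (2 * d)"
    using det_0_iff_vec_prod_zero_field[OF flux_mat_carrier, of vh d] det_J s(2) sc by blast
  then have b: "?b > 0"
    using cvnorm_eq_0_iff[OF J_vec_carrier[OF sc]] cvnorm_nonneg[of "J *\<^sub>v s"] by linarith
  have "cvnorm (An (j * N) (- (real (j * N) * \<alpha>)) *\<^sub>v e) \<le> sqrt (?K * ?a / ?b) * cvnorm e"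
    if e: "e \<in> Em (- (real (j * N) * \<alpha>))" for j e
  proof -
    let ?n = "j * N" let ?t = "- (real (j * N) * \<alpha>)"
    let ?X = "cvnorm (An ?n ?t *\<^sub>v e)"
    have "(\<lambda>u. An ?n ?t *\<^sub>v u) ` Ep ?t = Ep 0" using image_Ep[of ?n ?t] by simp
    then have "s \<in> (\<lambda>u. An ?n ?t *\<^sub>v u) ` Ep ?t" "J *\<^sub>v s \<in> (\<lambda>u. An ?n ?t *\<^sub>v u) ` Ep ?t"
      using s by simp_all
    \<comment> \<open>The preimages carry the same value of the form, so the product of their norms
      cannot be small.\<close>
    then obtain y1 y2 where y: "y1 \<in> Ep ?t" "An ?n ?t *\<^sub>v y1 = s" "y2 \<in> Ep ?t" "An ?n ?t *\<^sub>v y2 = J *\<^sub>v s"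
      by (elim imageE) (rule that, assumption, simp, assumption, simp)
    have yc: "y1 \<in> carrier_vec (2 * d)" "y2 \<in> carrier_vec (2 * d)" using y Ep_carrier by auto
    have "?b\<^sup>2 = cmod (flux vh d (An ?n ?t *\<^sub>v y2) (An ?n ?t *\<^sub>v y1))"
      unfolding y using flux_self[OF sc] by simp
    also have "\<dots> \<le> ?K * cvnorm y2 * cvnorm y1"
      unfolding flux_An[OF yc(2,1)] by (rule flux_bound[OF yc(2,1)])
    finally have b2: "?b\<^sup>2 \<le> ?K * cvnorm y2 * cvnorm y1" .
    \<comment> \<open>Multiplied together, these two inequalities contain that product on the left.
      Its lower bound leaves an estimate for the square of \<open>?X\<close>, hence the square root
      in the constant.\<close>
    have X: "?X * cvnorm y1 \<le> ?a * cvnorm e" "?X * cvnorm y2 \<le> ?b * cvnorm e"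
      using dom[OF y(1) e, of j] dom[OF y(3) e, of j] unfolding y(2,4) by (simp_all only:)
    have "?X\<^sup>2 * ?b\<^sup>2 \<le> ?X\<^sup>2 * (?K * cvnorm y2 * cvnorm y1)" by (rule mult_left_mono[OF b2]) simp
    also have "\<dots> = ?K * ((?X * cvnorm y1) * (?X * cvnorm y2))" by (simp add: power2_eq_square mult_ac)
    also have "\<dots> \<le> ?K * ((?a * cvnorm e) * (?b * cvnorm e))"
      by (intro mult_left_mono mult_mono X) auto
    finally have "?X\<^sup>2 * ?b * ?b \<le> ?K * ?a * (cvnorm e)\<^sup>2 * ?b" by (simp add: power2_eq_square mult_ac)
    then have "?X\<^sup>2 * ?b \<le> ?K * ?a * (cvnorm e)\<^sup>2" using b by simp
    then have "?X\<^sup>2 \<le> ?K * ?a / ?b * (cvnorm e)\<^sup>2" using b by (simp add: field_simps)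
    then have "?X\<^sup>2 \<le> (sqrt (?K * ?a / ?b) * cvnorm e)\<^sup>2" using b by (simp add: power_mult_distrib)
    then show ?thesis by (rule power2_le_imp_le) (use b in simp)
  qed
  then show ?thesis using b by (intro exI[of _ "sqrt (?K * ?a / ?b)"]) auto
qed

text \<open>If \<open>p1, p2\<close> are quantitatively independent and small both in the forward and in the backward
  orbit, then \<open>Em 0\<close> together with \<open>p1, p2\<close> spans a space of dimension \<open>d + 1\<close> that the forward
  orbit contracts, hence an almost isotropic one.\<close>

lemma no_decaying_pair:
  "\<exists>\<tau>>0. \<forall>j \<eta> \<mu> p1 p2 q1 q2.
    p1 \<in> carrier_vec (2 * d) \<longrightarrow> p2 \<in> carrier_vec (2 * d) \<longrightarrow> q1 \<in> carrier_vec (2 * d) \<longrightarrow> q2 \<in> carrier_vec (2 * d) \<longrightarrow>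
    0 < \<mu> \<longrightarrow> 0 \<le> \<eta> \<longrightarrow> (\<forall>a b. \<mu> * (cmod a + cmod b) \<le> cvnorm (a \<cdot>\<^sub>v p1 + b \<cdot>\<^sub>v p2)) \<longrightarrow>
    cvnorm (An (j * N) 0 *\<^sub>v p1) \<le> \<eta> \<longrightarrow> cvnorm (An (j * N) 0 *\<^sub>v p2) \<le> \<eta> \<longrightarrow>
    cvnorm q1 \<le> \<eta> \<longrightarrow> cvnorm q2 \<le> \<eta> \<longrightarrow>
    cvnorm (p1 - An (j * N) (- (real (j * N) * \<alpha>)) *\<^sub>v q1) \<le> \<eta> \<longrightarrow>
    cvnorm (p2 - An (j * N) (- (real (j * N) * \<alpha>)) *\<^sub>v q2) \<le> \<eta> \<longrightarrow> \<tau> * \<mu> < \<eta>"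
proof -
  obtain K3 where K3: "K3 \<ge> 0" "\<And>j e. e \<in> Em (- (real (j * N) * \<alpha>)) \<Longrightarrow>
      cvnorm (An (j * N) (- (real (j * N) * \<alpha>)) *\<^sub>v e) \<le> K3 * cvnorm e"
    using Em_backward_bound by blast
  obtain cJ where cJ: "cJ \<ge> 0" "\<And>x. x \<in> carrier_vec (2 * d) \<Longrightarrow> cvnorm x \<le> cJ * cvnorm (J *\<^sub>v x)"
    using J_lower_bound by blast
  let ?K = "entry_sum J"
  \<comment> \<open>\<open>C1 * \<eta>\<close> will bound the \<open>Em\<close> part of normalised
    combinations of \<open>p1\<close> and \<open>p2\<close>; \<open>C4 * \<tau>\<close> will bound
    the contraction on \<open>Em 0\<close> plus their span. The threshold \<open>x\<close> makes
    this contraction incompatible with the conserved form, and \<tau> is small enough for both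
    purposes.\<close>
  define C1 where "C1 = K3 * C + C"
  define C4 where "C4 = 4 * C * C + 2 * C"
  define x where "x = 1 / (?K * cJ + 1)"
  define \<tau> where "\<tau> = min (1 / (2 * C1)) (x / C4)"
  have C1: "C1 > 0" using K3(1) C_pos by (simp add: C1_def add_nonneg_pos)
  have C4: "C4 > 0" using C_pos by (simp add: C4_def add_pos_pos)
  have x: "0 < x" "x \<le> 1" "x * (?K * cJ) < 1"
    using cJ(1) entry_sum_nonneg[of J] by (auto simp: x_def divide_simps add_nonneg_pos)
  have tau: "\<tau> > 0" "C1 * \<tau> \<le> 1 / 2" "C4 * \<tau> \<le> x"
  proof -
    show "\<tau> > 0" using C1 C4 x by (simp add: \<tau>_def)
    have "C1 * \<tau> \<le> C1 * (1 / (2 * C1))" using C1 by (intro mult_left_mono) (auto simp: \<tau>_def)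
    then show "C1 * \<tau> \<le> 1 / 2" using C1 by simp
    have "C4 * \<tau> \<le> C4 * (x / C4)" using C4 by (intro mult_left_mono) (auto simp: \<tau>_def)
    then show "C4 * \<tau> \<le> x" using C4 by simp
  qed
  have "\<tau> * \<mu> < \<eta>" if p: "p1 \<in> carrier_vec (2 * d)" "p2 \<in> carrier_vec (2 * d)"
    and q: "q1 \<in> carrier_vec (2 * d)" "q2 \<in> carrier_vec (2 * d)" and mu: "0 < \<mu>" and eta: "0 \<le> \<eta>"
    and low: "\<And>a b. \<mu> * (cmod a + cmod b) \<le> cvnorm (a \<cdot>\<^sub>v p1 + b \<cdot>\<^sub>v p2)"
    and fw: "cvnorm (An (j * N) 0 *\<^sub>v p1) \<le> \<eta>" "cvnorm (An (j * N) 0 *\<^sub>v p2) \<le> \<eta>"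
    and qn: "cvnorm q1 \<le> \<eta>" "cvnorm q2 \<le> \<eta>"
    and bw: "cvnorm (p1 - An (j * N) (- (real (j * N) * \<alpha>)) *\<^sub>v q1) \<le> \<eta>"
      "cvnorm (p2 - An (j * N) (- (real (j * N) * \<alpha>)) *\<^sub>v q2) \<le> \<eta>" for j \<eta> \<mu> p1 p2 q1 q2
  proof (rule ccontr)
    assume "\<not> \<tau> * \<mu> < \<eta>"
    then have small: "\<eta> \<le> \<tau> * \<mu>" by simp
    let ?n = "j * N" let ?t = "- (real (j * N) * \<alpha>)"
    let ?A = "An ?n 0" and ?B = "An ?n ?t"
    let ?p = "\<lambda>a b. a \<cdot>\<^sub>v p1 + b \<cdot>\<^sub>v p2" and ?S = "\<lambda>a b. cmod a + cmod b"
    have pc: "?p a b \<in> carrier_vec (2 * d)" for a b using p by simp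
    have Ap: "cvnorm (?A *\<^sub>v ?p a b) \<le> \<eta> * ?S a b" for a b
      unfolding mult_mat_vec_lincomb[OF An_carrier p]
      by (rule cvnorm_lincomb[OF An_vec_carrier[OF p(1)] An_vec_carrier[OF p(2)] fw])
    \<comment> \<open>A combination of the pair is the image of a small vector from the past plus a
      small error. Both are split along the two bundles: \<open>K3\<close> controls the transported
      \<open>Em\<close> part of the former, and \<open>C\<close> alone that of the error.\<close>
    have split: "\<exists>u\<in>Ep 0. \<exists>w\<in>Em 0. ?p a b = u + w \<and> cvnorm w \<le> C1 * \<eta> * ?S a b" for a b
    proof -
      let ?q = "a \<cdot>\<^sub>v q1 + b \<cdot>\<^sub>v q2"
      let ?r = "a \<cdot>\<^sub>v (p1 - ?B *\<^sub>v q1) + b \<cdot>\<^sub>v (p2 - ?B *\<^sub>v q2)"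
      have Bq: "?B *\<^sub>v q1 \<in> carrier_vec (2 * d)" "?B *\<^sub>v q2 \<in> carrier_vec (2 * d)"
        using q An_vec_carrier by auto
      have qc: "?q \<in> carrier_vec (2 * d)" and rc: "?r \<in> carrier_vec (2 * d)" using q p Bq by auto
      have qn': "cvnorm ?q \<le> \<eta> * ?S a b" by (rule cvnorm_lincomb[OF q qn])
      have rn: "cvnorm ?r \<le> \<eta> * ?S a b" 
        by (rule cvnorm_lincomb[OF minus_carrier_vec[OF p(1) Bq(1)] minus_carrier_vec[OF p(2) Bq(2)] bw])
      have eq: "?p a b = ?B *\<^sub>v ?q + ?r"
        unfolding mult_mat_vec_lincomb[OF An_carrier q]
        using p carrier_vecD[OF Bq(1)] carrier_vecD[OF Bq(2)]
        by (intro eq_vecI) (simp_all add: algebra_simps del: index_mult_mat_vec dim_mult_mat_vec)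
      obtain qu qw where qq: "qu \<in> Ep ?t" "qw \<in> Em ?t" "?q = qu + qw" using decompose[OF qc] by blast
      obtain ru rw where rr: "ru \<in> Ep 0" "rw \<in> Em 0" "?r = ru + rw" using decompose[OF rc] by blast
      have "?B *\<^sub>v qu \<in> Ep 0" "?B *\<^sub>v qw \<in> Em 0" using An_Ep[OF qq(1), of ?n] An_Em[OF qq(2), of ?n] by auto
      then have u: "?B *\<^sub>v qu + ru \<in> Ep 0" and w: "?B *\<^sub>v qw + rw \<in> Em 0"
        using rr Ep_add Em_add by auto
      have c: "?B *\<^sub>v qu \<in> carrier_vec (2 * d)" "?B *\<^sub>v qw \<in> carrier_vec (2 * d)"
        "ru \<in> carrier_vec (2 * d)" "rw \<in> carrier_vec (2 * d)"
        using An_vec_carrier[OF Ep_carrier[OF qq(1)]] An_vec_carrier[OF Em_carrier[OF qq(2)]]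
          Ep_carrier[OF rr(1)] Em_carrier[OF rr(2)] by auto
      have "?p a b = (?B *\<^sub>v qu + ?B *\<^sub>v qw) + (ru + rw)"
        unfolding eq qq(3) rr(3)
        by (simp only: mult_add_distrib_mat_vec[OF An_carrier Ep_carrier[OF qq(1)] Em_carrier[OF qq(2)]])
      also have "\<dots> = (?B *\<^sub>v qu + ru) + (?B *\<^sub>v qw + rw)"
        using carrier_vecD[OF c(1)] carrier_vecD[OF c(2)] c(3,4)
        by (intro eq_vecI) (simp_all add: algebra_simps del: index_mult_mat_vec dim_mult_mat_vec)
      finally have e: "?p a b = (?B *\<^sub>v qu + ru) + (?B *\<^sub>v qw + rw)" .
      have "cvnorm (?B *\<^sub>v qw + rw) \<le> cvnorm (?B *\<^sub>v qw) + cvnorm rw" by (rule cvnorm_add[OF c(2,4)])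
      also have "\<dots> \<le> K3 * (C * (\<eta> * ?S a b)) + C * (\<eta> * ?S a b)"
      proof (rule add_mono)
        have "cvnorm qw \<le> C * cvnorm ?q" unfolding qq(3) by (rule proj(2)[OF qq(1,2)])
        also have "\<dots> \<le> C * (\<eta> * ?S a b)" using C_pos by (intro mult_left_mono qn') simp
        finally show "cvnorm (?B *\<^sub>v qw) \<le> K3 * (C * (\<eta> * ?S a b))"
          using K3(2)[OF qq(2)] K3(1) by (meson mult_left_mono order_trans)
        have "cvnorm rw \<le> C * cvnorm ?r" unfolding rr(3) by (rule proj(2)[OF rr(1,2)])
        also have "\<dots> \<le> C * (\<eta> * ?S a b)" using C_pos by (intro mult_left_mono rn) simp
        finally show "cvnorm rw \<le> C * (\<eta> * ?S a b)" .
      qed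
      also have "\<dots> = C1 * \<eta> * ?S a b" by (simp add: C1_def algebra_simps)
      finally show ?thesis using u w e by blast
    qed
    \<comment> \<open>The \<open>Em\<close> part thus takes at most half of the independence bound,
      and the \<open>Ep\<close> part keeps the other half.\<close>
    have C1eta: "C1 * \<eta> \<le> \<mu> / 2"
    proof -
      have "C1 * \<eta> \<le> C1 * (\<tau> * \<mu>)" using small C1 by (intro mult_left_mono) auto
      also have "\<dots> \<le> 1 / 2 * \<mu>" using tau(2) mu by (simp only: mult.assoc[symmetric]) (intro mult_right_mono, auto)
      finally show ?thesis by simp
    qed
    have u_low: "\<mu> / 2 * ?S a b \<le> cvnorm u"
      if "u \<in> Ep 0" "w \<in> Em 0" "?p a b = u + w" "cvnorm w \<le> C1 * \<eta> * ?S a b" for u w a b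
    proof -
      have "\<mu> * ?S a b \<le> cvnorm u + cvnorm w"
        using low[of a b] cvnorm_add[OF Ep_carrier[OF that(1)] Em_carrier[OF that(2)]] that(3) by simp
      moreover have "C1 * \<eta> * ?S a b \<le> \<mu> / 2 * ?S a b" by (rule mult_right_mono[OF C1eta]) simp
      ultimately show ?thesis using that(4) by (simp add: field_simps)
    qed
    \<comment> \<open>A contracted vector of \<open>Ep 0\<close> bounds the contraction on all of
      \<open>Em 0\<close>. The \<open>Ep\<close> part of \<open>p1\<close> is one: its length is at
      least \<open>\<mu> / 2\<close>, and projecting the forward image of \<open>p1\<close> bounds
      its image by \<open>C * \<eta>\<close>.\<close>
    have Ae: "cvnorm (?A *\<^sub>v e) \<le> 2 * C * \<tau> * cvnorm e" if e: "e \<in> Em 0" for e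
    proof -
      obtain u w where uw: "u \<in> Ep 0" "w \<in> Em 0" "?p 1 0 = u + w" "cvnorm w \<le> C1 * \<eta> * ?S 1 0"
        using split[of 1 0] by blast
      have lu: "\<mu> / 2 \<le> cvnorm u" using u_low[OF uw] by simp
      have "cvnorm (?A *\<^sub>v u) \<le> C * cvnorm (?A *\<^sub>v u + ?A *\<^sub>v w)"
        using An_Ep[OF uw(1), of ?n] An_Em[OF uw(2), of ?n] by (rule proj(1))
      also have "?A *\<^sub>v u + ?A *\<^sub>v w = ?A *\<^sub>v ?p 1 0"
        unfolding uw(3) by (rule mult_add_distrib_mat_vec[OF An_carrier Ep_carrier[OF uw(1)] Em_carrier[OF uw(2)], symmetric])
      also have "C * cvnorm (?A *\<^sub>v ?p 1 0) \<le> C * \<eta>"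
        using Ap[of 1 0] C_pos by (intro mult_left_mono) auto
      finally have Au: "cvnorm (?A *\<^sub>v u) \<le> C * \<eta>" .
      have "cvnorm (?A *\<^sub>v e) * (\<mu> / 2) \<le> cvnorm (?A *\<^sub>v e) * cvnorm u"
        by (rule mult_left_mono[OF lu]) simp
      also have "\<dots> \<le> cvnorm (?A *\<^sub>v u) * cvnorm e" by (rule dom[OF uw(1) e])
      also have "\<dots> \<le> C * \<eta> * cvnorm e" by (rule mult_right_mono[OF Au]) simp
      also have "\<dots> \<le> C * (\<tau> * \<mu>) * cvnorm e"
        using small C_pos by (intro mult_right_mono mult_left_mono) auto
      finally have "cvnorm (?A *\<^sub>v e) * \<mu> \<le> 2 * C * \<tau> * cvnorm e * \<mu>" by (simp add: mult_ac)
      then show ?thesis using mu by simp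
    qed
    \<comment> \<open>Regrouping \<open>e + p\<close> as \<open>u + (e + w)\<close> along the
      splitting shows that the coefficients of \<open>p\<close> and the vector \<open>e\<close> are
      controlled by the sum. Hence cancellation between \<open>e\<close> and \<open>p\<close> cannot
      spoil the contraction.\<close>
    have comb: "cvnorm (?A *\<^sub>v (e + ?p a b)) \<le> C4 * \<tau> * cvnorm (e + ?p a b)"
      "\<mu> * ?S a b \<le> 2 * C * cvnorm (e + ?p a b)" "cvnorm e \<le> 2 * C * cvnorm (e + ?p a b)"
      if e: "e \<in> Em 0" for e a b
    proof -
      let ?s = "e + ?p a b"
      obtain u w where uw: "u \<in> Ep 0" "w \<in> Em 0" "?p a b = u + w" "cvnorm w \<le> C1 * \<eta> * ?S a b"
        using split[of a b] by blast
      have c: "u \<in> carrier_vec (2 * d)" "w \<in> carrier_vec (2 * d)" "e \<in> carrier_vec (2 * d)"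
        using uw e Ep_carrier Em_carrier by auto
      have s: "?s = u + (e + w)" unfolding uw(3) using c by (intro eq_vecI) auto
      have ew: "e + w \<in> Em 0" by (rule Em_add[OF e uw(2)])
      have un: "cvnorm u \<le> C * cvnorm ?s" and ewn: "cvnorm (e + w) \<le> C * cvnorm ?s"
        unfolding s by (rule proj(1)[OF uw(1) ew], rule proj(2)[OF uw(1) ew])
      show S: "\<mu> * ?S a b \<le> 2 * C * cvnorm ?s" using u_low[OF uw] un by simp
      have "cvnorm e \<le> cvnorm (e + w) + cvnorm w"
      proof -
        have "e = (e + w) - w" using c by (intro eq_vecI) auto
        then show ?thesis using cvnorm_diff[of "e + w" "2 * d" w] c by simp
      qed
      also have "cvnorm w \<le> \<mu> / 2 * ?S a b"
        by (rule order_trans[OF uw(4) mult_right_mono[OF C1eta]]) simp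
      also have "\<mu> / 2 * ?S a b \<le> C * cvnorm ?s" using S by simp
      finally show en: "cvnorm e \<le> 2 * C * cvnorm ?s" using ewn by simp
      have "?A *\<^sub>v ?s = ?A *\<^sub>v e + ?A *\<^sub>v ?p a b"
        by (rule mult_add_distrib_mat_vec[OF An_carrier c(3) pc])
      then have "cvnorm (?A *\<^sub>v ?s) \<le> cvnorm (?A *\<^sub>v e) + cvnorm (?A *\<^sub>v ?p a b)"
        using cvnorm_add[OF An_vec_carrier[OF c(3)] An_vec_carrier[OF pc]] by simp
      also have "\<dots> \<le> 2 * C * \<tau> * (2 * C * cvnorm ?s) + \<tau> * (2 * C * cvnorm ?s)"
      proof (rule add_mono)
        have "2 * C * \<tau> * cvnorm e \<le> 2 * C * \<tau> * (2 * C * cvnorm ?s)"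
          using C_pos tau(1) by (intro mult_left_mono en) auto
        then show "cvnorm (?A *\<^sub>v e) \<le> 2 * C * \<tau> * (2 * C * cvnorm ?s)" by (rule order_trans[OF Ae[OF e]])
        have "\<eta> * ?S a b \<le> \<tau> * \<mu> * ?S a b" by (rule mult_right_mono[OF small]) simp
        also have "\<dots> = \<tau> * (\<mu> * ?S a b)" by (rule mult.assoc)
        also have "\<dots> \<le> \<tau> * (2 * C * cvnorm ?s)" using tau(1) by (intro mult_left_mono S) simp
        finally show "cvnorm (?A *\<^sub>v ?p a b) \<le> \<tau> * (2 * C * cvnorm ?s)" using Ap[of a b] by simp
      qed
      also have "\<dots> = C4 * \<tau> * cvnorm ?s" by (simp add: C4_def algebra_simps)
      finally show "cvnorm (?A *\<^sub>v ?s) \<le> C4 * \<tau> * cvnorm ?s" .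
    qed
    obtain fr where fr: "\<And>i. i < 2 * d \<Longrightarrow> fr i \<in> carrier_vec (2 * d)"
      "Determinant.det (frame_mat (2 * d) fr) \<noteq> 0" "Em 0 = cspan (2 * d) (\<lambda>i. fr (d + 1 + i)) (2 * d - (d + 1))"
      using frame[of 0] by blast
    \<comment> \<open>The \<open>d - 1\<close> frame vectors of \<open>Em 0\<close>, then
      \<open>p1\<close> and \<open>p2\<close>: one more than half of \<open>2 * d\<close>.\<close>
    define g where "g i = (if i < d - 1 then fr (d + 1 + i) else if i = d - 1 then p1 else p2)" for i
    let ?lc = "\<lambda>c. Matrix.vec (2 * d) (\<lambda>j. \<Sum>i<d + 1. c i * vec_index (g i) j)"
    let ?e = "\<lambda>c. Matrix.vec (2 * d) (\<lambda>j. \<Sum>i<2 * d - (d + 1). c i * vec_index (fr (d + 1 + i)) j)"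
    have e_Em: "?e c \<in> Em 0" for c unfolding fr(3) by (auto simp: cspan_def)
    have lc: "?lc c = ?e c + ?p (c (d - 1)) (c d)" for c
    proof (rule eq_vecI)
      fix j assume "j < dim_vec (?e c + ?p (c (d - 1)) (c d))"
      then have j: "j < 2 * d" using p by simp
      have sum: "(\<Sum>i<Suc (Suc r). f i) = (\<Sum>i<r. f i) + f r + f (Suc r)" for f :: "nat \<Rightarrow> complex" and r
        by simp
      have e: "d + 1 = Suc (Suc (d - 1))" "2 * d - (d + 1) = d - 1" "Suc (d - 1) = d" using d_pos by auto
      have "(\<Sum>i<d + 1. c i * vec_index (g i) j)
          = (\<Sum>i<2 * d - (d + 1). c i * vec_index (g i) j) + c (d - 1) * vec_index (g (d - 1)) j + c d * vec_index (g d) j"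
        using sum[of "\<lambda>i. c i * vec_index (g i) j" "d - 1"] unfolding e(2,3) unfolding Suc_eq_plus1 .
      also have "(\<Sum>i<2 * d - (d + 1). c i * vec_index (g i) j) = (\<Sum>i<2 * d - (d + 1). c i * vec_index (fr (d + 1 + i)) j)"
        by (intro sum.cong) (auto simp: g_def)
      also have "g (d - 1) = p1" by (simp add: g_def)
      also have "g d = p2" using d_pos by (auto simp: g_def)
      finally show "vec_index (?lc c) j = vec_index (?e c + ?p (c (d - 1)) (c d)) j"
        using j p by simp
    qed (use p in simp)
    have "\<exists>s\<in>cspan (2 * d) g (d + 1). s \<noteq> 0\<^sub>v (2 * d) \<and> J *\<^sub>v s \<in> cspan (2 * d) g (d + 1)"
    proof (rule cspan_meets_preimage)
      fix i assume "i < d + 1"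
      then show "g i \<in> carrier_vec (2 * d)" using fr(1) p by (auto simp: g_def)
    next
      \<comment> \<open>Independence is read off \<open>comb\<close>: a vanishing combination bounds
        the coefficients of \<open>p1\<close>, \<open>p2\<close> and the \<open>Em\<close> part by
        0.\<close>
      fix c i assume z: "?lc c = 0\<^sub>v (2 * d)" and i: "i < d + 1"
      have z': "cvnorm (?e c + ?p (c (d - 1)) (c d)) = 0" using z unfolding lc by simp
      have S0: "\<mu> * ?S (c (d - 1)) (c d) \<le> 0" and "cvnorm (?e c) \<le> 0"
        using comb(2)[OF e_Em[of c], of "c (d - 1)" "c d"] comb(3)[OF e_Em[of c], of "c (d - 1)" "c d"] z' by auto
      then have e0: "cvnorm (?e c) = 0" by (intro order_antisym) auto
      have "?S (c (d - 1)) (c d) \<le> 0" using S0 mu by (simp add: mult_le_0_iff)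
      then have "?S (c (d - 1)) (c d) = 0" by (intro order_antisym) auto
      then have cd: "c (d - 1) = 0" "c d = 0" by (simp_all add: add_nonneg_eq_0_iff)
      have ez: "?e c = 0\<^sub>v (2 * d)" using e0 cvnorm_eq_0_iff[of "?e c" "2 * d"] by simp
      show "c i = 0"
      proof (cases "i < d - 1")
        case True
        define c' where "c' i = (if i < d + 1 then 0 else c (i - (d + 1)))" for i
        have "Matrix.vec (2 * d) (\<lambda>j. \<Sum>i<2 * d. c' i * vec_index (fr i) j) = ?e c"
        proof (rule eq_vecI)
          fix j
          have "(\<Sum>i<2 * d. c' i * vec_index (fr i) j) = (\<Sum>i\<in>{d + 1..<2 * d}. c' i * vec_index (fr i) j)"
            by (intro sum.mono_neutral_right) (auto simp: c'_def)
          also have "\<dots> = (\<Sum>i<2 * d - (d + 1). c i * vec_index (fr (d + 1 + i)) j)"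
            by (rule sum.reindex_bij_witness[of _ "\<lambda>i. d + 1 + i" "\<lambda>i. i - (d + 1)"]) (auto simp: c'_def)
          finally have eq: "(\<Sum>i<2 * d. c' i * vec_index (fr i) j)
              = (\<Sum>i<2 * d - (d + 1). c i * vec_index (fr (d + 1 + i)) j)" .
          assume "j < dim_vec (?e c)"
          then show "vec_index (Matrix.vec (2 * d) (\<lambda>j. \<Sum>i<2 * d. c' i * vec_index (fr i) j)) j = vec_index (?e c) j"
            by (simp only: dim_vec index_vec eq)
        qed simp
        then have "c' (d + 1 + i) = 0" using frame_independent[OF fr(2), of c' "d + 1 + i"] ez True by simp
        then show ?thesis by (simp add: c'_def)
      next
        case False
        then have "i = d - 1 \<or> i = d" using i by auto
        then show ?thesis using cd by auto
      qed
    qed (use d_pos in auto)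
    then obtain s c c' where s: "s \<noteq> 0\<^sub>v (2 * d)" "s = ?lc c" "J *\<^sub>v s = ?lc c'"
      unfolding cspan_def by blast
    have sc: "s \<in> carrier_vec (2 * d)" "J *\<^sub>v s \<in> carrier_vec (2 * d)" using s by simp_all
    let ?z = "J *\<^sub>v s"
    \<comment> \<open>\<open>s\<close> and \<open>J s\<close> shrink by the factor \<open>x\<close>,
      while the form at their images keeps the value |J s|^2. One of the two factors
      \<open>x\<close> is then estimated by 1, the other gives the contradiction.\<close>
    have As: "cvnorm (?A *\<^sub>v s) \<le> x * cvnorm s" and Az: "cvnorm (?A *\<^sub>v ?z) \<le> x * cvnorm ?z"
      using comb(1)[OF e_Em[of c], of "c (d - 1)" "c d"] comb(1)[OF e_Em[of c'], of "c' (d - 1)" "c' d"] tau(3)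
        mult_right_mono[OF tau(3) cvnorm_nonneg[of s]] mult_right_mono[OF tau(3) cvnorm_nonneg[of ?z]]
      unfolding lc[symmetric] s(2)[symmetric] s(3)[symmetric] by linarith+
    have "cvnorm s \<noteq> 0" using s(1) cvnorm_eq_0_iff[OF sc(1)] by simp
    then have spos: "cvnorm s > 0" using cvnorm_nonneg[of s] by linarith
    then have zpos: "cvnorm ?z > 0"
      using cJ(2)[OF sc(1)] order_le_less[of 0 "cvnorm ?z"] by (cases "cvnorm ?z = 0") auto
    have "(cvnorm ?z)\<^sup>2 = cmod (flux vh d (?A *\<^sub>v ?z) (?A *\<^sub>v s))"
      unfolding flux_An[OF sc(2,1)] by (rule flux_self[OF sc(1), symmetric])
    also have "\<dots> \<le> ?K * cvnorm (?A *\<^sub>v ?z) * cvnorm (?A *\<^sub>v s)"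
      by (rule flux_bound[OF An_vec_carrier[OF sc(2)] An_vec_carrier[OF sc(1)]])
    also have "\<dots> \<le> ?K * (x * cvnorm ?z) * (x * cvnorm s)"
      using x by (intro mult_mono Az As) auto
    also have "\<dots> \<le> ?K * (x * cvnorm ?z) * (1 * (cJ * cvnorm ?z))"
      using x cJ(2)[OF sc(1)] by (intro mult_left_mono mult_mono) auto
    also have "\<dots> = x * (?K * cJ) * (cvnorm ?z)\<^sup>2" by (simp add: power2_eq_square mult_ac)
    also have "\<dots> < 1 * (cvnorm ?z)\<^sup>2" using x(3) zpos by (intro mult_strict_right_mono) auto
    finally show False by simp
  qed
  then show ?thesis using tau(1) by blast
qed

end

section \<open>Approximate solutions of the dual equation\<close>

lemma norm_cis_minus_one_le: "cmod (cis t - 1) \<le> \<bar>t\<bar>"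
proof -
  have "cis t - 1 = cis (t / 2) * (cis (t / 2) - cis (- (t / 2)))"
    unfolding right_diff_distrib cis_mult by simp
  also have "cis (t / 2) - cis (- (t / 2)) = 2 * \<i> * sin (t / 2)" by (simp add: complex_eq_iff)
  finally have "cmod (cis t - 1) = 2 * \<bar>sin (t / 2)\<bar>" by (simp add: norm_mult)
  also have "\<dots> \<le> \<bar>t\<bar>" using abs_sin_x_le_abs_x[of "t / 2"] by simp
  finally show ?thesis .
qed

text \<open>Half of the decay rate \<open>2 * h\<close> pays for the weight, the other half makes
  the tail beyond \<open>K\<close> small. The divisors cost a factor \<open>2 * q\<close>, so the
  tail is at most \<open>\<gamma> q / 2\<close> for suitable \<open>K\<close>. The head is a
  constant, which \<open>q > Q\<close> absorbs.\<close>

lemma coboundary_weight_bound: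
  assumes h: "h > 0" and a: "\<And>k. cmod (a k) \<le> M * exp (- (2 * h) * \<bar>of_int k\<bar>)" and g: "\<gamma> > 0"
  shows "\<exists>Q. \<forall>q::nat. Q < q \<longrightarrow> (\<forall>k::int. 0 < \<bar>k\<bar> \<and> \<bar>k\<bar> < int q \<longrightarrow> 1 / (2 * real q) \<le> cmod (ee k \<alpha> - 1)) \<longrightarrow>
    (\<Sum>k | 0 < \<bar>k\<bar> \<and> \<bar>k\<bar> < int q. cmod (a k / (ee k \<alpha> - 1)) * exp (h * \<bar>of_int k\<bar>)) \<le> \<gamma> * real q"
proof -
  have M0: "M \<ge> 0" using order_trans[OF norm_ge_zero a[of 0]] by simp
  define T where "T = 2 / (1 - exp (- h))"
  have T: "T > 0" using h by (simp add: T_def)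
  have "(\<lambda>n. 2 * M * T * exp (- h) ^ n) \<longlonglongrightarrow> 2 * M * T * 0"
    by (intro tendsto_mult tendsto_const LIMSEQ_power_zero) (use h in simp)
  then have "\<forall>\<^sub>F n in sequentially. 2 * M * T * exp (- h) ^ n < \<gamma> / 2"
    using g by (intro order_tendstoD(2)) auto
  then obtain K where K: "2 * M * T * exp (- h) ^ K < \<gamma> / 2"
    by (auto simp: eventually_sequentially)
  then have K: "2 * M * (T * exp (- h * real K)) \<le> \<gamma> / 2"
    by (simp add: exp_of_nat_mult[symmetric] mult_ac)
  let ?t = "\<lambda>k::int. cmod (a k / (ee k \<alpha> - 1)) * exp (h * \<bar>of_int k\<bar>)"
  \<comment> \<open>The head is taken over all \<open>|k| < K\<close>, so that it does not depend on
    \<open>q\<close>. The index 0 contributes 0, since division by zero gives 0.\<close>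
  define c where "c = (\<Sum>k | \<bar>k\<bar> < int K. ?t k)"
  obtain Q :: nat where Q: "2 * c / \<gamma> < real Q" using reals_Archimedean2 by blast
  have "(\<Sum>k | 0 < \<bar>k\<bar> \<and> \<bar>k\<bar> < int q. ?t k) \<le> \<gamma> * real q"
    if q: "Q < q" and good: "\<And>k::int. 0 < \<bar>k\<bar> \<and> \<bar>k\<bar> < int q \<Longrightarrow> 1 / (2 * real q) \<le> cmod (ee k \<alpha> - 1)" for q
  proof -
    let ?F = "{k::int. int K \<le> \<bar>k\<bar> \<and> 0 < \<bar>k\<bar> \<and> \<bar>k\<bar> < int q}"
    have fin: "finite {k::int. \<bar>k\<bar> < int r}" for r
      by (rule finite_subset[of _ "{- int r..int r}"]) auto
    have finF: "finite ?F" by (rule finite_subset[OF _ fin[of q]]) auto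
    have tk: "?t k \<le> 2 * real q * M * exp (- h * \<bar>of_int k\<bar>)" if k: "k \<in> ?F" for k
    proof -
      have e: "1 / (2 * real q) \<le> cmod (ee k \<alpha> - 1)" using good[of k] k by auto
      have qp: "real q > 0" using q by simp
      then have "0 < 1 / (2 * real q)" by simp
      then have ep: "cmod (ee k \<alpha> - 1) > 0" using e by linarith
      have "1 \<le> 2 * real q * cmod (ee k \<alpha> - 1)" using e qp by (simp add: field_simps)
      then have "1 / cmod (ee k \<alpha> - 1) \<le> 2 * real q" using ep by (simp add: field_simps)
      then have "cmod (a k) * (1 / cmod (ee k \<alpha> - 1)) \<le> M * exp (- (2 * h) * \<bar>of_int k\<bar>) * (2 * real q)"
        using ep M0 by (intro mult_mono a) auto
      then have "cmod (a k / (ee k \<alpha> - 1)) \<le> M * exp (- (2 * h) * \<bar>of_int k\<bar>) * (2 * real q)"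
        by (simp add: norm_divide)
      then have "?t k \<le> M * exp (- (2 * h) * \<bar>of_int k\<bar>) * (2 * real q) * exp (h * \<bar>of_int k\<bar>)"
        by (rule mult_right_mono) simp
      also have "\<dots> = 2 * real q * M * (exp (- (2 * h) * \<bar>of_int k\<bar>) * exp (h * \<bar>of_int k\<bar>))" by (simp only: mult_ac)
      also have "exp (- (2 * h) * \<bar>of_int k\<bar>) * exp (h * \<bar>of_int k\<bar>) = exp (- h * \<bar>of_int k\<bar>)"
        unfolding exp_add[symmetric] by (simp add: algebra_simps)
      finally show ?thesis .
    qed
    have "(\<Sum>k | 0 < \<bar>k\<bar> \<and> \<bar>k\<bar> < int q. ?t k) \<le> (\<Sum>k\<in>{k. \<bar>k\<bar> < int K} \<union> ?F. ?t k)"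
      by (rule sum_mono2) (use fin finF in auto)
    also have "\<dots> = c + (\<Sum>k\<in>?F. ?t k)"
      unfolding c_def by (rule sum.union_disjoint) (use fin finF in auto)
    also have "(\<Sum>k\<in>?F. ?t k) \<le> (\<Sum>k\<in>?F. 2 * real q * M * exp (- h * \<bar>of_int k\<bar>))"
      by (rule sum_mono) (rule tk)
    also have "\<dots> = 2 * real q * M * (\<Sum>k\<in>?F. exp (- h * \<bar>of_int k\<bar>))"
      by (simp only: sum_distrib_left)
    also have "\<dots> \<le> 2 * real q * M * (T * exp (- h * real K))"
      unfolding T_def using M0 by (intro mult_left_mono sum_exp_tail[OF h finF]) auto
    also have "\<dots> = real q * (2 * M * (T * exp (- h * real K)))" by (simp only: mult_ac)
    also have "\<dots> \<le> real q * (\<gamma> / 2)" by (intro mult_left_mono K) simp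
    also have "c \<le> real q * (\<gamma> / 2)"
    proof -
      have "2 * c / \<gamma> < real q" using Q q by linarith
      then show ?thesis using g by (simp add: field_simps)
    qed
    finally show ?thesis by (simp add: algebra_simps)
  qed
  then show ?thesis by blast
qed

definition dual_residual :: "real \<Rightarrow> real \<Rightarrow> (int \<Rightarrow> complex) \<Rightarrow> nat \<Rightarrow> (int \<Rightarrow> complex) \<Rightarrow> int \<Rightarrow> complex" where
  "dual_residual \<alpha> E vh d z n =
    (\<Sum>k\<in>{- int d..int d}. vh k * z (n + k)) + of_real (2 * cos (2 * pi * of_int n * \<alpha>) - E) * z n"

text \<open>The potential is real and the cosine even, so reflection with conjugation is a symmetry
  of the equation. It supplies the second approximate solution and the backward half of
  \<open>propagate\<close>.\<close>

lemma dual_residual_cnj_reflect: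
  assumes sym: "\<And>k. \<bar>k\<bar> \<le> int d \<Longrightarrow> vh (- k) = cnj (vh k)"
  shows "dual_residual \<alpha> E vh d (\<lambda>n. cnj (z (- n))) n = cnj (dual_residual \<alpha> E vh d z (- n))"
proof -
  have "(\<Sum>k\<in>{- int d..int d}. vh k * cnj (z (- (n + k)))) = (\<Sum>k\<in>{- int d..int d}. cnj (vh k * z (- n + k)))"
    by (rule sum.reindex_bij_witness[of _ uminus uminus]) (use sym in \<open>auto simp: algebra_simps\<close>)
  then show ?thesis by (simp add: dual_residual_def cnj_sum)
qed

lemma dual_residual_lincomb:
  "dual_residual \<alpha> E vh d (\<lambda>n. a * z n + b * z' n) n
    = a * dual_residual \<alpha> E vh d z n + b * dual_residual \<alpha> E vh d z' n"
proof -
  have "(\<Sum>k\<in>A. vh k * (a * z (n + k) + b * z' (n + k)))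
      = a * (\<Sum>k\<in>A. vh k * z (n + k)) + b * (\<Sum>k\<in>A. vh k * z' (n + k))" for A
    unfolding sum_distrib_left sum.distrib[symmetric] by (rule sum.cong) (simp_all add: algebra_simps)
  then show ?thesis unfolding dual_residual_def by (simp only: ring_distribs mult_ac add_ac)
qed

lemma cnj_exp_2pi_real:
  assumes "cnj w = w"
  shows "cnj (exp (2 * pi * \<i> * w)) * exp (2 * pi * \<i> * w) = 1" "cmod (exp (2 * pi * \<i> * w)) = 1"
proof -
  have "Im w = 0" using assms by (simp add: complex_eq_iff)
  then have "w = of_real (Re w)" by (simp add: complex_eq_iff)
  then have "2 * pi * \<i> * w = \<i> * of_real (2 * pi * Re w)" by (metis mult.assoc mult.commute of_real_mult of_real_numeral)
  then have e: "exp (2 * pi * \<i> * w) = cis (2 * pi * Re w)" by (simp only: cis_conv_exp)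
  show "cmod (exp (2 * pi * \<i> * w)) = 1" unfolding e by simp
  show "cnj (exp (2 * pi * \<i> * w)) * exp (2 * pi * \<i> * w) = 1" unfolding e by (simp add: cis_cnj cis_mult)
qed

lemma exp_2pi_of_real: "exp (2 * pi * \<i> * of_real x) = cis (2 * pi * x)"
  by (simp add: cis_conv_exp mult_ac)

section \<open>The truncated gauge transformation\<close>

text \<open>\<open>f\<close> and \<open>g\<close> are the two rows of \<open>B\<close> applied to
  \<open>(1, -i)\<close>, an eigenvector of the rotation with eigenvalue
  \<open>cis (2 * pi * \<psi> x)\<close>; thus \<open>eq1\<close> and \<open>eq2\<close> are the
  rows of the conjugacy. \<open>wronski\<close> is \<open>det B = 1\<close>. The rate
  \<open>2 * h\<close> for \<psi> is the one that \<open>coboundary_weight_bound\<close> asks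
  for.\<close>

locale rotation_reducible =
  fixes \<alpha> E :: real and d :: nat and vh :: "int \<Rightarrow> complex"
    and f f' g :: "real \<Rightarrow> complex" and \<psi> \<psi>' :: "real \<Rightarrow> real" and h M\<^sub>f M\<^sub>\<psi> B\<^sub>f :: real
  assumes f_deriv: "\<And>x. (f has_vector_derivative f' x) (at x)"
    and f_per: "\<And>x. f (x + 1) = f x"
    and f_bound: "\<And>x. cmod (f x) \<le> B\<^sub>f"
    and f_decay: "\<And>k. cmod (fc f k) \<le> M\<^sub>f * exp (- h * \<bar>of_int k\<bar>)"
    and psi_deriv: "\<And>x. (\<psi> has_real_derivative \<psi>' x) (at x)"
    and psi_per: "\<And>x. \<psi> (x + 1) = \<psi> x"
    and psi_mean: "fc (\<lambda>x. of_real (\<psi> x)) 0 = 0"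
    and psi_decay: "\<And>k. cmod (fc (\<lambda>x. of_real (\<psi> x)) k) \<le> M\<^sub>\<psi> * exp (- (2 * h) * \<bar>of_int k\<bar>)"
    and h_pos: "h > 0"
    and irr: "\<alpha> \<notin> \<rat>"
    and sym: "\<And>k. \<bar>k\<bar> \<le> int d \<Longrightarrow> vh (- k) = cnj (vh k)"
    and eq1: "\<And>x. (of_real E - (\<Sum>k\<in>{- int d..int d}. vh k * ee k x)) * f x - g x = cis (2 * pi * \<psi> x) * f (x + \<alpha>)"
    and eq2: "\<And>x. f x = cis (2 * pi * \<psi> x) * g (x + \<alpha>)"
    and wronski: "\<And>x. f x * cnj (g x) - cnj (f x) * g x = 2 * \<i>"
begin

definition "c\<^sub>\<psi> = fc (\<lambda>x. of_real (\<psi> x))"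

definition "idx q = {k::int. 0 < \<bar>k\<bar> \<and> \<bar>k\<bar> < int q}"

definition "psi_trunc q x = (\<Sum>k\<in>idx q. c\<^sub>\<psi> k * ee k x)"

definition "phi q x = (\<Sum>k\<in>idx q. c\<^sub>\<psi> k / (ee k \<alpha> - 1) * ee k x)"

definition "u q x = exp (2 * pi * \<i> * phi q x) * f x"

definition "good q \<longleftrightarrow> (\<forall>k::int. 0 < \<bar>k\<bar> \<and> \<bar>k\<bar> < int q \<longrightarrow> 1 / (2 * real q) \<le> cmod (ee k \<alpha> - 1))"

lemma finite_idx [simp]: "finite (idx q)"
  by (rule finite_subset[of _ "{- int q..int q}"]) (auto simp: idx_def)

lemma continuous_f: "continuous_on S f"
  using f_deriv by (intro continuous_at_imp_continuous_on ballI has_vector_derivative_continuous)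

lemma c_psi_reflect: "c\<^sub>\<psi> (- k) = cnj (c\<^sub>\<psi> k)"
  using fc_cnj[of "\<lambda>x. of_real (\<psi> x)" "- k"] by (simp add: c\<^sub>\<psi>_def)

lemma sum_idx_reflect: "(\<Sum>k\<in>idx q. F (- k)) = (\<Sum>k\<in>idx q. F k)"
  by (rule sum.reindex_bij_witness[of _ uminus uminus]) (auto simp: idx_def)

lemma psi_trunc_real: "cnj (psi_trunc q x) = psi_trunc q x"
proof -
  have "cnj (psi_trunc q x) = (\<Sum>k\<in>idx q. c\<^sub>\<psi> (- k) * ee (- k) x)"
    by (simp add: psi_trunc_def cnj_sum c_psi_reflect cnj_ee)
  then show ?thesis unfolding psi_trunc_def using sum_idx_reflect[of "\<lambda>k. c\<^sub>\<psi> k * ee k x" q] by simp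
qed

text \<open>Reality makes the gauge factor unimodular: \<open>u\<close> keeps the modulus of
  \<open>f\<close>, and only its Fourier decay suffers.\<close>

lemma phi_real: "cnj (phi q x) = phi q x"
proof -
  have "cnj (phi q x) = (\<Sum>k\<in>idx q. c\<^sub>\<psi> (- k) / (ee (- k) \<alpha> - 1) * ee (- k) x)"
    by (simp add: phi_def cnj_sum c_psi_reflect cnj_ee)
  then show ?thesis unfolding phi_def
    using sum_idx_reflect[of "\<lambda>k. c\<^sub>\<psi> k / (ee k \<alpha> - 1) * ee k x" q] by simp
qed

lemma ee_alpha_neq_1:
  assumes "good q" "k \<in> idx q"
  shows "ee k \<alpha> \<noteq> 1"
proof
  assume "ee k \<alpha> = 1"
  moreover have "1 / (2 * real q) \<le> cmod (ee k \<alpha> - 1)" "real q > 0" using assms by (auto simp: good_def idx_def)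
  ultimately show False by (simp add: divide_le_0_iff)
qed

lemma phi_coboundary:
  assumes "good q"
  shows "phi q (x + \<alpha>) = phi q x + psi_trunc q x"
  unfolding phi_def psi_trunc_def sum.distrib[symmetric]
proof (rule sum.cong)
  fix k assume k: "k \<in> idx q"
  have gen: "y * (t * e) = y * t + y * (e - 1) * t" for y t e :: complex by (simp add: algebra_simps)
  have "c\<^sub>\<psi> k / (ee k \<alpha> - 1) * (ee k \<alpha> - 1) = c\<^sub>\<psi> k" using ee_alpha_neq_1[OF assms k] by simp
  then show "c\<^sub>\<psi> k / (ee k \<alpha> - 1) * ee k (x + \<alpha>) = c\<^sub>\<psi> k / (ee k \<alpha> - 1) * ee k x + c\<^sub>\<psi> k * ee k x"
    using gen[of "c\<^sub>\<psi> k / (ee k \<alpha> - 1)" "ee k x" "ee k \<alpha>"] by (simp only: ee_add_arg)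
qed simp

definition "T = 2 / (1 - exp (- h))"

lemma T_pos: "T > 0"
  using h_pos by (simp add: T_def)

lemma M_psi_nonneg: "M\<^sub>\<psi> \<ge> 0"
  using order_trans[OF norm_ge_zero psi_decay[of 0]] by simp

lemma M_f_nonneg: "M\<^sub>f \<ge> 0"
  using order_trans[OF norm_ge_zero f_decay[of 0]] by simp

lemma psi_trunc_error: "cmod (of_real (\<psi> x) - psi_trunc q x) \<le> M\<^sub>\<psi> * (T * exp (- h * real q))"
proof -
  have "((\<lambda>x. complex_of_real (\<psi> x)) has_vector_derivative of_real (\<psi>' x)) (at x)" for x
    using psi_deriv[of x] by (auto simp: has_real_derivative_iff_has_vector_derivative
      intro!: bounded_linear.has_vector_derivative[OF bounded_linear_of_real])
  then have lim: "(\<lambda>n. \<Sum>k\<in>{- int n..int n}. c\<^sub>\<psi> k * ee k x) \<longlonglongrightarrow> of_real (\<psi> x)"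
    unfolding c\<^sub>\<psi>_def by (rule fourier_inversion) (simp add: psi_per)
  have "cmod (c\<^sub>\<psi> k) \<le> M\<^sub>\<psi> * exp (- h * \<bar>of_int k\<bar>)" for k
  proof -
    have "M\<^sub>\<psi> * exp (- (2 * h) * \<bar>of_int k\<bar>) \<le> M\<^sub>\<psi> * exp (- h * \<bar>of_int k\<bar>)"
      using h_pos M_psi_nonneg by (intro mult_left_mono) auto
    then show ?thesis using psi_decay[of k] unfolding c\<^sub>\<psi>_def by linarith
  qed
  from fourier_tail[OF lim this h_pos, of q]
  have "cmod (of_real (\<psi> x) - (\<Sum>k | \<bar>k\<bar> < int q. c\<^sub>\<psi> k * ee k x)) \<le> M\<^sub>\<psi> * (T * exp (- h * real q))"
    by (simp only: T_def)
  moreover have "(\<Sum>k | \<bar>k\<bar> < int q. c\<^sub>\<psi> k * ee k x) = psi_trunc q x"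
    unfolding psi_trunc_def
  proof (rule sum.mono_neutral_right)
    show "finite {k::int. \<bar>k\<bar> < int q}" by (rule finite_subset[of _ "{- int q..int q}"]) auto
  qed (auto simp: idx_def c\<^sub>\<psi>_def psi_mean)
  ultimately show ?thesis by simp
qed

lemma u_periodic: "u q (x + 1) = u q x"
  by (simp add: u_def phi_def f_per ee_periodic)

lemma u_has_derivative: "\<exists>D. (u q has_vector_derivative D) (at x)"
proof -
  have p: "(phi q has_vector_derivative (\<Sum>k\<in>idx q. c\<^sub>\<psi> k / (ee k \<alpha> - 1) * (2 * pi * \<i> * of_int k * ee k x))) (at x)"
    unfolding phi_def
    by (intro has_vector_derivative_sum has_vector_derivative_mult_right ee_has_vector_derivative)
  have "((exp \<circ> (\<lambda>x. 2 * pi * \<i> * phi q x)) has_vector_derivative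
      2 * pi * \<i> * (\<Sum>k\<in>idx q. c\<^sub>\<psi> k / (ee k \<alpha> - 1) * (2 * pi * \<i> * of_int k * ee k x)) * exp (2 * pi * \<i> * phi q x)) (at x)"
    by (rule field_vector_diff_chain_at[OF has_vector_derivative_mult_right[OF p] DERIV_exp])
  from has_vector_derivative_mult[OF this f_deriv]
  show ?thesis by (auto simp: u_def[abs_def] o_def)
qed

lemma continuous_u: "continuous_on S (u q)"
  using u_has_derivative by (intro continuous_at_imp_continuous_on ballI) (metis has_vector_derivative_continuous)

lemma norm_u: "cmod (u q x) \<le> B\<^sub>f"
  using f_bound[of x] by (simp only: u_def norm_mult cnj_exp_2pi_real(2)[OF phi_real] mult_1)

lemma fc_u_decay:
  assumes "(\<Sum>k\<in>idx q. cmod (c\<^sub>\<psi> k / (ee k \<alpha> - 1)) * exp (h * \<bar>of_int k\<bar>)) \<le> \<gamma> / (2 * pi) * real q"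
  shows "cmod (fc (u q) k) \<le> M\<^sub>f * exp (\<gamma> * real q - h * \<bar>of_int k\<bar>)"
proof -
  let ?P = "\<Sum>l\<in>idx q. cmod (2 * pi * \<i> * (c\<^sub>\<psi> l / (ee l \<alpha> - 1))) * exp (h * \<bar>of_int l\<bar>)"
  have A: "cmod (fc (\<lambda>x. exp (\<Sum>l\<in>idx q. 2 * pi * \<i> * (c\<^sub>\<psi> l / (ee l \<alpha> - 1)) * ee l x) * f x) k)
      \<le> exp ?P * M\<^sub>f * exp (- h * \<bar>of_int k\<bar>)"
    by (rule fc_exp_mult_decay[OF finite_idx continuous_f _ f_decay refl]) (use h_pos in simp)
  have B: "(\<lambda>x. exp (\<Sum>l\<in>idx q. 2 * pi * \<i> * (c\<^sub>\<psi> l / (ee l \<alpha> - 1)) * ee l x) * f x) = u q"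
    by (simp only: u_def[abs_def] phi_def sum_distrib_left mult.assoc)
  have "?P \<le> \<gamma> * real q"
  proof -
    have n: "cmod (2 * pi * \<i> * w) = 2 * pi * cmod w" for w by (simp add: norm_mult)
    have "?P = 2 * pi * (\<Sum>k\<in>idx q. cmod (c\<^sub>\<psi> k / (ee k \<alpha> - 1)) * exp (h * \<bar>of_int k\<bar>))"
      unfolding sum_distrib_left n by (simp only: mult.assoc)
    also have "\<dots> \<le> 2 * pi * (\<gamma> / (2 * pi) * real q)" by (rule mult_left_mono[OF assms]) simp
    finally show ?thesis by simp
  qed
  then have C: "exp ?P * M\<^sub>f * exp (- h * \<bar>of_int k\<bar>) \<le> exp (\<gamma> * real q) * M\<^sub>f * exp (- h * \<bar>of_int k\<bar>)"
    using M_f_nonneg by (intro mult_right_mono) auto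
  have D: "exp (\<gamma> * real q) * M\<^sub>f * exp (- h * \<bar>of_int k\<bar>) = M\<^sub>f * exp (\<gamma> * real q - h * \<bar>of_int k\<bar>)"
    by (simp add: exp_diff exp_minus field_simps)
  show ?thesis using A[unfolded B] C unfolding D by (rule order_trans)
qed

definition "defect q x = exp (2 * pi * \<i> * (of_real (\<psi> x) - psi_trunc q x))"

lemma defect_real: "cnj (of_real (\<psi> x) - psi_trunc q x) = of_real (\<psi> x) - psi_trunc q x"
  by (simp add: psi_trunc_real)

lemma defect_bound: "cmod (defect q x - 1) \<le> 2 * pi * (M\<^sub>\<psi> * (T * exp (- h * real q)))"
proof -
  let ?r = "of_real (\<psi> x) - psi_trunc q x"
  have "Im ?r = 0" using defect_real[of x q] by (simp add: complex_eq_iff)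
  then have r: "?r = of_real (Re ?r)" by (simp add: complex_eq_iff)
  have "defect q x = cis (2 * pi * Re ?r)" unfolding defect_def by (subst r) (rule exp_2pi_of_real)
  then have "cmod (defect q x - 1) \<le> \<bar>2 * pi * Re ?r\<bar>" using norm_cis_minus_one_le by simp
  also have "\<dots> = 2 * pi * \<bar>Re ?r\<bar>" by (simp add: abs_mult)
  also have "\<dots> \<le> 2 * pi * cmod ?r" by (intro mult_left_mono abs_Re_le_cmod) simp
  also have "\<dots> \<le> 2 * pi * (M\<^sub>\<psi> * (T * exp (- h * real q)))" by (intro mult_left_mono psi_trunc_error) simp
  finally show ?thesis .
qed

text \<open>The coboundary absorbs the truncated part of \<psi>, so the gauge removes the rotation
  up to the tail, which is the factor \<open>defect\<close> close to 1.\<close>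

lemma gauge_forward:
  assumes "good q"
  shows "exp (2 * pi * \<i> * phi q x) * cis (2 * pi * \<psi> x) * f (x + \<alpha>) = defect q x * u q (x + \<alpha>)"
proof -
  have "exp (2 * pi * \<i> * phi q x) * cis (2 * pi * \<psi> x) = exp (2 * pi * \<i> * (phi q x + of_real (\<psi> x)))"
    unfolding exp_2pi_of_real[symmetric] exp_add[symmetric] by (simp only: distrib_left)
  also have "phi q x + of_real (\<psi> x) = (of_real (\<psi> x) - psi_trunc q x) + phi q (x + \<alpha>)"
    by (simp add: phi_coboundary[OF assms])
  also have "exp (2 * pi * \<i> * \<dots>) = defect q x * exp (2 * pi * \<i> * phi q (x + \<alpha>))"
    unfolding defect_def distrib_left exp_add ..
  finally show ?thesis by (simp add: u_def)
qed

text \<open>By \<open>eq2\<close> the second row is the first row at the previous phase, up to the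
  rotation; so \<open>g\<close> becomes a value of \<open>u\<close> too.\<close>

lemma gauge_backward:
  assumes "good q"
  shows "exp (2 * pi * \<i> * phi q x) * g x = cnj (defect q (x - \<alpha>)) * u q (x - \<alpha>)"
proof -
  have e: "exp (2 * pi * \<i> * phi q (x - \<alpha>)) * cis (2 * pi * \<psi> (x - \<alpha>)) * g x
      = defect q (x - \<alpha>) * exp (2 * pi * \<i> * phi q x) * g x"
  proof -
    have "exp (2 * pi * \<i> * phi q (x - \<alpha>)) * cis (2 * pi * \<psi> (x - \<alpha>))
        = exp (2 * pi * \<i> * (phi q (x - \<alpha>) + of_real (\<psi> (x - \<alpha>))))"
      unfolding exp_2pi_of_real[symmetric] exp_add[symmetric] by (simp only: distrib_left)
    also have "phi q (x - \<alpha>) + of_real (\<psi> (x - \<alpha>)) = (of_real (\<psi> (x - \<alpha>)) - psi_trunc q (x - \<alpha>)) + phi q x"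
      using phi_coboundary[OF assms, of "x - \<alpha>"] by simp
    also have "exp (2 * pi * \<i> * \<dots>) = defect q (x - \<alpha>) * exp (2 * pi * \<i> * phi q x)"
      unfolding defect_def distrib_left exp_add ..
    finally show ?thesis by simp
  qed
  have "cnj (defect q (x - \<alpha>)) * defect q (x - \<alpha>) = 1"
    unfolding defect_def by (rule cnj_exp_2pi_real(1)[OF defect_real])
  then have "exp (2 * pi * \<i> * phi q x) * g x = cnj (defect q (x - \<alpha>)) * (defect q (x - \<alpha>) * exp (2 * pi * \<i> * phi q x) * g x)"
    by (simp add: mult.assoc[symmetric])
  also have "\<dots> = cnj (defect q (x - \<alpha>)) * u q (x - \<alpha>)"
    unfolding e[symmetric] u_def using eq2[of "x - \<alpha>"] by (simp add: mult_ac)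
  finally show ?thesis .
qed

text \<open>By the conjugacy, \<open>u\<close> solves
  \<open>u(x + \<alpha>) + u(x - \<alpha>) + v u = E u\<close> up to \<open>err\<close>, and taking
  coefficients gives the dual equation. The index is reversed because products yield
  \<open>k - l\<close> where the dual equation has \<open>n + k\<close>. The constant
  \<open>4 * pi\<close> counts one \<open>defect\<close> bound for each of the two
  neighbours.\<close>

lemma residual_fc_u:
  assumes q: "good q"
  shows "cmod (dual_residual \<alpha> E vh d (\<lambda>n. fc (u q) (- n)) n) \<le> 4 * pi * M\<^sub>\<psi> * T * B\<^sub>f * exp (- h * real q)"
proof -
  let ?v = "\<lambda>x. \<Sum>k\<in>{- int d..int d}. vh k * ee k x"
  define err where "err x = u q (x + \<alpha>) + u q (x + (- \<alpha>)) + ?v x * u q x - of_real E * u q x" for x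
  have cu: "continuous_on {0..1} (\<lambda>x. u q (x + a))" for a
    by (rule continuous_on_compose2[OF continuous_u[of UNIV]]) (auto intro!: continuous_intros)
  have cerr: "continuous_on {0..1} err"
    unfolding err_def by (intro continuous_intros cu continuous_u)
  have err: "err x = (1 - defect q x) * u q (x + \<alpha>) + (1 - cnj (defect q (x - \<alpha>))) * u q (x - \<alpha>)" for x
  proof -
    have "(of_real E - ?v x) * u q x - exp (2 * pi * \<i> * phi q x) * g x
        = exp (2 * pi * \<i> * phi q x) * ((of_real E - ?v x) * f x - g x)"
      unfolding u_def right_diff_distrib by (simp only: mult_ac)
    also have "\<dots> = defect q x * u q (x + \<alpha>)"
      unfolding eq1 gauge_forward[OF q, symmetric] by (simp only: mult.assoc)
    finally have "(of_real E - ?v x) * u q x - exp (2 * pi * \<i> * phi q x) * g x = defect q x * u q (x + \<alpha>)" .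
    then have "(of_real E - ?v x) * u q x = cnj (defect q (x - \<alpha>)) * u q (x - \<alpha>) + defect q x * u q (x + \<alpha>)"
      unfolding gauge_backward[OF q] by (simp add: diff_eq_eq add.commute)
    then show ?thesis by (simp add: err_def algebra_simps)
  qed
  let ?e = "2 * pi * (M\<^sub>\<psi> * (T * exp (- h * real q)))"
  have e0: "?e \<ge> 0" using M_psi_nonneg T_pos by simp
  have "cmod (err x) \<le> ?e * B\<^sub>f + ?e * B\<^sub>f" for x
  proof -
    have "cmod (1 - defect q x) \<le> ?e" using defect_bound[of q x] by (simp add: norm_minus_commute)
    moreover have "cmod (1 - cnj (defect q (x - \<alpha>))) \<le> ?e"
      using defect_bound[of q "x - \<alpha>"] by (metis complex_cnj_diff complex_cnj_one complex_mod_cnj norm_minus_commute)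
    ultimately show ?thesis unfolding err
      using norm_u e0 by (intro order_trans[OF norm_triangle_ineq] add_mono) (auto simp: norm_mult intro!: mult_mono)
  qed
  then have b: "cmod (fc err (- n)) \<le> ?e * B\<^sub>f + ?e * B\<^sub>f" by (intro fc_bound[OF cerr])
  have "fc err k = ee k \<alpha> * fc (u q) k + ee k (- \<alpha>) * fc (u q) k
      + (\<Sum>l\<in>{- int d..int d}. vh l * fc (u q) (k - l)) - of_real E * fc (u q) k" for k
  proof -
    have "fc err k = fc (\<lambda>x. u q (x + \<alpha>)) k + fc (\<lambda>x. u q (x + (- \<alpha>))) k + fc (\<lambda>x. ?v x * u q x) k
        - fc (\<lambda>x. of_real E * u q x) k"
      unfolding err_def
      by (subst fc_diff, (intro continuous_intros cu continuous_u)+, subst fc_add, (intro continuous_intros cu continuous_u)+,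
        subst fc_add, (intro continuous_intros cu continuous_u)+, rule refl)
    then show ?thesis
      by (simp only: fc_shift[OF continuous_u u_periodic] fc_cmult fc_trig_mult[OF finite_atLeastAtMost_int continuous_u])
  qed
  from this[of "- n"]
  have "fc err (- n) = dual_residual \<alpha> E vh d (\<lambda>n. fc (u q) (- n)) n"
  proof -
    have "ee (- n) \<alpha> + ee (- n) (- \<alpha>) = of_real (2 * cos (2 * pi * of_int n * \<alpha>))"
      by (simp add: ee_def complex_eq_iff)
    then have "ee (- n) \<alpha> * fc (u q) (- n) + ee (- n) (- \<alpha>) * fc (u q) (- n)
        = of_real (2 * cos (2 * pi * of_int n * \<alpha>)) * fc (u q) (- n)"
      by (simp only: distrib_right[symmetric])
    moreover have "(\<Sum>l\<in>{- int d..int d}. vh l * fc (u q) (- n - l)) = (\<Sum>l\<in>{- int d..int d}. vh l * fc (u q) (- (n + l)))"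
      by (rule sum.cong) simp_all
    ultimately show ?thesis unfolding \<open>fc err (- n) = _\<close> dual_residual_def
      by (simp add: left_diff_distrib)
  qed
  then show ?thesis using b by (simp add: algebra_simps)
qed

text \<open>\<open>G = a u + b conj(u)\<close> is evaluated at 0 and at - \<alpha>. By
  \<open>gauge_backward\<close> this is nearly a linear system for \<open>a\<close> and
  \<open>b\<close>, up to unimodular factors, whose determinant is the Wronskian \<open>2 i\<close>.
  Its right-hand side is bounded by the Fourier sum of \<open>G\<close> cut at \<open>K\<close> and
  the remaining tail.\<close>

lemma lower_bound:
  assumes q: "good q" and small: "max (cmod (f 0)) (cmod (g 0)) * (cmod (g 0) * (2 * pi * (M\<^sub>\<psi> * (T * exp (- h * real q))))) \<le> 1 / 2"
    and dec: "\<And>k. cmod (fc (u q) k) \<le> M\<^sub>f * exp (\<gamma> * real q - h * \<bar>of_int k\<bar>)"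
  shows "cmod a + cmod b \<le> 4 * max (cmod (f 0)) (cmod (g 0)) *
    ((\<Sum>k | \<bar>k\<bar> < int K. cmod (a * fc (u q) (- k) + b * cnj (fc (u q) k)))
      + (cmod a + cmod b) * (M\<^sub>f * T * exp (\<gamma> * real q - h * real K)))"
proof -
  let ?m = "max (cmod (f 0)) (cmod (g 0))" and ?S = "cmod a + cmod b"
  let ?r = "2 * pi * (M\<^sub>\<psi> * (T * exp (- h * real q)))"
  define G where "G x = a * u q x + b * cnj (u q x)" for x
  have "\<forall>x. \<exists>D. (u q has_vector_derivative D) (at x)" using u_has_derivative by blast
  then obtain u' where u': "\<And>x. (u q has_vector_derivative u' x) (at x)" by metis
  have Gd: "(G has_vector_derivative a * u' x + b * cnj (u' x)) (at x)" for x
    unfolding G_def using bounded_linear.has_vector_derivative[OF bounded_linear_cnj u']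
    by (intro has_vector_derivative_add has_vector_derivative_mult_right u')
  have fG: "fc G k = a * fc (u q) k + b * cnj (fc (u q) (- k))" for k
    unfolding G_def
    by (subst fc_add) (auto intro!: continuous_intros continuous_u simp: fc_cmult fc_cnj)
  have fGb: "cmod (fc G k) \<le> ?S * M\<^sub>f * exp (\<gamma> * real q) * exp (- h * \<bar>of_int k\<bar>)" for k
  proof -
    have "cmod (fc G k) \<le> cmod a * cmod (fc (u q) k) + cmod b * cmod (fc (u q) (- k))"
      unfolding fG by (rule order_trans[OF norm_triangle_ineq]) (simp add: norm_mult)
    also have "\<dots> \<le> cmod a * (M\<^sub>f * exp (\<gamma> * real q - h * \<bar>of_int k\<bar>)) + cmod b * (M\<^sub>f * exp (\<gamma> * real q - h * \<bar>of_int k\<bar>))"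
      using dec[of k] dec[of "- k"] by (intro add_mono mult_left_mono) auto
    also have "\<dots> = ?S * M\<^sub>f * exp (\<gamma> * real q) * exp (- h * \<bar>of_int k\<bar>)"
      by (simp add: exp_diff exp_minus field_simps)
    finally show ?thesis .
  qed
  let ?W = "(\<Sum>k | \<bar>k\<bar> < int K. cmod (a * fc (u q) (- k) + b * cnj (fc (u q) k)))
      + ?S * (M\<^sub>f * T * exp (\<gamma> * real q - h * real K))"
  have GW: "cmod (G x) \<le> ?W" for x
  proof -
    have lim: "(\<lambda>n. \<Sum>k\<in>{- int n..int n}. fc G k * ee k x) \<longlonglongrightarrow> G x"
      by (rule fourier_inversion[OF Gd]) (simp add: G_def u_periodic)
    have "cmod (G x) \<le> cmod (\<Sum>k | \<bar>k\<bar> < int K. fc G k * ee k x) + cmod (G x - (\<Sum>k | \<bar>k\<bar> < int K. fc G k * ee k x))"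
      by (metis add.commute norm_triangle_sub)
    also have "cmod (G x - (\<Sum>k | \<bar>k\<bar> < int K. fc G k * ee k x)) \<le> ?S * M\<^sub>f * exp (\<gamma> * real q) * (T * exp (- h * real K))"
      unfolding T_def by (rule fourier_tail[OF lim fGb h_pos])
    also have "\<dots> = ?S * (M\<^sub>f * T * exp (\<gamma> * real q - h * real K))"
      by (simp add: exp_diff exp_minus field_simps)
    also have "cmod (\<Sum>k | \<bar>k\<bar> < int K. fc G k * ee k x) \<le> (\<Sum>k | \<bar>k\<bar> < int K. cmod (fc G k))"
      by (rule order_trans[OF norm_sum]) (simp add: norm_mult)
    also have "\<dots> = (\<Sum>k | \<bar>k\<bar> < int K. cmod (a * fc (u q) (- k) + b * cnj (fc (u q) k)))"
      unfolding fG by (rule sum.reindex_bij_witness[of _ uminus uminus]) auto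
    finally show ?thesis by simp
  qed
  \<comment> \<open>The gauge factor at phase 0; being unimodular, it can be moved into the
    coefficients.\<close>
  define \<theta> where "\<theta> = exp (2 * pi * \<i> * phi q 0)"
  have \<theta>: "cmod \<theta> = 1" unfolding \<theta>_def by (rule cnj_exp_2pi_real(2)[OF phi_real])
  define a' b' where "a' = a * \<theta>" and "b' = b * cnj \<theta>"
  have ab: "cmod a' = cmod a" "cmod b' = cmod b" by (simp_all add: a'_def b'_def norm_mult \<theta>)
  define G1 where "G1 = a' * g 0 + b' * cnj (g 0)"
  have G0: "G 0 = a' * f 0 + b' * cnj (f 0)" by (simp add: G_def u_def a'_def b'_def \<theta>_def)
  have "cmod (u q (- \<alpha>) - \<theta> * g 0) \<le> ?r * cmod (g 0)"
  proof -
    have c1: "cnj (defect q (- \<alpha>)) * defect q (- \<alpha>) = 1"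
      unfolding defect_def by (rule cnj_exp_2pi_real(1)[OF defect_real])
    have "\<theta> * g 0 = cnj (defect q (- \<alpha>)) * u q (- \<alpha>)"
      using gauge_backward[OF q, of 0] by (simp add: \<theta>_def)
    then have "defect q (- \<alpha>) * (\<theta> * g 0) = (cnj (defect q (- \<alpha>)) * defect q (- \<alpha>)) * u q (- \<alpha>)"
      by (simp only: mult_ac)
    then have "u q (- \<alpha>) - \<theta> * g 0 = (defect q (- \<alpha>) - 1) * (\<theta> * g 0)"
      unfolding c1 by (simp add: algebra_simps)
    then have "cmod (u q (- \<alpha>) - \<theta> * g 0) = cmod (defect q (- \<alpha>) - 1) * cmod (g 0)"
      by (simp only: norm_mult \<theta> mult_1)
    then show ?thesis using mult_right_mono[OF defect_bound[of q "- \<alpha>"], of "cmod (g 0)"] by simp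
  qed
  moreover have "G (- \<alpha>) - G1 = a * (u q (- \<alpha>) - \<theta> * g 0) + b * cnj (u q (- \<alpha>) - \<theta> * g 0)"
    by (simp add: G_def G1_def a'_def b'_def algebra_simps)
  then have "cmod (G (- \<alpha>) - G1) \<le> ?S * cmod (u q (- \<alpha>) - \<theta> * g 0)"
    by (simp only:) (rule order_trans[OF norm_triangle_ineq],
      simp add: norm_mult distrib_right del: complex_cnj_diff complex_cnj_mult)
  ultimately have "cmod (G (- \<alpha>) - G1) \<le> ?S * (?r * cmod (g 0))"
    by (meson add_nonneg_nonneg mult_left_mono norm_ge_zero order_trans)
  then have G1: "cmod G1 \<le> cmod (G (- \<alpha>)) + ?S * (?r * cmod (g 0))"
    using norm_triangle_ineq2[of G1 "G (- \<alpha>)"] by (simp add: norm_minus_commute)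
  have "G 0 * cnj (g 0) - G1 * cnj (f 0) = a' * (f 0 * cnj (g 0) - cnj (f 0) * g 0)"
    by (simp add: G0 G1_def algebra_simps)
  then have A: "2 * \<i> * a' = G 0 * cnj (g 0) - G1 * cnj (f 0)" unfolding wronski by simp
  have "G 0 * g 0 - G1 * f 0 = - b' * (f 0 * cnj (g 0) - cnj (f 0) * g 0)"
    by (simp add: G0 G1_def algebra_simps)
  then have B: "2 * \<i> * b' = - (G 0 * g 0 - G1 * f 0)" unfolding wronski by simp
  have tri: "cmod (x - y) \<le> ?m * (cmod (G 0) + cmod G1)"
    if "cmod x = cmod (G 0) * cmod (g 0)" "cmod y = cmod G1 * cmod (f 0)" for x y
  proof -
    have "cmod (x - y) \<le> cmod (G 0) * cmod (g 0) + cmod G1 * cmod (f 0)"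
      using norm_triangle_ineq4[of x y] that by simp
    also have "\<dots> \<le> cmod (G 0) * ?m + cmod G1 * ?m" by (intro add_mono mult_left_mono) auto
    finally show ?thesis by (simp add: algebra_simps)
  qed
  have "2 * cmod a = cmod (G 0 * cnj (g 0) - G1 * cnj (f 0))"
    unfolding A[symmetric] by (simp add: norm_mult ab)
  also have "\<dots> \<le> ?m * (cmod (G 0) + cmod G1)" by (rule tri) (simp_all add: norm_mult)
  finally have a2: "2 * cmod a \<le> ?m * (cmod (G 0) + cmod G1)" .
  have "2 * cmod b = cmod (2 * \<i> * b')" by (simp add: norm_mult ab)
  also have "\<dots> = cmod (G 0 * g 0 - G1 * f 0)" unfolding B norm_minus_cancel ..
  also have "\<dots> \<le> ?m * (cmod (G 0) + cmod G1)" by (rule tri) (simp_all add: norm_mult)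
  finally have "?S \<le> ?m * (cmod (G 0) + cmod G1)" using a2 by simp
  also have "\<dots> \<le> ?m * (?W + (?W + ?S * (?r * cmod (g 0))))"
  proof (rule mult_left_mono)
    show "cmod (G 0) + cmod G1 \<le> ?W + (?W + ?S * (?r * cmod (g 0)))"
      using GW[of 0] GW[of "- \<alpha>"] G1 by linarith
  qed (simp add: le_max_iff_disj)
  also have "\<dots> = 2 * ?m * ?W + ?S * (?m * (cmod (g 0) * ?r))" by (simp add: algebra_simps)
  \<comment> \<open>Replacing \<open>u (- \<alpha>)\<close> by \<open>\<theta> * g 0\<close> costs
    at most half of the left-hand side; absorbing it doubles the constant to 4.\<close>
  also have "\<dots> \<le> 2 * ?m * ?W + ?S * (1 / 2)"
    by (intro add_left_mono mult_left_mono small) simp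
  finally have "?S \<le> 2 * ?m * ?W + ?S * (1 / 2)" .
  moreover have "s \<le> 4 * m * w" if "s \<le> 2 * m * w + s * (1 / 2)" for s m w :: real
    using that by simp
  ultimately show ?thesis by blast
qed

end

section \<open>Windows of approximate solutions\<close>

text \<open>The interface between the two halves of the proof, free of \<open>B\<close> and \<psi>.
  The constants \<open>h\<close> and \<open>M\<close> precede \<gamma> and \<open>q\<close>, so the
  loss rate \<gamma> may be chosen after the decay rate \<open>h\<close>. The last clause is
  independence, measured on the sites below distance \<open>K\<close>.\<close>

definition approx_dual_solutions ::
    "real \<Rightarrow> real \<Rightarrow> (int \<Rightarrow> complex) \<Rightarrow> nat \<Rightarrow> real \<Rightarrow> real \<Rightarrow> bool" where
  "approx_dual_solutions \<alpha> E vh d h M \<longleftrightarrow> (\<forall>\<gamma>>0. \<forall>Q::nat. \<exists>q>Q. \<exists>z z'.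
    (\<forall>n. cmod (z n) \<le> M * exp (\<gamma> * real q - h * \<bar>of_int n\<bar>)) \<and>
    (\<forall>n. cmod (z' n) \<le> M * exp (\<gamma> * real q - h * \<bar>of_int n\<bar>)) \<and>
    (\<forall>n. cmod (dual_residual \<alpha> E vh d z n) \<le> M * exp (- h * real q)) \<and>
    (\<forall>n. cmod (dual_residual \<alpha> E vh d z' n) \<le> M * exp (- h * real q)) \<and>
    (\<forall>a b. \<forall>K::nat. cmod a + cmod b \<le> M * ((\<Sum>k | \<bar>k\<bar> < int K. cmod (a * z k + b * z' k))
      + (cmod a + cmod b) * exp (\<gamma> * real q - h * real K))))"

context rotation_reducible begin

lemma approximate_solutions:
  "\<exists>M>0. approx_dual_solutions \<alpha> E vh d h M"
proof -
  define m where "m = max (cmod (f 0)) (cmod (g 0))"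
  define M where "M = 1 + M\<^sub>f + \<bar>4 * pi * M\<^sub>\<psi> * T * B\<^sub>f\<bar> + 4 * m * (1 + M\<^sub>f * T)"
  have m0: "m \<ge> 0" by (simp add: m_def le_max_iff_disj)
  have MfT: "M\<^sub>f * T \<ge> 0" using M_f_nonneg T_pos by simp
  have mm: "0 \<le> 4 * m * (1 + M\<^sub>f * T)" using m0 MfT by simp
  have M: "M > 0" "M\<^sub>f \<le> M" "4 * pi * M\<^sub>\<psi> * T * B\<^sub>f \<le> M" "4 * m * (1 + M\<^sub>f * T) \<le> M"
    using mm M_f_nonneg unfolding M_def by linarith+
  have "\<exists>q>Q. \<exists>z z'.
    (\<forall>n. cmod (z n) \<le> M * exp (\<gamma> * real q - h * \<bar>of_int n\<bar>)) \<and>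
    (\<forall>n. cmod (z' n) \<le> M * exp (\<gamma> * real q - h * \<bar>of_int n\<bar>)) \<and>
    (\<forall>n. cmod (dual_residual \<alpha> E vh d z n) \<le> M * exp (- h * real q)) \<and>
    (\<forall>n. cmod (dual_residual \<alpha> E vh d z' n) \<le> M * exp (- h * real q)) \<and>
    (\<forall>a b. \<forall>K::nat. cmod a + cmod b \<le> M * ((\<Sum>k | \<bar>k\<bar> < int K. cmod (a * z k + b * z' k))
      + (cmod a + cmod b) * exp (\<gamma> * real q - h * real K)))"
    if \<gamma>: "\<gamma> > 0" for \<gamma> and Q :: nat
  proof -
    have g2: "\<gamma> / (2 * pi) > 0" using \<gamma> by simp
    have psi: "cmod (c\<^sub>\<psi> k) \<le> M\<^sub>\<psi> * exp (- (2 * h) * \<bar>of_int k\<bar>)" for k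
      unfolding c\<^sub>\<psi>_def by (rule psi_decay)
    obtain Q1 where Q1: "\<And>q. Q1 < q \<Longrightarrow> good q \<Longrightarrow>
        (\<Sum>k\<in>idx q. cmod (c\<^sub>\<psi> k / (ee k \<alpha> - 1)) * exp (h * \<bar>of_int k\<bar>)) \<le> \<gamma> / (2 * pi) * real q"
      using coboundary_weight_bound[OF h_pos psi g2, of \<alpha>] unfolding idx_def good_def by blast
    define c where "c = m * (cmod (g 0) * (2 * pi * (M\<^sub>\<psi> * T)))"
    \<comment> \<open>Beyond \<open>Q2\<close> the truncation error is small enough for
      \<open>lower_bound\<close>, because \<open>exp x >= x\<close>.\<close>
    obtain Q2 :: nat where Q2: "2 * c / h < real Q2" using reals_Archimedean2 by blast
    obtain q where q: "q > max Q (max Q1 Q2)" "good q"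
      using small_divisor_bound[OF irr, of "max Q (max Q1 Q2)"] unfolding good_def by blast
    have small: "m * (cmod (g 0) * (2 * pi * (M\<^sub>\<psi> * (T * exp (- h * real q))))) \<le> 1 / 2"
    proof -
      have "2 * c / h < real q" using Q2 q(1) by linarith
      then have "2 * c \<le> h * real q" using h_pos by (simp add: field_simps)
      also have "\<dots> \<le> exp (h * real q)" using exp_ge_add_one_self[of "h * real q"] by linarith
      finally have "c * exp (- h * real q) \<le> 1 / 2" by (simp add: exp_minus field_simps)
      then show ?thesis by (simp add: c_def mult_ac)
    qed
    have dec: "cmod (fc (u q) k) \<le> M\<^sub>f * exp (\<gamma> * real q - h * \<bar>of_int k\<bar>)" for k
      by (rule fc_u_decay[OF Q1[OF _ q(2)]]) (use q(1) in simp)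
    have dec': "cmod (fc (u q) k) \<le> M * exp (\<gamma> * real q - h * \<bar>of_int k\<bar>)" for k
      using dec[of k] M(2) by (meson exp_ge_zero mult_right_mono order_trans)
    define z where "z n = fc (u q) (- n)" for n
    \<comment> \<open>These are the coefficients of the conjugate of \<open>u\<close>, in the same
      reversed order.\<close>
    define z' where "z' n = cnj (fc (u q) n)" for n
    have z'z: "z' = (\<lambda>n. cnj (z (- n)))" by (simp add: z_def z'_def fun_eq_iff)
    have res: "cmod (dual_residual \<alpha> E vh d z n) \<le> M * exp (- h * real q)" for n
    proof -
      have "cmod (dual_residual \<alpha> E vh d z n) \<le> 4 * pi * M\<^sub>\<psi> * T * B\<^sub>f * exp (- h * real q)"
        unfolding z_def by (rule residual_fc_u[OF q(2)])
      also have "\<dots> \<le> M * exp (- h * real q)" by (intro mult_right_mono M) simp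
      finally show ?thesis .
    qed
    have res': "cmod (dual_residual \<alpha> E vh d z' n) \<le> M * exp (- h * real q)" for n
    proof -
      have "dual_residual \<alpha> E vh d z' n = cnj (dual_residual \<alpha> E vh d z (- n))"
        unfolding z'z by (rule dual_residual_cnj_reflect) (rule sym)
      then show ?thesis using res[of "- n"] by simp
    qed
    have low: "cmod a + cmod b \<le> M * ((\<Sum>k | \<bar>k\<bar> < int K. cmod (a * z k + b * z' k))
      + (cmod a + cmod b) * exp (\<gamma> * real q - h * real K))" for a b and K :: nat
    proof -
      let ?s = "\<Sum>k | \<bar>k\<bar> < int K. cmod (a * z k + b * z' k)" and ?e = "exp (\<gamma> * real q - h * real K)"
      let ?S = "cmod a + cmod b"
      have "?S \<le> 4 * m * (?s + ?S * (M\<^sub>f * T * ?e))"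
        using lower_bound[OF q(2) small[unfolded m_def] dec, of a b K] unfolding m_def z_def z'_def .
      also have "\<dots> \<le> 4 * m * ((1 + M\<^sub>f * T) * (?s + ?S * ?e))"
      proof (rule mult_left_mono)
        have "0 \<le> M\<^sub>f * T * ?s" by (rule mult_nonneg_nonneg[OF MfT sum_nonneg]) simp
        moreover have "0 \<le> ?S * ?e" by simp
        ultimately have "0 \<le> M\<^sub>f * T * ?s + ?S * ?e" by (rule add_nonneg_nonneg)
        then show "?s + ?S * (M\<^sub>f * T * ?e) \<le> (1 + M\<^sub>f * T) * (?s + ?S * ?e)" by (simp add: algebra_simps)
      qed (use m0 in simp)
      also have "\<dots> = 4 * m * (1 + M\<^sub>f * T) * (?s + ?S * ?e)" by (simp only: mult.assoc)
      also have "\<dots> \<le> M * (?s + ?S * ?e)"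
        by (intro mult_right_mono M(4) add_nonneg_nonneg mult_nonneg_nonneg sum_nonneg) auto
      finally show ?thesis .
    qed
    have "cmod (z n) \<le> M * exp (\<gamma> * real q - h * \<bar>of_int n\<bar>)" "cmod (z' n) \<le> M * exp (\<gamma> * real q - h * \<bar>of_int n\<bar>)" for n
      using dec'[of n] dec'[of "- n"] by (simp_all add: z_def z'_def)
    then show ?thesis using q(1) res res' low by (intro exI[of _ q] exI[of _ z] exI[of _ z'] conjI allI) auto
  qed
  then show ?thesis unfolding approx_dual_solutions_def using M(1) by blast
qed

end

text \<open>The sites descend from \<open>n + d - 1\<close> to \<open>n - d\<close>, since
  \<open>dualL\<close> writes the new, highest site into entry 0.\<close>

definition window :: "nat \<Rightarrow> (int \<Rightarrow> complex) \<Rightarrow> int \<Rightarrow> complex vec" where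
  "window d z n = Matrix.vec (2 * d) (\<lambda>i. z (n + int d - 1 - int i))"

lemma window_carrier [simp]: "window d z n \<in> carrier_vec (2 * d)"
  by (simp add: window_def)

lemma cvnorm_window_le:
  assumes "\<And>j. n - int d \<le> j \<Longrightarrow> j < n + int d \<Longrightarrow> cmod (z j) \<le> B"
  shows "cvnorm (window d z n) \<le> 2 * real d * B"
proof -
  have "cvnorm (window d z n) \<le> (\<Sum>i<2 * d. cmod (z (n + int d - 1 - int i)))"
    using cvnorm_le_sum[of "window d z n"] by (simp add: window_def)
  also have "\<dots> \<le> (\<Sum>i<2 * d. B)" by (intro sum_mono assms) auto
  finally show ?thesis by simp
qed

lemma cmod_le_cvnorm_window:
  assumes "n - int d \<le> j" "j < n + int d"
  shows "cmod (z j) \<le> cvnorm (window d z n)"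
  using cmod_index_le_cvnorm[of "nat (n + int d - 1 - j)" "window d z n"] assms
  by (simp add: window_def)

lemma window_lincomb:
  "window d (\<lambda>n. a * z n + b * z' n) n = a \<cdot>\<^sub>v window d z n + b \<cdot>\<^sub>v window d z' n"
  by (intro eq_vecI) (simp_all add: window_def)

text \<open>All other entries are merely shifted, so the whole error sits in the new site, for which
  the equation is solved by dividing by \<open>vh d\<close>.\<close>

lemma window_step:
  assumes d: "d \<ge> 1" "vh (int d) \<noteq> 0"
  shows "cvnorm (window d z (n + 1) - dualL E vh d (of_int n * \<alpha>) *\<^sub>v window d z n)
    \<le> cmod (dual_residual \<alpha> E vh d z n) / cmod (vh (int d))"
proof -
  let ?A = "dualL E vh d (of_int n * \<alpha>)" and ?w = "window d z n"
  let ?e = "complex_of_real (E - 2 * cos (2 * pi * (of_int n * \<alpha>)))"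
  let ?D = "window d z (n + 1) - ?A *\<^sub>v ?w"
  have Aw: "dim_vec (?A *\<^sub>v ?w) = 2 * d" by (simp add: dualL_def)
  have rest: "vec_index ?D i = 0" if i: "i < 2 * d" "i \<noteq> 0" for i
  proof -
    obtain j where j: "i = j + 1" using i by (metis Suc_eq_plus1 not0_implies_Suc)
    have "vec_index (?A *\<^sub>v ?w) (j + 1) = vec_index ?w j"
      by (rule dualL_index(1)[where vh=vh, OF window_carrier d]) (use i j in simp)
    moreover have "vec_index ?D i = vec_index (window d z (n + 1)) i - vec_index (?A *\<^sub>v ?w) i"
      using i Aw by (simp del: index_mult_mat_vec)
    moreover have "n + int d - (1 + int j) = n + int d - 1 - int j" by simp
    ultimately show ?thesis using i j by (simp add: window_def)
  qed
  have "vh (int d) * vec_index (?A *\<^sub>v ?w) 0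
      = (\<Sum>j<2 * d. (of_bool (j + 1 = d) * ?e - vh (int d - 1 - int j)) * vec_index ?w j)"
    by (rule dualL_index(2)[where vh=vh, OF window_carrier d])
  also have "\<dots> = (\<Sum>j<2 * d. if j = d - 1 then ?e * vec_index ?w (d - 1) else 0)
      - (\<Sum>j<2 * d. vh (int d - 1 - int j) * vec_index ?w j)"
    unfolding sum_subtractf[symmetric] using d(1) by (intro sum.cong) (auto simp: algebra_simps)
  also have "(\<Sum>j<2 * d. if j = d - 1 then ?e * vec_index ?w (d - 1) else 0) = ?e * vec_index ?w (d - 1)"
  proof -
    have "d - 1 < 2 * d" using d(1) by linarith
    then show ?thesis by simp
  qed
  also have "vec_index ?w (d - 1) = z n"
  proof -
    have "n + int d - 1 - int (d - 1) = n" "d - 1 < 2 * d" using d(1) by linarith+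
    then show ?thesis by (simp only: window_def index_vec)
  qed
  also have "(\<Sum>j<2 * d. vh (int d - 1 - int j) * vec_index ?w j) = (\<Sum>k\<in>{- int d..<int d}. vh k * z (n + k))"
    by (rule sum.reindex_bij_witness[of _ "\<lambda>s. nat (int d - 1 - s)" "\<lambda>i. int d - 1 - int i"])
      (auto simp: window_def algebra_simps)
  finally have a0: "vh (int d) * vec_index (?A *\<^sub>v ?w) 0 = ?e * z n - (\<Sum>k\<in>{- int d..<int d}. vh k * z (n + k))" .
  have "{- int d..int d} = insert (int d) {- int d..<int d}" by auto
  then have "dual_residual \<alpha> E vh d z n = vh (int d) * z (n + int d) + (\<Sum>k\<in>{- int d..<int d}. vh k * z (n + k)) - ?e * z n"
    by (simp add: dual_residual_def left_diff_distrib mult.assoc)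
  also have "\<dots> = vh (int d) * (z (n + int d) - vec_index (?A *\<^sub>v ?w) 0)"
    unfolding right_diff_distrib a0 by simp
  finally have r: "vec_index ?D 0 = dual_residual \<alpha> E vh d z n / vh (int d)"
    using d Aw by (simp add: window_def field_simps del: index_mult_mat_vec)
  have "cvnorm ?D \<le> (\<Sum>i<2 * d. cmod (vec_index ?D i))"
    using cvnorm_le_sum[of ?D] Aw by simp
  also have "\<dots> = (\<Sum>i<2 * d. if i = 0 then cmod (vec_index ?D 0) else 0)"
    by (intro sum.cong) (auto simp: rest simp del: index_minus_vec)
  also have "\<dots> = cmod (vec_index ?D 0)" using d(1) by simp
  finally show ?thesis unfolding r by (simp add: norm_divide)
qed

lemma dualL_entry_sum_bound:
  "\<exists>L. \<forall>\<theta>. entry_sum (dualL E vh d \<theta>) \<le> L"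
proof -
  define b where "b = 1 + (\<bar>E\<bar> + 2 + (\<Sum>k\<in>{- int d..int d}. cmod (vh k))) / cmod (vh (int d))"
  have V: "cmod (vh k) \<le> (\<Sum>k\<in>{- int d..int d}. cmod (vh k))" if "- int d \<le> k" "k \<le> int d" for k
    using that by (intro member_le_sum) auto
  have "cmod (dualL E vh d \<theta> $$ (i, j)) \<le> b" if ij: "i < 2 * d" "j < 2 * d" for \<theta> i j
  proof (cases "i = 0")
    case True
    let ?s = "\<Sum>k\<in>{- int d..int d}. cmod (vh k)"
    have s0: "0 \<le> ?s" by (simp add: sum_nonneg)
    have c: "\<bar>2 * cos (2 * pi * \<theta>)\<bar> \<le> 2" using abs_cos_le_one[of "2 * pi * \<theta>"] by (simp add: abs_mult)
    have "cmod (if j + 1 = d then of_real E - of_real (2 * cos (2 * pi * \<theta>)) - vh 0 else - vh (int d - 1 - int j))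
        \<le> \<bar>E\<bar> + 2 + ?s"
    proof (cases "j + 1 = d")
      case True
      have "cmod (of_real E - of_real (2 * cos (2 * pi * \<theta>)) - vh 0) \<le> \<bar>E - 2 * cos (2 * pi * \<theta>)\<bar> + cmod (vh 0)"
        unfolding of_real_diff[symmetric] using norm_triangle_ineq4[of "of_real (E - 2 * cos (2 * pi * \<theta>))" "vh 0"]
        by (simp only: norm_of_real)
      then show ?thesis using True c V[of 0] by simp
    next
      case False
      then show ?thesis using V[of "int d - 1 - int j"] ij by simp
    qed
    then have "cmod (dualL E vh d \<theta> $$ (i, j)) \<le> (\<bar>E\<bar> + 2 + ?s) / cmod (vh (int d))"
      using True ij by (simp only: dualL_def index_mat case_prod_conv if_True norm_divide refl) (intro divide_right_mono, auto)
    then show ?thesis by (simp add: b_def)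
  next
    case False
    have "0 \<le> (\<bar>E\<bar> + 2 + (\<Sum>k\<in>{- int d..int d}. cmod (vh k))) / cmod (vh (int d))"
      by (intro divide_nonneg_nonneg add_nonneg_nonneg sum_nonneg) auto
    then show ?thesis using False ij by (auto simp: dualL_def b_def)
  qed
  then have "entry_sum (dualL E vh d \<theta>) \<le> (\<Sum>i<2 * d. \<Sum>j<2 * d. b)" for \<theta>
    unfolding entry_sum_def by (simp only: dualL_def dim_row_mat dim_col_mat) (intro sum_mono, auto)
  then show ?thesis by blast
qed

text \<open>Each step multiplies the old error by at most \<open>L\<close> and adds a new one; the
  base \<open>L + 1\<close> absorbs the addition.\<close>

lemma window_error:
  assumes d: "d \<ge> 1" "vh (int d) \<noteq> 0" and L: "\<And>\<theta>. entry_sum (dualL E vh d \<theta>) \<le> L"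
    and res: "\<And>n. cmod (dual_residual \<alpha> E vh d z n) \<le> \<epsilon>"
  shows "cvnorm (window d z (s + int n) - cociter (2 * d) \<alpha> (dualL E vh d) n (of_int s * \<alpha>) *\<^sub>v window d z s)
    \<le> \<epsilon> / cmod (vh (int d)) * (L + 1) ^ n"
proof (induction n)
  case 0
  have "\<epsilon> \<ge> 0" using order_trans[OF norm_ge_zero res] .
  then have e0: "0 \<le> \<epsilon> / cmod (vh (int d)) * (L + 1) ^ 0" by simp
  have "cociter (2 * d) \<alpha> (dualL E vh d) 0 (of_int s * \<alpha>) *\<^sub>v window d z s = window d z s"
    using one_mult_mat_vec[OF window_carrier] by simp
  moreover have "window d z (s + int 0) - window d z s = 0\<^sub>v (2 * d)"
    by (intro eq_vecI) (auto simp: window_def)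
  ultimately show ?case using e0 by (simp only: cvnorm_zero)
next
  case (Suc n)
  let ?An = "cociter (2 * d) \<alpha> (dualL E vh d) n (of_int s * \<alpha>)"
  let ?A = "dualL E vh d (of_int (s + int n) * \<alpha>)"
  let ?e = "\<epsilon> / cmod (vh (int d))"
  have e0: "?e \<ge> 0" using order_trans[OF norm_ge_zero res] by simp
  have L0: "L \<ge> 0" using order_trans[OF entry_sum_nonneg L] .
  have c: "?An \<in> carrier_mat (2 * d) (2 * d)" by (rule cociter_carrier) simp
  let ?x = "?An *\<^sub>v window d z s" and ?w = "window d z (s + int n)" and ?w1 = "window d z (s + int n + 1)"
  have xc: "?x \<in> carrier_vec (2 * d)" by (rule mult_mat_vec_carrier[OF c window_carrier])
  have Ax: "?A *\<^sub>v ?x \<in> carrier_vec (2 * d)" and Aw: "?A *\<^sub>v ?w \<in> carrier_vec (2 * d)"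
    by (rule mult_mat_vec_carrier[OF dualL_carrier xc], rule mult_mat_vec_carrier[OF dualL_carrier window_carrier])
  have "of_int s * \<alpha> + real n * \<alpha> = of_int (s + int n) * \<alpha>" by (simp add: algebra_simps)
  then have "cociter (2 * d) \<alpha> (dualL E vh d) (Suc n) (of_int s * \<alpha>) *\<^sub>v window d z s = ?A *\<^sub>v ?x"
    using assoc_mult_mat_vec[OF dualL_carrier c window_carrier] by simp
  moreover have "window d z (s + int (Suc n)) = ?w1" by (simp add: algebra_simps)
  moreover have "?w1 - ?A *\<^sub>v ?x = (?w1 - ?A *\<^sub>v ?w) + ?A *\<^sub>v (?w - ?x)"
    unfolding mult_minus_distrib_mat_vec[OF dualL_carrier window_carrier xc]
    using carrier_vecD[OF Ax] carrier_vecD[OF Aw] carrier_vecD[OF window_carrier[of d z "s + int n + 1"]]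
    by (intro eq_vecI) (simp_all del: index_mult_mat_vec dim_mult_mat_vec)
  moreover have "cvnorm ((?w1 - ?A *\<^sub>v ?w) + ?A *\<^sub>v (?w - ?x)) \<le> ?e * (L + 1) ^ Suc n"
  proof -
    have wx: "?w - ?x \<in> carrier_vec (2 * d)" by (rule minus_carrier_vec[OF window_carrier xc])
    have "cvnorm ((?w1 - ?A *\<^sub>v ?w) + ?A *\<^sub>v (?w - ?x)) \<le> cvnorm (?w1 - ?A *\<^sub>v ?w) + cvnorm (?A *\<^sub>v (?w - ?x))"
      by (rule cvnorm_add[OF minus_carrier_vec[OF window_carrier Aw] mult_mat_vec_carrier[OF dualL_carrier wx]])
    also have "cvnorm (?w1 - ?A *\<^sub>v ?w) \<le> cmod (dual_residual \<alpha> E vh d z (s + int n)) / cmod (vh (int d))"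
      by (rule window_step[where vh=vh and E=E, OF d])
    also have "\<dots> \<le> ?e" by (intro divide_right_mono res) simp
    also have "cvnorm (?A *\<^sub>v (?w - ?x)) \<le> entry_sum ?A * cvnorm (?w - ?x)"
      by (rule cvnorm_mult_mat_vec[OF dualL_carrier wx])
    also have "\<dots> \<le> L * (?e * (L + 1) ^ n)"
      using L0 by (intro mult_mono L Suc) auto
    also have "?e + L * (?e * (L + 1) ^ n) \<le> ?e * (L + 1) ^ n + L * (?e * (L + 1) ^ n)"
      using e0 L0 mult_left_mono[OF one_le_power[of "L + 1" n] e0] by simp
    also have "\<dots> = ?e * (L + 1) ^ Suc n" by (simp add: algebra_simps)
    finally show ?thesis by simp
  qed
  ultimately show ?case by (simp only:)
qed

section \<open>Recovering a solution from one window\<close>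

text \<open>Solving the equation for its highest site bounds that site by the \<open>2 * d\<close>
  sites below it and the residual. The 3 in the constant is 1 for the residual and 2 for the
  cosine.\<close>

lemma propagate_forward:
  assumes d: "d \<ge> 1" "vh (int d) \<noteq> 0"
    and res: "\<And>n. cmod (dual_residual \<alpha> E vh d z n) \<le> \<epsilon>" and D: "\<epsilon> \<le> D"
    and base: "\<And>j. - int d \<le> j \<Longrightarrow> j < int d \<Longrightarrow> cmod (z j) \<le> D"
    and L: "L \<ge> 1" "3 + (\<Sum>k\<in>{- int d..int d}. cmod (vh k)) + \<bar>E\<bar> \<le> L * cmod (vh (int d))"
  shows "cmod (z (int i - int d)) \<le> L ^ i * D"
proof (induction i rule: less_induct)
  case (less i)
  have D0: "D \<ge> 0" using order_trans[OF order_trans[OF norm_ge_zero res] D] .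
  show ?case
  proof (cases "i < 2 * d")
    case True
    have "cmod (z (int i - int d)) \<le> 1 * D" using base True by simp
    also have "\<dots> \<le> L ^ i * D" by (intro mult_right_mono one_le_power L(1) D0)
    finally show ?thesis .
  next
    case False
    then have i0: "i > 0" using d(1) by simp
    define n where "n = int i - 2 * int d"
    let ?X = "L ^ (i - 1) * D" and ?V = "\<Sum>k\<in>{- int d..int d}. cmod (vh k)"
    have X: "cmod (z (n + k)) \<le> ?X" if "- int d \<le> k" "k < int d" for k
    proof -
      have i': "nat (n + k + int d) < i" "int (nat (n + k + int d)) - int d = n + k"
        using that False by (auto simp: n_def)
      have "cmod (z (n + k)) \<le> L ^ nat (n + k + int d) * D" using less[OF i'(1)] unfolding i'(2) .
      also have "\<dots> \<le> ?X" using i'(1) by (intro mult_right_mono power_increasing L(1) D0) auto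
      finally show ?thesis .
    qed
    have "D * 1 \<le> D * L ^ (i - 1)" by (intro mult_left_mono one_le_power L(1) D0)
    then have DX: "D \<le> ?X" by (simp add: mult.commute)
    then have X0: "?X \<ge> 0" using D0 by linarith
    let ?c = "complex_of_real (2 * cos (2 * pi * of_int n * \<alpha>) - E)"
    let ?R = "\<Sum>k\<in>{- int d..<int d}. vh k * z (n + k)"
    have "{- int d..int d} = insert (int d) {- int d..<int d}" by auto
    then have "dual_residual \<alpha> E vh d z n = vh (int d) * z (n + int d) + ?R + ?c * z n"
      unfolding dual_residual_def by simp
    then have "vh (int d) * z (n + int d) = dual_residual \<alpha> E vh d z n - ?R - ?c * z n" by simp
    then have "cmod (vh (int d)) * cmod (z (n + int d)) \<le> cmod (dual_residual \<alpha> E vh d z n) + cmod ?R + cmod (?c * z n)"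
      unfolding norm_mult[symmetric]
      using norm_triangle_ineq4[of "dual_residual \<alpha> E vh d z n - ?R" "?c * z n"]
        norm_triangle_ineq4[of "dual_residual \<alpha> E vh d z n" ?R] by simp
    also have "cmod (dual_residual \<alpha> E vh d z n) \<le> ?X" using res[of n] D DX by linarith
    also have "cmod ?R \<le> ?V * ?X"
    proof -
      have "cmod ?R \<le> (\<Sum>k\<in>{- int d..<int d}. cmod (vh k) * ?X)"
      proof (rule order_trans[OF norm_sum sum_mono])
        fix k assume "k \<in> {- int d..<int d}"
        then show "cmod (vh k * z (n + k)) \<le> cmod (vh k) * ?X"
          unfolding norm_mult by (intro mult_left_mono[OF X]) auto
      qed
      also have "\<dots> \<le> (\<Sum>k\<in>{- int d..int d}. cmod (vh k) * ?X)"
        using X0 by (intro sum_mono2) auto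
      finally show ?thesis by (simp only: sum_distrib_right)
    qed
    also have "cmod (?c * z n) \<le> (2 + \<bar>E\<bar>) * ?X"
    proof -
      have "\<bar>2 * cos (2 * pi * of_int n * \<alpha>)\<bar> \<le> 2"
        using abs_cos_le_one[of "2 * pi * of_int n * \<alpha>"] by (simp add: abs_mult)
      then have "cmod ?c \<le> 2 + \<bar>E\<bar>" unfolding norm_of_real by linarith
      moreover have "cmod (z n) \<le> ?X" using X[of 0] d(1) by simp
      ultimately show ?thesis unfolding norm_mult by (intro mult_mono) auto
    qed
    also have "?X + ?V * ?X + (2 + \<bar>E\<bar>) * ?X = (3 + ?V + \<bar>E\<bar>) * ?X" by (simp add: algebra_simps)
    also have "\<dots> \<le> L * cmod (vh (int d)) * ?X" by (rule mult_right_mono[OF L(2) X0])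
    also have "\<dots> = cmod (vh (int d)) * (L * L ^ (i - 1) * D)" by (simp only: mult_ac)
    also have "L * L ^ (i - 1) = L ^ i" using i0 by (simp add: power_eq_if)
    finally have "cmod (z (n + int d)) \<le> L ^ i * D" using d(2) by simp
    then show ?thesis by (simp add: n_def)
  qed
qed

text \<open>Negative sites follow by reflection. The reflection of \<open>{-d..<d}\<close> contains
  the site \<open>d\<close>, so its starting bound is taken from the forward estimate at the cost
  \<open>L ^ (2 * d)\<close>; hence the \<open>3 * d\<close>.\<close>

lemma propagate:
  assumes d: "d \<ge> 1" "vh (int d) \<noteq> 0" and sym: "\<And>k. \<bar>k\<bar> \<le> int d \<Longrightarrow> vh (- k) = cnj (vh k)"
    and res: "\<And>n. cmod (dual_residual \<alpha> E vh d z n) \<le> \<epsilon>" and D: "\<epsilon> \<le> D"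
    and base: "\<And>j. - int d \<le> j \<Longrightarrow> j < int d \<Longrightarrow> cmod (z j) \<le> D"
    and L: "L \<ge> 1" "3 + (\<Sum>k\<in>{- int d..int d}. cmod (vh k)) + \<bar>E\<bar> \<le> L * cmod (vh (int d))"
  shows "cmod (z j) \<le> L ^ (nat \<bar>j\<bar> + 3 * d) * D"
proof -
  have D0: "D \<ge> 0" using order_trans[OF order_trans[OF norm_ge_zero res] D] .
  have fw: "cmod (z (int i - int d)) \<le> L ^ i * D" for i
    by (rule propagate_forward[where vh=vh, OF d res D base L])
  show ?thesis
  proof (cases "j \<ge> 0")
    case True
    have "cmod (z j) \<le> L ^ (nat j + d) * D" using fw[of "nat j + d"] True by simp
    also have "\<dots> \<le> L ^ (nat \<bar>j\<bar> + 3 * d) * D"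
      using True by (intro mult_right_mono power_increasing L(1) D0) auto
    finally show ?thesis .
  next
    case False
    let ?w = "\<lambda>n. cnj (z (- n))"
    have "cmod (dual_residual \<alpha> E vh d ?w n) \<le> \<epsilon>" for n
    proof -
      have "dual_residual \<alpha> E vh d ?w n = cnj (dual_residual \<alpha> E vh d z (- n))"
        by (rule dual_residual_cnj_reflect) (rule sym)
      then show ?thesis using res[of "- n"] by simp
    qed
    moreover have "\<epsilon> \<le> L ^ (2 * d) * D"
    proof -
      have "D * 1 \<le> D * L ^ (2 * d)" by (intro mult_left_mono one_le_power L(1) D0)
      then show ?thesis using D by (simp add: mult.commute)
    qed
    moreover have "cmod (?w i) \<le> L ^ (2 * d) * D" if "- int d \<le> i" "i < int d" for i
    proof -
      have "cmod (z (- i)) \<le> L ^ nat (- i + int d) * D" using fw[of "nat (- i + int d)"] that by simp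
      also have "\<dots> \<le> L ^ (2 * d) * D" using that by (intro mult_right_mono power_increasing L(1) D0) auto
      finally show ?thesis by simp
    qed
    ultimately have "cmod (?w (int (nat (- j) + d) - int d)) \<le> L ^ (nat (- j) + d) * (L ^ (2 * d) * D)"
      by (rule propagate_forward[where vh=vh, OF d _ _ _ L])
    also have "\<dots> = L ^ (nat \<bar>j\<bar> + 3 * d) * D"
    proof -
      have "nat \<bar>j\<bar> + 3 * d = (nat (- j) + d) + 2 * d" using False by simp
      then show ?thesis by (simp only: power_add mult.assoc)
    qed
    finally show ?thesis using False by simp
  qed
qed

section \<open>Balancing the exponential rates\<close>

context dual_splitting begin

lemma no_approximate_solutions:
  assumes h: "h > 0" and M: "M > 0"
    and H: "approx_dual_solutions \<alpha> E vh d h M"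
  shows False
proof -
  let ?vd = "cmod (vh (int d))" and ?V = "\<Sum>k\<in>{- int d..int d}. cmod (vh k)"
  have vd: "?vd > 0" using lead by simp
  obtain L0 where L0: "\<And>\<theta>. entry_sum (dualL E vh d \<theta>) \<le> L0" using dualL_entry_sum_bound[of E vh d] by blast
  \<comment> \<open>A growth rate per site: \<open>exp lam\<close> dominates both the one-step error
    factor \<open>L0 + 1\<close> and the factor needed in \<open>propagate\<close>.\<close>
  define lam where "lam = max 1 (max L0 ((3 + ?V + \<bar>E\<bar>) / ?vd))"
  have lam: "lam \<ge> 1" "L0 \<le> lam" "(3 + ?V + \<bar>E\<bar>) / ?vd \<le> lam" by (auto simp: lam_def)
  have L0': "0 \<le> L0" "L0 + 1 \<le> exp lam"
    using order_trans[OF entry_sum_nonneg L0] exp_ge_add_one_self[of lam] lam by linarith+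
  have L: "exp lam \<ge> 1" "3 + ?V + \<bar>E\<bar> \<le> exp lam * ?vd"
  proof -
    show "exp lam \<ge> 1" using lam by simp
    have "3 + ?V + \<bar>E\<bar> \<le> lam * ?vd" using lam(3) vd by (simp add: field_simps)
    moreover have "lam \<le> exp lam" using exp_ge_add_one_self[of lam] by linarith
    then have "lam * ?vd \<le> exp lam * ?vd" using vd by (intro mult_right_mono) auto
    ultimately show "3 + ?V + \<bar>E\<bar> \<le> exp lam * ?vd" by linarith
  qed
  obtain \<tau> where \<tau>: "\<tau> > 0" and nd: "\<And>j \<eta> \<mu> p1 p2 q1 q2.
    p1 \<in> carrier_vec (2 * d) \<Longrightarrow> p2 \<in> carrier_vec (2 * d) \<Longrightarrow> q1 \<in> carrier_vec (2 * d) \<Longrightarrow> q2 \<in> carrier_vec (2 * d) \<Longrightarrow>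
    0 < \<mu> \<Longrightarrow> 0 \<le> \<eta> \<Longrightarrow> (\<forall>a b. \<mu> * (cmod a + cmod b) \<le> cvnorm (a \<cdot>\<^sub>v p1 + b \<cdot>\<^sub>v p2)) \<Longrightarrow>
    cvnorm (An (j * N) 0 *\<^sub>v p1) \<le> \<eta> \<Longrightarrow> cvnorm (An (j * N) 0 *\<^sub>v p2) \<le> \<eta> \<Longrightarrow>
    cvnorm q1 \<le> \<eta> \<Longrightarrow> cvnorm q2 \<le> \<eta> \<Longrightarrow>
    cvnorm (p1 - An (j * N) (- (real (j * N) * \<alpha>)) *\<^sub>v q1) \<le> \<eta> \<Longrightarrow>
    cvnorm (p2 - An (j * N) (- (real (j * N) * \<alpha>)) *\<^sub>v q2) \<le> \<eta> \<Longrightarrow> \<tau> * \<mu> < \<eta>"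
    using no_decaying_pair by blast
  \<comment> \<open>Rates per unit of \<open>q\<close>. Over the time \<open>\<nu> q\<close> errors
    grow by at most \<open>exp (h q / 2)\<close>, half of what the residual permits. Then \<rho> is
    a rate at which those errors and the windows at distance \<open>\<nu> q\<close> are small.
    Beyond distance \<open>\<kappa> q\<close> the solutions are negligible; reaching that distance
    from the central window costs \<open>exp ((lam + 2) \<kappa> q)\<close>, the 2 being for the
    number of sites. The choice of \<gamma> lets this cost at most half of \<rho>.\<close>
  define \<nu> where "\<nu> = h / (2 * lam)"
  define \<rho> where "\<rho> = min (h * \<nu> / 2) (h / 2)"
  define \<gamma> where "\<gamma> = min (\<rho> * h / (4 * (lam + 2))) (h * \<nu> / 2)"
  define \<kappa> where "\<kappa> = 2 * \<gamma> / h"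
  define C5 where "C5 = 2 * M * exp ((lam + 2) + 3 * real d * lam)"
  define C6 where "C6 = max (2 * real d * M * exp (h * (real d + real N))) (M / ?vd)"
  have \<nu>: "\<nu> > 0" using h lam by (simp add: \<nu>_def)
  have \<rho>: "\<rho> > 0" "\<rho> \<le> h * \<nu> / 2" "\<rho> \<le> h / 2" using h \<nu> by (auto simp: \<rho>_def)
  have "0 < \<rho> * h / (4 * (lam + 2))" using h \<rho>(1) lam(1) by simp
  then have \<gamma>: "\<gamma> > 0" "\<gamma> \<le> \<rho> * h / (4 * (lam + 2))" "\<gamma> \<le> h * \<nu> / 2"
    using h \<nu> unfolding \<gamma>_def by (simp_all only: min_less_iff_conj min.cobounded1 min.cobounded2) simp
  have \<kappa>: "\<kappa> > 0" "(lam + 2) * \<kappa> \<le> \<rho> / 2"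
  proof -
    show "\<kappa> > 0" using \<gamma> h by (simp add: \<kappa>_def)
    have "(lam + 2) * \<kappa> \<le> (lam + 2) * (2 * (\<rho> * h / (4 * (lam + 2))) / h)"
      unfolding \<kappa>_def using lam h \<gamma>(2) by (intro mult_left_mono divide_right_mono) auto
    also have "\<dots> = \<rho> / 2"
    proof -
      have gen: "l * (2 * (r * h' / (4 * l)) / h') = r / 2" if "l > 0" "h' > 0" for l r h' :: real
        using that by simp
      show ?thesis by (rule gen) (use lam(1) h in simp_all)
    qed
    finally show "(lam + 2) * \<kappa> \<le> \<rho> / 2" .
  qed
  have C5: "C5 > 0" using M by (simp add: C5_def)
  have C6: "C6 > 0" "2 * real d * M * exp (h * (real d + real N)) \<le> C6" "M / ?vd \<le> C6"
    using M vd by (auto simp: C6_def less_max_iff_disj)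
  \<comment> \<open>The three thresholds are those for which \<open>x <= exp x\<close> suffices to
    beat fixed constants by exponentials in \<open>q\<close>.\<close>
  obtain Q :: nat where Q: "max (2 * M / \<gamma>) (max (4 * C5 * M / h) (8 * C5 * C6 / (\<tau> * \<rho>))) < real Q"
    using reals_Archimedean2 by blast
  obtain q z z' where q: "q > Q"
    and z: "\<And>n. cmod (z n) \<le> M * exp (\<gamma> * real q - h * \<bar>of_int n\<bar>)"
    and z': "\<And>n. cmod (z' n) \<le> M * exp (\<gamma> * real q - h * \<bar>of_int n\<bar>)"
    and rz: "\<And>n. cmod (dual_residual \<alpha> E vh d z n) \<le> M * exp (- h * real q)"
    and rz': "\<And>n. cmod (dual_residual \<alpha> E vh d z' n) \<le> M * exp (- h * real q)"
    and low: "\<And>a b K. cmod a + cmod b \<le> M * ((\<Sum>k | \<bar>k\<bar> < int K. cmod (a * z k + b * z' k))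
      + (cmod a + cmod b) * exp (\<gamma> * real q - h * real K))"
    using H[unfolded approx_dual_solutions_def, rule_format, OF \<gamma>(1), of Q] by blast
  have large: "2 * M \<le> exp (\<gamma> * real q)" "2 * C5 * M \<le> exp (h / 2 * real q)" "4 * C5 * C6 / \<tau> \<le> exp (\<rho> / 2 * real q)"
  proof -
    have ex: "x \<le> exp x" for x :: real using exp_ge_add_one_self[of x] by linarith
    have l: "2 * M / \<gamma> < real q" "4 * C5 * M / h < real q" "8 * C5 * C6 / (\<tau> * \<rho>) < real q" using Q q by auto
    have "2 * M \<le> \<gamma> * real q" using l(1) \<gamma>(1) by (simp add: field_simps)
    then show "2 * M \<le> exp (\<gamma> * real q)" using ex[of "\<gamma> * real q"] by linarith
    have "2 * C5 * M \<le> h / 2 * real q" using l(2) h by (simp add: field_simps)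
    then show "2 * C5 * M \<le> exp (h / 2 * real q)" using ex[of "h / 2 * real q"] by linarith
    have "4 * C5 * C6 / \<tau> \<le> \<rho> / 2 * real q" using l(3) \<tau> \<rho>(1) by (simp add: field_simps)
    then show "4 * C5 * C6 / \<tau> \<le> exp (\<rho> / 2 * real q)" using ex[of "\<rho> / 2 * real q"] by linarith
  qed
  define K where "K = nat \<lceil>\<kappa> * real q\<rceil>"
  have K: "\<kappa> * real q \<le> real K" "real K \<le> \<kappa> * real q + 1"
  proof -
    have "0 \<le> \<kappa> * real q" using \<kappa> by simp
    then show "\<kappa> * real q \<le> real K" "real K \<le> \<kappa> * real q + 1" unfolding K_def by linarith+
  qed
  \<comment> \<open>The time is rounded down to a multiple of \<open>N\<close>, the step in which
    domination is given. The rounding is paid for by \<open>real N\<close> in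
    \<open>C6\<close>.\<close>
  define j where "j = nat \<lfloor>\<nu> * real q / real N\<rfloor>"
  let ?n = "j * N"
  have n: "real ?n \<le> \<nu> * real q" "\<nu> * real q - real N \<le> real ?n"
  proof -
    have N0: "real N > 0" using N_pos by simp
    have "0 \<le> \<nu> * real q / real N" using \<nu> by simp
    then have j: "real j \<le> \<nu> * real q / real N" "\<nu> * real q / real N \<le> real j + 1" unfolding j_def by linarith+
    show "real ?n \<le> \<nu> * real q" using j(1) N0 by (simp add: field_simps)
    show "\<nu> * real q - real N \<le> real ?n" using j(2) N0 by (simp add: field_simps)
  qed
  let ?mu = "exp (- ((lam + 2) * \<kappa>) * real q) / (2 * C5)" and ?eta = "2 * C6 * exp (- \<rho> * real q)"
  have lower: "?mu * (cmod a + cmod b) \<le> cvnorm (a \<cdot>\<^sub>v window d z 0 + b \<cdot>\<^sub>v window d z' 0)" for a b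
  proof -
    let ?S = "cmod a + cmod b" and ?y = "\<lambda>n. a * z n + b * z' n"
    let ?eps = "?S * (M * exp (- h * real q))"
    \<comment> \<open>The residual bound is included because \<open>propagate\<close> wants
      \<open>D\<close> to be at least as large. At the end it is at most half of the lower bound for
      \<open>D\<close> and is subtracted again.\<close>
    define D where "D = cvnorm (window d ?y 0) + ?eps"
    have res: "cmod (dual_residual \<alpha> E vh d ?y n) \<le> ?eps" for n
    proof -
      have "cmod (dual_residual \<alpha> E vh d ?y n) \<le> cmod a * cmod (dual_residual \<alpha> E vh d z n) + cmod b * cmod (dual_residual \<alpha> E vh d z' n)"
        unfolding dual_residual_lincomb by (rule order_trans[OF norm_triangle_ineq]) (simp add: norm_mult)
      also have "\<dots> \<le> cmod a * (M * exp (- h * real q)) + cmod b * (M * exp (- h * real q))"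
        by (intro add_mono mult_left_mono rz rz') auto
      finally show ?thesis by (simp only: distrib_right)
    qed
    have D: "?eps \<le> D" "D \<ge> 0" using M by (simp_all add: D_def)
    have base: "cmod (?y i) \<le> D" if "- int d \<le> i" "i < int d" for i
      using cmod_le_cvnorm_window[of 0 d i ?y] that M by (simp add: D_def add_increasing2)
    have grow: "cmod (?y i) \<le> exp lam ^ (nat \<bar>i\<bar> + 3 * d) * D" for i
      by (rule propagate[where vh=vh and z="?y", OF d_pos lead sym res D(1) base L])
    \<comment> \<open>By the choice of \<kappa> the tail beyond \<open>K\<close> has size at most
      \<open>exp (- \<gamma> q)\<close>, so its term in \<open>low\<close> is at most half of the
      left-hand side.\<close>
    have "M * exp (\<gamma> * real q - h * real K) \<le> 1 / 2"
    proof -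
      have "2 * \<gamma> * real q = h * (\<kappa> * real q)" using h by (simp add: \<kappa>_def)
      also have "\<dots> \<le> h * real K" using h by (intro mult_left_mono K) simp
      finally have "exp (\<gamma> * real q - h * real K) \<le> exp (- (\<gamma> * real q))" by simp
      then have "M * exp (\<gamma> * real q - h * real K) \<le> M * exp (- (\<gamma> * real q))" using M by (intro mult_left_mono) auto
      also have "\<dots> \<le> 1 / 2" using large(1) by (simp add: exp_minus field_simps)
      finally show ?thesis .
    qed
    then have e2: "?S * (M * exp (\<gamma> * real q - h * real K)) \<le> ?S * (1 / 2)" by (intro mult_left_mono) auto
    have "s \<le> 2 * M * t" if "s \<le> M * (t + s * e)" "s * (M * e) \<le> s * (1 / 2)" for s t e
      using that by (simp add: distrib_left mult.left_commute)
    from this[OF low e2] have "?S \<le> 2 * M * (\<Sum>k | \<bar>k\<bar> < int K. cmod (?y k))" .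
    also have "\<dots> \<le> 2 * M * (exp (2 * real K) * (exp (lam * (real K + 3 * real d)) * D))"
    proof (rule mult_left_mono)
      have "(\<Sum>k | \<bar>k\<bar> < int K. cmod (?y k)) \<le> real (card {k::int. \<bar>k\<bar> < int K}) * (exp lam ^ (K + 3 * d) * D)"
      proof (rule sum_bounded_above)
        fix k assume "k \<in> {k::int. \<bar>k\<bar> < int K}"
        then have "exp lam ^ (nat \<bar>k\<bar> + 3 * d) * D \<le> exp lam ^ (K + 3 * d) * D"
          using L(1) D(2) by (intro mult_right_mono power_increasing) auto
        then show "cmod (?y k) \<le> exp lam ^ (K + 3 * d) * D" using grow[of k] by linarith
      qed
      also have "exp lam ^ (K + 3 * d) = exp (lam * (real K + 3 * real d))"
        by (simp add: exp_of_nat_mult[symmetric] mult.commute)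
      also have "real (card {k::int. \<bar>k\<bar> < int K}) * (exp (lam * (real K + 3 * real d)) * D)
          \<le> exp (2 * real K) * (exp (lam * (real K + 3 * real d)) * D)"
      proof (rule mult_right_mono)
        have "card {k::int. \<bar>k\<bar> < int K} \<le> card {- int K..<int K}" by (intro card_mono) auto
        then have "real (card {k::int. \<bar>k\<bar> < int K}) \<le> 2 * real K" by simp
        also have "\<dots> \<le> exp (2 * real K)" using exp_ge_add_one_self[of "2 * real K"] by linarith
        finally show "real (card {k::int. \<bar>k\<bar> < int K}) \<le> exp (2 * real K)" .
      qed (use D(2) in simp)
      finally show "(\<Sum>k | \<bar>k\<bar> < int K. cmod (?y k)) \<le> exp (2 * real K) * (exp (lam * (real K + 3 * real d)) * D)" .
    qed (use M in simp)
    also have "\<dots> = 2 * M * exp ((lam + 2) * real K + 3 * real d * lam) * D"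
      by (simp add: exp_add algebra_simps)
    also have "\<dots> \<le> 2 * M * exp ((lam + 2) * (\<kappa> * real q + 1) + 3 * real d * lam) * D"
      using M D(2) K(2) lam by (intro mult_right_mono mult_left_mono) auto
    also have "\<dots> = C5 * exp ((lam + 2) * \<kappa> * real q) * D"
      by (simp add: C5_def exp_add algebra_simps)
    finally have S_le: "?S \<le> C5 * exp ((lam + 2) * \<kappa> * real q) * D" .
    have "2 * (exp (- x) / (2 * c) * s) \<le> D" if "s \<le> c * exp x * D" "c > 0" for s c x D :: real
      using that by (simp add: exp_minus field_simps)
    from this[OF S_le C5] have "2 * (?mu * ?S) \<le> D" by (simp only: mult_minus_left)
    moreover have "?eps \<le> ?mu * ?S"
    proof -
      have "exp (h / 2 * real q) \<le> exp ((h - (lam + 2) * \<kappa>) * real q)"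
        using \<kappa>(2) \<rho>(3) h by (intro exp_le_cancel_iff[THEN iffD2] mult_right_mono) auto
      then have "2 * C5 * M \<le> exp ((h - (lam + 2) * \<kappa>) * real q)" using large(2) by linarith
      also have "\<dots> = exp (- ((lam + 2) * \<kappa>) * real q) * exp (h * real q)"
        by (simp add: exp_add[symmetric] algebra_simps)
      finally have "M * exp (- h * real q) \<le> ?mu"
        using C5 by (simp add: exp_minus field_simps)
      then have "?S * (M * exp (- h * real q)) \<le> ?S * ?mu" by (intro mult_left_mono) auto
      then show ?thesis by (simp only: mult.commute)
    qed
    ultimately have "?mu * ?S \<le> cvnorm (window d ?y 0)" by (simp add: D_def)
    then show ?thesis by (simp only: window_lincomb)
  qed
  have err: "cvnorm (window d w (s + int ?n) - An ?n (of_int s * \<alpha>) *\<^sub>v window d w s) \<le> C6 * exp (- \<rho> * real q)"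
    if rw: "\<And>n. cmod (dual_residual \<alpha> E vh d w n) \<le> M * exp (- h * real q)" for w s
  proof -
    have "cvnorm (window d w (s + int ?n) - An ?n (of_int s * \<alpha>) *\<^sub>v window d w s)
        \<le> M * exp (- h * real q) / ?vd * (L0 + 1) ^ ?n"
      by (rule window_error[where vh=vh, OF d_pos lead L0 rw])
    also have "\<dots> \<le> M * exp (- h * real q) / ?vd * exp (h / 2 * real q)"
    proof (rule mult_left_mono)
      have "(L0 + 1) ^ ?n \<le> exp lam ^ ?n" using L0' by (intro power_mono) auto
      also have "\<dots> = exp (real ?n * lam)" by (rule exp_of_nat_mult[symmetric])
      also have "\<dots> \<le> exp (h / 2 * real q)"
      proof -
        have "real ?n * lam \<le> \<nu> * real q * lam" using lam by (intro mult_right_mono n) auto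
        also have "\<dots> = h / 2 * real q" using lam by (simp add: \<nu>_def field_simps)
        finally show ?thesis by simp
      qed
      finally show "(L0 + 1) ^ ?n \<le> exp (h / 2 * real q)" .
    qed (use M in simp)
    also have "\<dots> = M / ?vd * exp (- (h / 2) * real q)"
    proof -
      have "exp (- h * real q) * exp (h / 2 * real q) = exp (- (h / 2) * real q)"
        unfolding exp_add[symmetric] by (simp add: field_simps)
      then show ?thesis by (simp add: field_simps)
    qed
    also have "\<dots> \<le> C6 * exp (- \<rho> * real q)"
    proof (rule mult_mono[OF C6(3)])
      have "\<rho> * real q \<le> h / 2 * real q" using \<rho>(3) by (rule mult_right_mono) simp
      then show "exp (- (h / 2) * real q) \<le> exp (- \<rho> * real q)" by simp
    qed (use C6(1) in simp_all)
    finally show ?thesis .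
  qed
  \<comment> \<open>At distance \<open>\<nu> q\<close> the solutions decay at rate
    \<open>h \<nu>\<close>, of which the loss \<gamma> takes at most half; at least \<rho>
    remains.\<close>
  have far: "cvnorm (window d w s) \<le> C6 * exp (- \<rho> * real q)"
    if w: "\<And>n. cmod (w n) \<le> M * exp (\<gamma> * real q - h * \<bar>of_int n\<bar>)" and s: "\<bar>s\<bar> = int ?n" for w s
  proof -
    have "cvnorm (window d w s) \<le> 2 * real d * (M * exp (h * (real d + real N)) * exp (- \<rho> * real q))"
    proof (rule cvnorm_window_le)
      fix i assume i: "s - int d \<le> i" "i < s + int d"
      have "int ?n - int d \<le> \<bar>i\<bar>" using i s by linarith
      then have "of_int (int ?n - int d) \<le> (of_int \<bar>i\<bar> :: real)" by (simp only: of_int_le_iff)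
      then have "real ?n - real d \<le> \<bar>of_int i\<bar>" by simp
      then have "h * (\<nu> * real q - real N - real d) \<le> h * \<bar>of_int i\<bar>"
        using n(2) h by (intro mult_left_mono) auto
      moreover have "\<gamma> * real q \<le> h * \<nu> / 2 * real q" using \<gamma>(3) by (intro mult_right_mono) auto
      moreover have "\<rho> * real q \<le> h * \<nu> / 2 * real q" using \<rho>(2) by (intro mult_right_mono) auto
      ultimately have "\<gamma> * real q - h * \<bar>of_int i\<bar> \<le> h * (real d + real N) + - \<rho> * real q"
        by (simp add: algebra_simps)
      then have "M * exp (\<gamma> * real q - h * \<bar>of_int i\<bar>) \<le> M * (exp (h * (real d + real N)) * exp (- \<rho> * real q))"
        unfolding exp_add[symmetric] using M by (intro mult_left_mono) auto
      then show "cmod (w i) \<le> M * exp (h * (real d + real N)) * exp (- \<rho> * real q)"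
        using w[of i] by (simp only: mult.assoc)
    qed
    also have "\<dots> = (2 * real d * M * exp (h * (real d + real N))) * exp (- \<rho> * real q)" by (simp only: mult.assoc)
    also have "\<dots> \<le> C6 * exp (- \<rho> * real q)" by (intro mult_right_mono C6) simp
    finally show ?thesis .
  qed
  have half: "C6 * exp (- \<rho> * real q) \<le> ?eta" using C6 by simp
  have fw: "cvnorm (An ?n 0 *\<^sub>v window d w 0) \<le> ?eta"
    if w: "\<And>n. cmod (w n) \<le> M * exp (\<gamma> * real q - h * \<bar>of_int n\<bar>)"
      and rw: "\<And>n. cmod (dual_residual \<alpha> E vh d w n) \<le> M * exp (- h * real q)" for w
  proof -
    have c: "An ?n 0 *\<^sub>v window d w 0 \<in> carrier_vec (2 * d)" by (rule An_vec_carrier) simp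
    have "An ?n 0 *\<^sub>v window d w 0 = window d w (int ?n) - (window d w (int ?n) - An ?n 0 *\<^sub>v window d w 0)"
      using carrier_vecD[OF c] carrier_vecD[OF window_carrier[of d w "int ?n"]]
      by (intro eq_vecI) (simp_all del: index_mult_mat_vec dim_mult_mat_vec)
    then have "cvnorm (An ?n 0 *\<^sub>v window d w 0)
        \<le> cvnorm (window d w (int ?n)) + cvnorm (window d w (int ?n) - An ?n 0 *\<^sub>v window d w 0)"
      using cvnorm_diff[OF window_carrier[of d w "int ?n"] minus_carrier_vec[OF window_carrier c]] by metis
    then show ?thesis using far[OF w, of "int ?n"] err[OF rw, of 0] by simp
  qed
  have bw: "cvnorm (window d w 0 - An ?n (- (real ?n * \<alpha>)) *\<^sub>v window d w (- int ?n)) \<le> ?eta"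
    if rw: "\<And>n. cmod (dual_residual \<alpha> E vh d w n) \<le> M * exp (- h * real q)" for w
    using err[OF rw, of "- int ?n"] half by simp
  have "\<tau> * ?mu < ?eta"
  proof (rule nd)
    show "0 < ?mu" using C5 by simp
    show "0 \<le> ?eta" using C6 by simp
    show "\<forall>a b. ?mu * (cmod a + cmod b) \<le> cvnorm (a \<cdot>\<^sub>v window d z 0 + b \<cdot>\<^sub>v window d z' 0)"
      using lower by blast
    show "cvnorm (An ?n 0 *\<^sub>v window d z 0) \<le> ?eta" "cvnorm (An ?n 0 *\<^sub>v window d z' 0) \<le> ?eta"
      by (rule fw[OF z rz], rule fw[OF z' rz'])
    show "cvnorm (window d z (- int ?n)) \<le> ?eta" "cvnorm (window d z' (- int ?n)) \<le> ?eta"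
      by (rule order_trans[OF far[OF z] half], simp, rule order_trans[OF far[OF z'] half], simp)
    show "cvnorm (window d z 0 - An ?n (- (real ?n * \<alpha>)) *\<^sub>v window d z (- int ?n)) \<le> ?eta"
      "cvnorm (window d z' 0 - An ?n (- (real ?n * \<alpha>)) *\<^sub>v window d z' (- int ?n)) \<le> ?eta"
      by (rule bw[OF rz], rule bw[OF rz'])
  qed simp_all
  \<comment> \<open>The small quantity decays at rate \<rho> and the independence bound at a rate of
    at most half of \<rho>, so for large \<open>q\<close> the inequality just obtained is
    reversed.\<close>
  moreover have "?eta \<le> \<tau> * ?mu"
  proof -
    have "exp (\<rho> / 2 * real q) \<le> exp ((\<rho> - (lam + 2) * \<kappa>) * real q)"
      using \<kappa>(2) by (intro exp_le_cancel_iff[THEN iffD2] mult_right_mono) auto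
    then have "4 * C5 * C6 / \<tau> \<le> exp ((\<rho> - (lam + 2) * \<kappa>) * real q)" using large(3) by linarith
    also have "\<dots> = exp (- ((lam + 2) * \<kappa>) * real q) * exp (\<rho> * real q)"
      by (simp add: exp_add[symmetric] algebra_simps)
    finally show ?thesis using C5 \<tau> by (simp add: exp_minus field_simps)
  qed
  ultimately show False by simp
qed

end

section \<open>Assembling the two halves\<close>

lemma trigpoly_eq_ee: "trigpoly vh d x = (\<Sum>k\<in>{- int d..int d}. vh k * ee k x)"
  unfolding trigpoly_def ee_def cis_conv_exp by (simp add: mult_ac)

text \<open>This symmetry is what conserves the form and makes reflected conjugates of solutions
  solutions again; it is read off by comparing the coefficients of the polynomial with those of its
  conjugate.\<close>

lemma trigpoly_real_coeffs:
  assumes "\<forall>x. Im (trigpoly vh d x) = 0" and k: "\<bar>k\<bar> \<le> int d"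
  shows "vh (- k) = cnj (vh k)"
proof -
  let ?P = "\<lambda>x. \<Sum>k\<in>{- int d..int d}. vh k * ee k x"
  have real: "cnj w = w" if "Im w = 0" for w using that by (simp add: complex_eq_iff)
  have "cnj (?P x) = ?P x" for x
    by (rule real) (use assms(1) in \<open>simp only: trigpoly_eq_ee\<close>)
  then have "fc (\<lambda>x. cnj (?P x)) (- k) = fc ?P (- k)" by (simp only:)
  moreover have "fc (\<lambda>x. cnj (?P x)) (- k) = cnj (fc ?P k)" using fc_cnj[of ?P "- k"] by simp
  ultimately show ?thesis using k by (simp add: fc_trig abs_le_iff)
qed

lemma analytic_periodic_bounded:
  assumes "analytic_periodic b"
  shows "\<exists>C. \<forall>x. \<bar>b x\<bar> \<le> C"
proof -
  obtain C where "\<And>y j. \<bar>(deriv ^^ j) b y\<bar> \<le> fact j * C ^ Suc j"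
    using analytic_periodic_derivative_bound[OF assms] by blast
  from this[of 0] show ?thesis by auto
qed

lemma analytic_periodic_deriv: "analytic_periodic b \<Longrightarrow> (b has_real_derivative deriv b x) (at x)"
  using real_analytic_higher_derivative[of b 0 x] by (simp add: analytic_periodic_def)

lemma weaker_decay:
  assumes "\<And>k. cmod (c k) \<le> M * exp (- h * \<bar>of_int k\<bar>)" and "h' \<le> h"
  shows "cmod (c k) \<le> M * exp (- h' * \<bar>of_int k\<bar>)"
proof -
  have "M \<ge> 0" using order_trans[OF norm_ge_zero assms(1)[of 0]] by simp
  moreover have "h' * \<bar>of_int k\<bar> \<le> h * \<bar>of_int k :: real\<bar>" using assms(2) by (rule mult_right_mono) simp
  ultimately have "M * exp (- h * \<bar>of_int k\<bar>) \<le> M * exp (- h' * \<bar>of_int k\<bar>)"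
    by (intro mult_left_mono) auto
  then show ?thesis using assms(1)[of k] by linarith
qed

theorem theorem1p6:
  fixes \<alpha> E :: real and d :: nat and vh :: "int \<Rightarrow> complex"
  assumes irrational: "\<alpha> \<notin> \<rat>"
    and deg: "d \<ge> 1" "vh (int d) \<noteq> 0"
    and real_valued: "\<forall>x. Im (trigpoly vh d x) = 0"
    and ph2: "PH2 d \<alpha> (dualL E vh d)"
  shows "\<not> (\<exists>(B :: real \<Rightarrow> real^2^2) (\<psi> :: real \<Rightarrow> real).
            analytic_SL2 B \<and> analytic_periodic \<psi> \<and> integral {0..1} \<psi> = 0 \<and>
            (\<forall>x. matrix_inv (B (x + \<alpha>)) ** SE E (\<lambda>y. Re (trigpoly vh d y)) x ** B x = Rot (\<psi> x)))"
proof
  assume "\<exists>(B :: real \<Rightarrow> real^2^2) (\<psi> :: real \<Rightarrow> real).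
            analytic_SL2 B \<and> analytic_periodic \<psi> \<and> integral {0..1} \<psi> = 0 \<and>
            (\<forall>x. matrix_inv (B (x + \<alpha>)) ** SE E (\<lambda>y. Re (trigpoly vh d y)) x ** B x = Rot (\<psi> x))"
  then obtain B :: "real \<Rightarrow> real^2^2" and \<psi> :: "real \<Rightarrow> real" where B: "analytic_SL2 B"
    and psi: "analytic_periodic \<psi>" "integral {0..1} \<psi> = 0"
    and conj: "\<And>x. matrix_inv (B (x + \<alpha>)) ** SE E (\<lambda>y. Re (trigpoly vh d y)) x ** B x = Rot (\<psi> x)"
    by blast
  let ?b = "\<lambda>i j x. vec_nth (vec_nth (B x) i) j"
  let ?V = "\<lambda>x. Re (trigpoly vh d x)"
  have an: "analytic_periodic (?b i j)" for i j using B by (simp add: analytic_SL2_def)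
  have det: "Determinants.det (B x) = 1" for x using B by (simp add: analytic_SL2_def)
  have prod: "SE E ?V x ** B x = B (x + \<alpha>) ** Rot (\<psi> x)" for x
  proof -
    have "invertible (B (x + \<alpha>))" by (simp add: invertible_det_nz det)
    then have "B (x + \<alpha>) ** matrix_inv (B (x + \<alpha>)) = Finite_Cartesian_Product.mat 1"
      unfolding invertible_def matrix_inv_def by (rule someI2_ex) (rule conjunct1)
    then show ?thesis unfolding conj[of x, symmetric] by (simp only: matrix_mul_assoc matrix_mul_lid)
  qed
  define f where "f x = Complex (?b 1 1 x) (- ?b 1 2 x)" for x
  define g where "g x = Complex (?b 2 1 x) (- ?b 2 2 x)" for x
  have sym: "\<And>k. \<bar>k\<bar> \<le> int d \<Longrightarrow> vh (- k) = cnj (vh k)"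
    by (rule trigpoly_real_coeffs[OF real_valued])
  have V: "(\<Sum>k\<in>{- int d..int d}. vh k * ee k x) = of_real (?V x)" for x
  proof -
    have "trigpoly vh d x = of_real (?V x)" using real_valued by (simp add: complex_eq_iff)
    then show ?thesis by (simp only: trigpoly_eq_ee)
  qed
  have entries:
    "(E - ?V x) * ?b 1 j x - ?b 2 j x = vec_nth (vec_nth (B (x + \<alpha>) ** Rot (\<psi> x)) 1) j"
    "?b 1 j x = vec_nth (vec_nth (B (x + \<alpha>) ** Rot (\<psi> x)) 2) j" for x j
    unfolding prod[symmetric] by (simp_all add: matrix_matrix_mult_def SE_def sum_2)
  have rot: "vec_nth (vec_nth (B (x + \<alpha>) ** Rot (\<psi> x)) i) 1
      = ?b i 1 (x + \<alpha>) * cos (2 * pi * \<psi> x) + ?b i 2 (x + \<alpha>) * sin (2 * pi * \<psi> x)"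
    "vec_nth (vec_nth (B (x + \<alpha>) ** Rot (\<psi> x)) i) 2
      = - ?b i 1 (x + \<alpha>) * sin (2 * pi * \<psi> x) + ?b i 2 (x + \<alpha>) * cos (2 * pi * \<psi> x)" for x i
    by (simp_all add: matrix_matrix_mult_def Rot_def sum_2)
  have eq1: "(of_real E - (\<Sum>k\<in>{- int d..int d}. vh k * ee k x)) * f x - g x = cis (2 * pi * \<psi> x) * f (x + \<alpha>)" for x
    unfolding V of_real_diff[symmetric]
    using entries(1)[of x 1] entries(1)[of x 2] unfolding rot
    by (simp add: complex_eq_iff f_def g_def algebra_simps)
  have eq2: "f x = cis (2 * pi * \<psi> x) * g (x + \<alpha>)" for x
    using entries(2)[where x=x and j=1] entries(2)[where x=x and j=2] unfolding rot
    by (simp add: complex_eq_iff f_def g_def algebra_simps)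
  have wronski: "f x * cnj (g x) - cnj (f x) * g x = 2 * \<i>" for x
    using det[of x] by (simp add: complex_eq_iff f_def g_def det_2 algebra_simps)
  obtain M1 h1 where 1: "h1 > 0" "\<And>k. cmod (fc (\<lambda>x. of_real (?b 1 1 x)) k) \<le> M1 * exp (- h1 * \<bar>of_int k\<bar>)"
    using fc_analytic_decay[OF an[of 1 1]] by blast
  obtain M2 h2 where 2: "h2 > 0" "\<And>k. cmod (fc (\<lambda>x. of_real (?b 1 2 x)) k) \<le> M2 * exp (- h2 * \<bar>of_int k\<bar>)"
    using fc_analytic_decay[OF an[of 1 2]] by blast
  obtain M3 h3 where 3: "h3 > 0" "\<And>k. cmod (fc (\<lambda>x. of_real (\<psi> x)) k) \<le> M3 * exp (- h3 * \<bar>of_int k\<bar>)"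
    using fc_analytic_decay[OF psi(1)] by blast
  \<comment> \<open>Half of the rate of \<psi> is taken, because \<open>rotation_reducible\<close>
    wants \<psi> to decay at rate \<open>2 * h\<close>.\<close>
  define h where "h = min h1 (min h2 (h3 / 2))"
  have h: "h > 0" "h \<le> h1" "h \<le> h2" "2 * h \<le> h3" using 1 2 3 by (auto simp: h_def)
  obtain C1 C2 where C: "\<And>x. \<bar>?b 1 1 x\<bar> \<le> C1" "\<And>x. \<bar>?b 1 2 x\<bar> \<le> C2"
    using analytic_periodic_bounded[OF an[of 1 1]] analytic_periodic_bounded[OF an[of 1 2]] by blast
  have bd: "((\<lambda>x. complex_of_real (?b i j x)) has_vector_derivative of_real (deriv (?b i j) x)) (at x)" for i j x
    using analytic_periodic_deriv[OF an[of i j]] by (auto simp: has_real_derivative_iff_has_vector_derivative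
      intro!: bounded_linear.has_vector_derivative[OF bounded_linear_of_real])
  have bc: "continuous_on S (\<lambda>x. complex_of_real (?b i j x))" for i j S
    using bd by (intro continuous_at_imp_continuous_on ballI has_vector_derivative_continuous)
  have f_eq: "f = (\<lambda>x. of_real (?b 1 1 x) + (- \<i>) * of_real (?b 1 2 x))"
    by (simp add: f_def fun_eq_iff complex_eq_iff)
  have "rotation_reducible \<alpha> E d vh f (\<lambda>x. of_real (deriv (?b 1 1) x) + (- \<i>) * of_real (deriv (?b 1 2) x)) g
      \<psi> (deriv \<psi>) h (M1 + M2) M3 (C1 + C2)"
  proof
    show "(f has_vector_derivative of_real (deriv (?b 1 1) x) + (- \<i>) * of_real (deriv (?b 1 2) x)) (at x)" for x
      unfolding f_eq by (intro has_vector_derivative_add has_vector_derivative_mult_right bd)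
    show "f (x + 1) = f x" for x using an by (simp add: f_def analytic_periodic_def)
    show "cmod (f x) \<le> C1 + C2" for x
      using cmod_le[of "f x"] C(1)[of x] C(2)[of x] by (simp add: f_def)
    show "cmod (fc f k) \<le> (M1 + M2) * exp (- h * \<bar>of_int k\<bar>)" for k
    proof -
      have "fc f k = fc (\<lambda>x. of_real (?b 1 1 x)) k + (- \<i>) * fc (\<lambda>x. of_real (?b 1 2 x)) k"
        unfolding f_eq by (subst fc_add) (auto intro!: bc continuous_intros simp only: fc_cmult)
      then have "cmod (fc f k) \<le> cmod (fc (\<lambda>x. of_real (?b 1 1 x)) k) + cmod (fc (\<lambda>x. of_real (?b 1 2 x)) k)"
        using norm_triangle_ineq[of "fc (\<lambda>x. of_real (?b 1 1 x)) k" "(- \<i>) * fc (\<lambda>x. of_real (?b 1 2 x)) k"]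
        by (simp add: norm_mult)
      also have "\<dots> \<le> M1 * exp (- h * \<bar>of_int k\<bar>) + M2 * exp (- h * \<bar>of_int k\<bar>)"
        by (intro add_mono weaker_decay[OF 1(2) h(2)] weaker_decay[OF 2(2) h(3)])
      finally show ?thesis by (simp only: distrib_right)
    qed
    show "fc (\<lambda>x. complex_of_real (\<psi> x)) 0 = 0"
    proof -
      have "continuous_on {0..1} \<psi>"
        using analytic_periodic_deriv[OF psi(1)] by (intro continuous_at_imp_continuous_on ballI DERIV_isCont)
      then have "(\<psi> has_integral 0) {0..1}"
        using psi(2) integrable_integral[OF integrable_continuous_real] by metis
      from has_integral_linear[OF this bounded_linear_of_real]
      have "((\<lambda>x. complex_of_real (\<psi> x)) has_integral 0) {0..1}" by (simp add: o_def)
      then show ?thesis by (simp add: fc_def integral_unique)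
    qed
    show "cmod (fc (\<lambda>x. complex_of_real (\<psi> x)) k) \<le> M3 * exp (- (2 * h) * \<bar>of_int k\<bar>)" for k
      by (rule weaker_decay[OF 3(2) h(4)])
  qed (use psi(1) h(1) irrational sym eq1 eq2 wronski in
      \<open>auto simp: analytic_periodic_def intro: analytic_periodic_deriv\<close>)
  then obtain M where M: "M > 0" "approx_dual_solutions \<alpha> E vh d h M"
    using rotation_reducible.approximate_solutions by blast
  have "dominated (2 * d) \<alpha> (dualL E vh d) (d + 1)" using ph2 by (simp add: PH2_def)
  then obtain Ep Em C N where "dominated_splitting (2 * d) \<alpha> (dualL E vh d) (d + 1) Ep Em C N"
    using dominated_imp_splitting[of "2 * d" \<alpha> "dualL E vh d" "d + 1", OF _ dualL_carrier] by blast
  then interpret dual_splitting d \<alpha> E vh Ep Em C N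
    by (intro dual_splitting.intro dual_splitting_axioms.intro) (use deg sym in auto)
  show False by (rule no_approximate_solutions[OF h(1) M])
qed

end
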